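(* Let $t \geq 2$ be an integer. Every rational number $r \in [1,t]$ is realizable for $K_t$; that is, for every rational $r\in[1,t]$ there exists a finite family of graphs $\mathcal{F}_r$ such that $\mathrm{ex}(n,K_t,\mathcal{F}_r) = \Theta(n^r)$.
   Context: For a graph $H$ and a family of graphs $\mathcal{F}$, $\mathrm{ex}(n,H,\mathcal{F})$ denotes the maximum number of copies of $H$ in an $n$-vertex graph containing no copy (as a subgraph) of any member of $\mathcal{F}$. $f(n)=\Theta(g(n))$ means there are constants $c_1,c_2>0$ with $c_1g(n)\le f(n)\le c_2 g(n)$ for all sufficiently large $n$; the family is fixed and $n\to\infty$. *)

theory Defs
  imports Complex_Main "HOL-Library.Landau_Symbols"
begin

text \<open>Undirected graphs: an edge is the set of its two endpoints.\<close>

record 'a sgraph =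
  verts :: "'a set"
  edges :: "'a set set"

definition simple_graph :: "'a sgraph \<Rightarrow> bool" where
  "simple_graph G \<longleftrightarrow>
     finite (verts G) \<and> (\<forall>e \<in> edges G. e \<subseteq> verts G \<and> card e = 2)"

definition complete_graph :: "nat \<Rightarrow> nat sgraph" where
  "complete_graph t = \<lparr>verts = {..<t}, edges = {e. e \<subseteq> {..<t} \<and> card e = 2}\<rparr>"

definition isomorphic :: "'a sgraph \<Rightarrow> 'b sgraph \<Rightarrow> bool" where
  "isomorphic G H \<longleftrightarrow>
     (\<exists>f. bij_betw f (verts G) (verts H) \<and> edges H = (\<lambda>e. f ` e) ` edges G)"

text \<open>Subgraphs are not necessarily induced.\<close>

definition is_subgraph :: "'a sgraph \<Rightarrow> 'a sgraph \<Rightarrow> bool" where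
  "is_subgraph H G \<longleftrightarrow>
     simple_graph H \<and> verts H \<subseteq> verts G \<and> edges H \<subseteq> edges G"

text \<open>Copies are counted as subgraphs, not as embeddings: one copy contributes one,
  whatever the number of automorphisms of \<open>H\<close>.\<close>

definition copies :: "'b sgraph \<Rightarrow> 'a sgraph \<Rightarrow> 'a sgraph set" where
  "copies H G = {H'. is_subgraph H' G \<and> isomorphic H H'}"

definition free_of :: "'b sgraph set \<Rightarrow> 'a sgraph \<Rightarrow> bool" where
  "free_of \<F> G \<longleftrightarrow> (\<forall>F \<in> \<F>. copies F G = {})"

text \<open>Vertices are natural numbers, which is no restriction since every finite graph is
  isomorphic to one of this kind. The supremum is a maximum (lemma \<open>gen_ex_attained\<close> below),
  except that it is 0 if there is no \<open>n\<close>-vertex graph free of \<open>\<F>\<close>.\<close>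

definition copy_counts :: "nat \<Rightarrow> nat sgraph \<Rightarrow> nat sgraph set \<Rightarrow> nat set" where
  "copy_counts n H \<F> =
     {card (copies H G) |G :: nat sgraph. simple_graph G \<and> card (verts G) = n \<and> free_of \<F> G}"

definition gen_ex :: "nat \<Rightarrow> nat sgraph \<Rightarrow> nat sgraph set \<Rightarrow> nat" where
  "gen_ex n H \<F> = Sup (copy_counts n H \<F>)"

definition realizable :: "real \<Rightarrow> nat sgraph \<Rightarrow> bool" where
  "realizable r H \<longleftrightarrow>
     (\<exists>\<F>. finite \<F> \<and> (\<forall>F \<in> \<F>. simple_graph F) \<and>
          (\<lambda>n. real (gen_ex n H \<F>)) \<in> \<Theta>(\<lambda>n. real n powr r))"

lemma simple_graph_complete_graph: "simple_graph (complete_graph t)"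
  by (auto simp: simple_graph_def complete_graph_def)

lemma card_copies_le:
  fixes G :: "'a sgraph"
  assumes "simple_graph G"
  shows "finite (copies H G)" and "card (copies H G) \<le> 2 ^ card (verts G) * 2 ^ 2 ^ card (verts G)"
proof -
  let ?V = "verts G"
  let ?S = "Pow ?V \<times> Pow (Pow ?V)"
  let ?p = "\<lambda>K :: 'a sgraph. (verts K, edges K)"
  have fin: "finite ?S"
    using assms by (simp add: simple_graph_def)
  have sub: "?p ` copies H G \<subseteq> ?S"
    using assms by (force simp: copies_def is_subgraph_def simple_graph_def)
  have inj: "inj_on ?p (copies H G)"
    by (rule inj_onI) simp
  show "finite (copies H G)"
    using finite_imageD[OF finite_subset[OF sub fin] inj] .
  have "card (copies H G) \<le> card ?S"
    using card_inj_on_le[OF inj sub fin] .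
  also have "\<dots> = 2 ^ card ?V * 2 ^ 2 ^ card ?V"
    using assms by (simp add: simple_graph_def card_cartesian_product card_Pow)
  finally show "card (copies H G) \<le> 2 ^ card ?V * 2 ^ 2 ^ card ?V" .
qed

lemma finite_copy_counts: "finite (copy_counts n H \<F>)"
proof (rule finite_subset)
  show "copy_counts n H \<F> \<subseteq> {..2 ^ n * 2 ^ 2 ^ n}"
    using card_copies_le(2) by (fastforce simp: copy_counts_def)
qed simp

lemma gen_ex_attained:
  assumes "copy_counts n H \<F> \<noteq> {}"
  shows "gen_ex n H \<F> = Max (copy_counts n H \<F>)" and "gen_ex n H \<F> \<in> copy_counts n H \<F>"
proof -
  show eq: "gen_ex n H \<F> = Max (copy_counts n H \<F>)"
    using assms by (simp add: gen_ex_def Sup_nat_def)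
  show "gen_ex n H \<F> \<in> copy_counts n H \<F>"
    unfolding eq using Max_in[OF finite_copy_counts assms] .
qed

end

theory Submission
  imports Defs "HOL-Algebra.Algebraic_Closure_Type" "HOL-Library.Z2" "HOL-Library.FuncSet"
begin

text \<open>
  Write \<open>r = k - a/b\<close> with \<open>1 \<le> a \<le> b\<close> and \<open>2 \<le> k \<le> t\<close> (the case \<open>r = t\<close> is trivial). As in the
  theorem of Bukh and Conlon on rational Turan exponents, let \<open>T\<close> be a rooted caterpillar with \<open>b\<close>
  edges and \<open>a\<close> non-root vertices such that every set \<open>S\<close> of non-roots meets at least \<open>(b/a) |S|\<close>
  edges. There are bipartite graphs on \<open>N + N\<close> vertices with \<open>N powr (2 - a/b) / 2\<close> edges in which
  a placement of the roots extends to a bounded number of copies of \<open>T\<close>. Joining such a graph to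
  \<open>k - 2\<close> independent sets of size \<open>N\<close> and \<open>t - k\<close> single vertices gives about \<open>N powr r\<close> copies of
  \<open>K\<^sub>t\<close>. The forbidden family consists of all small graphs that do not have a \<open>t\<close>-colouring of
  this shape.

  Upper bound: any two \<open>t\<close>-cliques share \<open>t - k\<close> vertices, so a positive proportion of them
  contains a fixed \<open>(t - k)\<close>-set. Among the remaining \<open>k\<close>-tuples one passes to a family in which
  each \<open>(k - 1)\<close>-subtuple has many extensions. Around one clique of it and for any two of its \<open>k\<close>
  vertices, embedding \<open>T\<close> greedily in the link gives many copies of \<open>T\<close> with the same roots. One of
  the pairs must receive the two colours on which this is excluded.

  Bipartite graphs: the edges are the common zeros of \<open>a\<close> random polynomials on
  \<open>F\<^sub>q\<^sup>b \<times> F\<^sub>q\<^sup>b\<close>. Instead of the Lang--Weil bound we use the dimension of constructible sets over the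
  algebraic closure. If a placement of the roots admits infinitely many copies of \<open>T\<close> over the
  closure, then the \<open>s\<close>-tuples of copies form a set of dimension at least \<open>s\<close>, whereas by the
  balance of \<open>T\<close> the incidence variety of coefficients and \<open>s\<close>-tuples has at most the dimension
  of the coefficient space. So the bad coefficients have codimension at least \<open>s\<close>, a constructible
  set of dimension \<open>e\<close> has \<open>O(q\<^sup>e)\<close> points over \<open>F\<^sub>q\<close>, and for good coefficients the finite number
  of copies is uniformly bounded.
\<close>

section \<open>Constructible predicates\<close>

text \<open>The obstacle is uniformity in the field: every constant has to be chosen before
  \<open>q\<close>. Hence coefficients, roots and unknowns are variables of one environment, and
  each finiteness bound is proved once for all values of the variables that are not being counted.
  Only upper bounds for numbers of points occur, so an inductive notion of dimension is enough and
  irreducible components never appear. The length \<open>s = b * (b + 1) + a + 1\<close> of the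
  tuples is dictated by a union bound. There are at most q^(b(b+1)) placements of roots, each
  spoiling a fraction O(q^-s) of the coefficients, and the total must stay below the probability
  q^-a of an edge; the last factor q absorbs the constants. The family can be finite because the
  upper bound inspects only boundedly many vertices: two cliques, or one clique with a second vertex
  for each of \<open>k\<close> coordinates and \<open>p\<close> trees for each pair of coordinates.
  Characteristic 2 is enough, since the available host sizes form a geometric progression up to
  bounded factors and rounding \<open>n\<close> down costs a constant.\<close>

inductive polyfun :: "(('i \<Rightarrow> 'k::comm_ring_1) \<Rightarrow> 'k) \<Rightarrow> bool" where
  polyfun_const: "polyfun (\<lambda>v. c)"
| polyfun_var: "polyfun (\<lambda>v. v i)"
| polyfun_add: "polyfun f \<Longrightarrow> polyfun g \<Longrightarrow> polyfun (\<lambda>v. f v + g v)"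
| polyfun_mult: "polyfun f \<Longrightarrow> polyfun g \<Longrightarrow> polyfun (\<lambda>v. f v * g v)"

lemma polyfun_uminus: "polyfun f \<Longrightarrow> polyfun (\<lambda>v. - f v)"
  using polyfun_mult[OF polyfun_const[of "-1"], of f] by simp

lemma polyfun_diff: "polyfun f \<Longrightarrow> polyfun g \<Longrightarrow> polyfun (\<lambda>v. f v - g v)"
  using polyfun_add[OF _ polyfun_uminus, of f g] by simp

lemma polyfun_sum: "(\<And>k. k \<in> A \<Longrightarrow> polyfun (f k)) \<Longrightarrow> polyfun (\<lambda>v. \<Sum>k\<in>A. f k v)"
  by (induction A rule: infinite_finite_induct) (auto intro: polyfun_const polyfun_add)

lemma polyfun_power: "polyfun f \<Longrightarrow> polyfun (\<lambda>v. f v ^ n)"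
  by (induction n) (auto intro: polyfun_const polyfun_mult)

text \<open>Predicates on whole environments rather than subsets of a fixed affine space: any
  variable can be quantified while the others act as parameters.\<close>

inductive constructible :: "(('i \<Rightarrow> 'k::comm_ring_1) \<Rightarrow> bool) \<Rightarrow> bool" where
  constructible_eq0: "polyfun f \<Longrightarrow> constructible (\<lambda>v. f v = 0)"
| constructible_not: "constructible P \<Longrightarrow> constructible (\<lambda>v. \<not> P v)"
| constructible_conj: "constructible P \<Longrightarrow> constructible Q \<Longrightarrow> constructible (\<lambda>v. P v \<and> Q v)"

lemma constructible_disj: "constructible P \<Longrightarrow> constructible Q \<Longrightarrow> constructible (\<lambda>v. P v \<or> Q v)"
  using constructible_not[OF constructible_conj[OF constructible_not constructible_not, of P Q]] by simp

lemma constructible_const: "constructible (\<lambda>v :: 'i \<Rightarrow> 'k::comm_ring_1. b)"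
  using constructible_eq0[OF polyfun_const[of "if b then 0 else 1 :: 'k"]] by (cases b) auto

lemma constructible_eq: "polyfun f \<Longrightarrow> polyfun g \<Longrightarrow> constructible (\<lambda>v. f v = g v)"
  using constructible_eq0[OF polyfun_diff, of f g] by simp

lemma constructible_ball:
  "finite A \<Longrightarrow> (\<And>k. k \<in> A \<Longrightarrow> constructible (P k)) \<Longrightarrow> constructible (\<lambda>v. \<forall>k\<in>A. P k v)"
  by (induction A rule: finite_induct) (auto intro: constructible_const constructible_conj)

lemma constructible_bex:
  "finite A \<Longrightarrow> (\<And>k. k \<in> A \<Longrightarrow> constructible (P k)) \<Longrightarrow> constructible (\<lambda>v. \<exists>k\<in>A. P k v)"
  by (induction A rule: finite_induct) (auto intro: constructible_const constructible_disj)

text \<open>Polynomials in one distinguished variable whose coefficients depend polynomially on the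
  environment. The degree is smaller than \<open>n\<close>, so that \<open>n = 0\<close> is the zero family.\<close>

definition poly_family :: "nat \<Rightarrow> (('i \<Rightarrow> 'k::comm_ring_1) \<Rightarrow> 'k poly) \<Rightarrow> bool" where
  "poly_family n g \<longleftrightarrow> (\<forall>k. polyfun (\<lambda>v. coeff (g v) k)) \<and> (\<forall>v. \<forall>k\<ge>n. coeff (g v) k = 0)"

lemma poly_family_const:
  assumes "polyfun f"
  shows "poly_family 1 (\<lambda>v. [:f v:])"
proof -
  have "polyfun (\<lambda>v. coeff [:f v:] k)" for k
    using assms by (cases k) (auto intro: polyfun_const)
  then show ?thesis by (auto simp: poly_family_def coeff_pCons split: nat.splits)
qed

lemma poly_family_X: "poly_family 2 (\<lambda>v. [:0, 1:])"
  by (auto simp: poly_family_def coeff_pCons intro: polyfun_const split: nat.splits)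

lemma poly_family_add: "poly_family m f \<Longrightarrow> poly_family n g \<Longrightarrow> poly_family (max m n) (\<lambda>v. f v + g v)"
  by (auto simp: poly_family_def intro: polyfun_add)

lemma poly_family_diff: "poly_family m f \<Longrightarrow> poly_family n g \<Longrightarrow> poly_family (max m n) (\<lambda>v. f v - g v)"
  by (auto simp: poly_family_def intro: polyfun_diff)

lemma poly_family_mult: "poly_family m f \<Longrightarrow> poly_family n g \<Longrightarrow> poly_family (m + n) (\<lambda>v. f v * g v)"
  unfolding poly_family_def
proof (intro conjI allI impI, goal_cases)
  case (1 k)
  then show ?case unfolding coeff_mult by (intro polyfun_sum polyfun_mult) auto
next
  case (2 v k)
  have "coeff (f v) i * coeff (g v) (k - i) = 0" if "i \<le> k" for i
  proof (cases "i < m")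
    case True then show ?thesis using 2 by (auto simp: )
  next
    case False then show ?thesis using 2 by auto
  qed
  then show ?case unfolding coeff_mult by (intro sum.neutral) auto
qed

lemma poly_family_power: "poly_family m f \<Longrightarrow> \<exists>n. poly_family n (\<lambda>v. f v ^ j)"
proof (induction j)
  case 0 show ?case using poly_family_const[OF polyfun_const[of 1]] by (auto simp: one_pCons[symmetric] pCons_one)
next
  case (Suc j) then show ?case using poly_family_mult[of m f] by (auto)
qed

lemma poly_family_monom:
  assumes "polyfun c" "poly_family n f"
  shows "poly_family (n + j) (\<lambda>v. monom (c v) j * f v)"
proof -
  have "polyfun (\<lambda>v. if k < j then 0 else c v * coeff (f v) (k - j))" for k
    using assms by (cases "k < j") (auto simp: poly_family_def intro: polyfun_mult polyfun_const)
  then show ?thesis using assms by (auto simp: poly_family_def coeff_monom_mult)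
qed

lemma polyfun_as_poly:
  "polyfun f \<Longrightarrow> \<exists>g n. poly_family n g \<and> (\<forall>v x. f (v(i := x)) = poly (g v) x)"
proof (induction rule: polyfun.induct)
  case (polyfun_const c)
  show ?case using poly_family_const[OF polyfun.polyfun_const[of c]] by (intro exI[of _ "\<lambda>v. [:c:]"]) auto
next
  case (polyfun_var j)
  show ?case
  proof (cases "j = i")
    case True
    then show ?thesis using poly_family_X by (intro exI[of _ "\<lambda>v. [:0,1:]"]) auto
  next
    case False
    then show ?thesis using poly_family_const[OF polyfun.polyfun_var[of j]] by (intro exI[of _ "\<lambda>v. [:v j:]"]) auto
  qed
next
  case (polyfun_add f1 f2)
  then obtain g1 n1 g2 n2 where "poly_family n1 g1" "\<forall>v x. f1 (v(i := x)) = poly (g1 v) x"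
    "poly_family n2 g2" "\<forall>v x. f2 (v(i := x)) = poly (g2 v) x" by blast
  then show ?case using poly_family_add[of n1 g1 n2 g2] by (intro exI[of _ "\<lambda>v. g1 v + g2 v"]) (auto simp del: fun_upd_apply)
next
  case (polyfun_mult f1 f2)
  then obtain g1 n1 g2 n2 where "poly_family n1 g1" "\<forall>v x. f1 (v(i := x)) = poly (g1 v) x"
    "poly_family n2 g2" "\<forall>v x. f2 (v(i := x)) = poly (g2 v) x" by blast
  then show ?case using poly_family_mult[of n1 g1 n2 g2] by (intro exI[of _ "\<lambda>v. g1 v * g2 v"]) (auto simp del: fun_upd_apply)
qed

text \<open>The Nullstellensatz in one variable: no root of \<open>p\<close> has multiplicity above
  \<open>degree p\<close>. It turns a quantifier over roots into a divisibility, which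
  pseudo-division decides.\<close>

lemma root_inclusion_iff_dvd_power:
  fixes p q :: "'k::alg_closed_field poly"
  assumes "p \<noteq> 0"
  shows "(\<forall>x. poly p x = 0 \<longrightarrow> poly q x = 0) \<longleftrightarrow> p dvd q ^ degree p"
proof
  assume dvd: "p dvd q ^ degree p"
  show "\<forall>x. poly p x = 0 \<longrightarrow> poly q x = 0"
  proof (intro allI impI)
    fix x assume "poly p x = 0"
    then have "poly (q ^ degree p) x = 0" using dvd by (metis dvdE mult_zero_left poly_mult)
    then show "poly q x = 0" unfolding poly_power by (metis power_eq_0_iff)
  qed
next
  assume "\<forall>x. poly p x = 0 \<longrightarrow> poly q x = 0"
  then show "p dvd q ^ degree p" using assms
  proof (induction "degree p" arbitrary: p)
    case 0
    then show ?case by (metis is_unit_iff_degree dvd_trans one_dvd)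
  next
    case (Suc n)
    then obtain x where x: "poly p x = 0" using alg_closed_imp_poly_has_root[of p] by auto
    then obtain p' where p': "p = [:-x,1:] * p'" by (auto simp: poly_eq_0_iff_dvd elim: dvdE)
    have "p' \<noteq> 0" using Suc p' by auto
    then have deg: "degree p = Suc (degree p')" unfolding p' by (subst degree_mult_eq) auto
    have "poly q x = 0" using x Suc by auto
    then have "[:-x,1:] dvd q" by (simp add: poly_eq_0_iff_dvd)
    moreover have "p' dvd q ^ degree p'" using Suc deg \<open>p' \<noteq> 0\<close> p' by auto
    ultimately show ?case unfolding deg unfolding p' by (simp add: mult_dvd_mono del: mult_pCons_left)
  qed
qed

section \<open>Quantifier elimination over algebraically closed fields\<close>

lemma infinite_UNIV_alg_closed: "infinite (UNIV :: 'k::alg_closed_field set)"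
proof
  assume fin: "finite (UNIV :: 'k set)"
  define p :: "'k poly" where "p = (\<Prod>a\<in>UNIV. [:-a, 1:])"
  have "degree p = card (UNIV :: 'k set)"
    unfolding p_def by (subst degree_prod_eq_sum_degree) auto
  then have "degree p > 0" using fin by (simp add: finite_UNIV_card_ge_0)
  then have "degree (p + 1) > 0" by (subst degree_add_eq_left) auto
  then obtain x where "poly (p + 1) x = 0" using alg_closed_imp_poly_has_root by blast
  moreover have "poly p x = 0" unfolding p_def poly_prod using fin by (intro prod_zero) auto
  ultimately show False by simp
qed

lemma exists_nonroot_iff:
  fixes q :: "'k::alg_closed_field poly"
  shows "(\<exists>x. poly q x \<noteq> 0) \<longleftrightarrow> q \<noteq> 0"
  using poly_roots_finite[of q] infinite_UNIV_alg_closed[where 'k='k]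
  by (metis (mono_tags, lifting) UNIV_I finite_subset mem_Collect_eq poly_0 subsetI)

lemma dvd_coeff_test:
  fixes p :: "'k::alg_closed_field poly"
  assumes "degree q < degree p"
  shows "p dvd q \<longleftrightarrow> q = 0"
  using assms by (auto dest: dvd_imp_degree_le)

lemma poly_family_degree_less: "poly_family n g \<Longrightarrow> n > 0 \<Longrightarrow> degree (g v) < n"
  unfolding poly_family_def by (metis coeff_0 degree_0 gr0I leI leading_coeff_0_iff)

lemma poly_family_eq0_iff: "poly_family n g \<Longrightarrow> g v = 0 \<longleftrightarrow> (\<forall>k\<in>{..<n}. coeff (g v) k = 0)"
  unfolding poly_family_def poly_eq_iff coeff_0 by (metis lessThan_iff not_le)

lemma constructible_poly_eq0: "poly_family n g \<Longrightarrow> constructible (\<lambda>v. g v = 0)"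
  unfolding poly_family_eq0_iff
  by (intro constructible_ball constructible_eq0) (auto simp: poly_family_def)

text \<open>One step of pseudo-division.\<close>

lemma poly_family_reduce:
  assumes "poly_family (Suc m) p" "poly_family (Suc n) q" "m \<le> n"
  defines "q' \<equiv> \<lambda>v. monom (coeff (p v) m) 0 * q v - monom (coeff (q v) n) (n - m) * p v"
  shows "poly_family n q'"
proof -
  have "poly_family (Suc n) q'" unfolding q'_def
    using poly_family_diff[OF poly_family_monom[of "\<lambda>v. coeff (p v) m" "Suc n" q 0] poly_family_monom[of "\<lambda>v. coeff (q v) n" "Suc m" p "n-m"]]
      assms(1-3) by (auto simp: poly_family_def)
  moreover have "coeff (q' v) n = 0" for v
    using assms(1-3) by (simp add: q'_def coeff_monom_mult poly_family_def)
  ultimately show ?thesis unfolding poly_family_def by (metis le_neq_implies_less Suc_leI)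
qed

lemma poly_family_truncate:
  assumes "poly_family (Suc m) p"
  shows "poly_family m (\<lambda>v. p v - monom (coeff (p v) m) m)"
proof -
  have "polyfun (\<lambda>v. coeff (p v - monom (coeff (p v) m) m) k)" for k
    using assms by (cases "k = m") (auto simp: poly_family_def intro: polyfun_const)
  moreover have "coeff (p v - monom (coeff (p v) m) m) k = 0" if "m \<le> k" for v k
    using that assms by (cases "k = m") (auto simp: poly_family_def)
  ultimately show ?thesis unfolding poly_family_def by blast
qed

text \<open>Pseudo-division multiplies \<open>q\<close> by the formal leading coefficient of
  \<open>p\<close>; where that is nonzero, divisibility by \<open>p\<close> is unaffected. Once the
  degree of \<open>q\<close> is below \<open>m\<close>, divisibility means that all coefficients of
  \<open>q\<close> vanish.\<close>

lemma constructible_dvd: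
  fixes p q :: "('i \<Rightarrow> 'k::alg_closed_field) \<Rightarrow> 'k poly"
  assumes p: "poly_family (Suc m) p" and q: "poly_family n q"
  shows "\<exists>P. constructible P \<and> (\<forall>v. coeff (p v) m \<noteq> 0 \<longrightarrow> (P v \<longleftrightarrow> p v dvd q v))"
  using q
proof (induction n arbitrary: q)
  case 0
  then have "q v = 0" for v by (auto simp: poly_family_def poly_eq_iff)
  then show ?case by (intro exI[of _ "\<lambda>v. True"]) (auto intro: constructible_const)
next
  case (Suc n)
  show ?case
  proof (cases "m \<le> n")
    case True
    define q' where "q' \<equiv> \<lambda>v. monom (coeff (p v) m) 0 * q v - monom (coeff (q v) n) (n - m) * p v"
    have "poly_family n q'" unfolding q'_def using poly_family_reduce[OF p Suc.prems True] .
    from Suc.IH[OF this] obtain P where P: "constructible P"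
      "\<And>v. coeff (p v) m \<noteq> 0 \<Longrightarrow> P v \<longleftrightarrow> p v dvd q' v" by blast
    have "p v dvd q' v \<longleftrightarrow> p v dvd q v" if "coeff (p v) m \<noteq> 0" for v
    proof -
      have "q' v = smult (coeff (p v) m) (q v) - monom (coeff (q v) n) (n - m) * p v"
        by (simp add: q'_def monom_0)
      then have "p v dvd q' v \<longleftrightarrow> p v dvd smult (coeff (p v) m) (q v)"
        by (metis dvd_diff_commute dvd_diff_right_iff dvd_triv_right)
      also have "\<dots> \<longleftrightarrow> p v dvd q v" using that by (simp add: dvd_smult_iff)
      finally show ?thesis .
    qed
    then show ?thesis using P by blast
  next
    case False
    have "degree (p v) = m" if "coeff (p v) m \<noteq> 0" for v
      using poly_family_degree_less[OF p, of v] le_degree[OF that] by simp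
    then have "p v dvd q v \<longleftrightarrow> (\<forall>k\<in>{..<Suc n}. coeff (q v) k = 0)" if "coeff (p v) m \<noteq> 0" for v
    proof -
      have "degree (q v) < degree (p v)"
        using poly_family_degree_less[OF Suc.prems, of v] False that \<open>\<And>v. _ \<Longrightarrow> degree (p v) = m\<close> by fastforce
      then have "p v dvd q v \<longleftrightarrow> q v = 0" by (rule dvd_coeff_test)
      also have "\<dots> \<longleftrightarrow> (\<forall>k\<in>{..<Suc n}. coeff (q v) k = 0)"
        using poly_family_eq0_iff[OF Suc.prems] .
      finally show ?thesis .
    qed
    moreover have "constructible (\<lambda>v. \<forall>k\<in>{..<Suc n}. coeff (q v) k = 0)"
      using Suc.prems by (intro constructible_ball constructible_eq0) (auto simp: poly_family_def)
    ultimately show ?thesis by blast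
  qed
qed

text \<open>Where the formal leading coefficient is nonzero, \<open>m\<close> is the true degree of
  \<open>p v\<close>, so the same power \<open>q v ^ m\<close> serves all these
  environments.\<close>

lemma constructible_single_root:
  fixes p q :: "('i \<Rightarrow> 'k::alg_closed_field) \<Rightarrow> 'k poly"
  assumes p: "poly_family (Suc m) p" and q: "poly_family n q"
  shows "\<exists>P. constructible P \<and>
    (\<forall>v. coeff (p v) m \<noteq> 0 \<longrightarrow> (P v \<longleftrightarrow> (\<exists>x. poly (p v) x = 0 \<and> poly (q v) x \<noteq> 0)))"
proof -
  obtain n' where "poly_family n' (\<lambda>v. q v ^ m)" using poly_family_power[OF q] by blast
  from constructible_dvd[OF p this] obtain P where P: "constructible P"
    "\<And>v. coeff (p v) m \<noteq> 0 \<Longrightarrow> P v \<longleftrightarrow> p v dvd q v ^ m" by blast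
  have "p v dvd q v ^ m \<longleftrightarrow> \<not> (\<exists>x. poly (p v) x = 0 \<and> poly (q v) x \<noteq> 0)"
    if c: "coeff (p v) m \<noteq> 0" for v
  proof -
    have "degree (p v) = m"
      using poly_family_degree_less[OF p, of v] le_degree[OF c] by simp
    moreover have "p v \<noteq> 0" using c by auto
    ultimately show ?thesis using root_inclusion_iff_dvd_power[of "p v" "q v"] by auto
  qed
  with P show ?thesis by (intro exI[of _ "\<lambda>v. \<not> P v"]) (auto intro: constructible_not)
qed

text \<open>Euclid's algorithm with branching: if the formal leading coefficient of the shorter of
  two polynomials vanishes, that polynomial is truncated, otherwise it reduces the longer one. The
  formal lengths shrink until at most one equation is left.\<close>

lemma constructible_common_root:
  fixes q :: "('i \<Rightarrow> 'k::alg_closed_field) \<Rightarrow> 'k poly"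
  assumes "\<forall>(p, m)\<in>set ps. poly_family m p" and q: "poly_family n q"
  shows "constructible (\<lambda>v. \<exists>x. (\<forall>(p, m)\<in>set ps. poly (p v) x = 0) \<and> poly (q v) x \<noteq> 0)"
  using assms(1)
\<comment> \<open>A polynomial with bound 0 still counts 1, so that dropping an identically zero one
  decreases the measure.\<close>
proof (induction "\<Sum>(p, m)\<leftarrow>ps. Suc m" arbitrary: ps rule: less_induct)
  case less
  let ?R = "\<lambda>ps v. \<exists>x. (\<forall>(p, m)\<in>set ps. poly (p v) x = 0) \<and> poly (q v) x \<noteq> 0"
  have small: "constructible (?R ps')"
    if "(\<Sum>(p, m)\<leftarrow>ps'. Suc m) < (\<Sum>(p, m)\<leftarrow>ps. Suc m)" "\<forall>(p, m)\<in>set ps'. poly_family m p" for ps'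
    using less.hyps[OF that] .
  show ?case
  proof (cases "\<exists>p. (p, 0) \<in> set ps")
    case True
    then obtain p xs ys where ps: "ps = xs @ (p, 0) # ys" by (meson split_list)
    have "p v = 0" for v using less.prems by (auto simp: ps poly_family_def poly_eq_iff)
    then have "?R ps = ?R (xs @ ys)" by (auto simp: ps)
    moreover have "constructible (?R (xs @ ys))"
      by (rule small) (use less.prems in \<open>auto simp: ps\<close>)
    ultimately show ?thesis by simp
  next
    case nz: False
    consider "ps = []" | p m where "ps = [(p, m)]"
      | p1 m1 p2 m2 qs where "mset ps = {#(p1, m1), (p2, m2)#} + mset qs" "m1 \<le> m2"
    proof (cases ps)
      case (Cons a list)
      then show ?thesis
      proof (cases list)
        case (Cons a' list')
        then have "mset ps = {#a, a'#} + mset list'" "mset ps = {#a', a#} + mset list'"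
          using \<open>ps = a # list\<close> by auto
        then show ?thesis using that(3)[of "fst a" "snd a" "fst a'" "snd a'"]
           that(3)[of "fst a'" "snd a'" "fst a" "snd a"] by (cases "snd a \<le> snd a'") auto
      qed (use that(2)[of "fst a" "snd a"] in auto)
    qed (use that in auto)
    then show ?thesis
    proof cases
      case 1
      have "?R ps = (\<lambda>v. \<not> q v = 0)" by (simp add: 1 exists_nonroot_iff)
      moreover have "constructible (\<lambda>v. \<not> q v = 0)"
        by (intro constructible_not constructible_poly_eq0[OF q])
      ultimately show ?thesis by metis
    next
      case (2 p m')
      then obtain m where m: "m' = Suc m" using nz by (cases m') auto
      have p: "poly_family (Suc m) p" using less.prems 2 m by auto
      from constructible_single_root[OF p q] obtain P where P: "constructible P"
        "\<And>v. coeff (p v) m \<noteq> 0 \<Longrightarrow> P v \<longleftrightarrow> (\<exists>x. poly (p v) x = 0 \<and> poly (q v) x \<noteq> 0)" by blast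
      define p' where "p' = (\<lambda>v. p v - monom (coeff (p v) m) m)"
      have p': "poly_family m p'" "\<And>v x. coeff (p v) m = 0 \<Longrightarrow> poly (p' v) x = poly (p v) x"
        unfolding p'_def using poly_family_truncate[OF p] by auto
      let ?ps' = "[(p', m)]"
      have "constructible (?R ?ps')"
        by (rule small) (use 2 m p'(1) in auto)
      moreover have "?R ps = (\<lambda>v. (coeff (p v) m = 0 \<and> ?R ?ps' v) \<or> (\<not> coeff (p v) m = 0 \<and> P v))"
      proof
        fix v show "?R ps v \<longleftrightarrow> (coeff (p v) m = 0 \<and> ?R ?ps' v) \<or> (\<not> coeff (p v) m = 0 \<and> P v)"
          using P(2)[of v] p'(2)[of v] unfolding 2 by (cases "coeff (p v) m = 0") auto
      qed
      moreover have "polyfun (\<lambda>v. coeff (p v) m)" using p by (auto simp: poly_family_def)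
      ultimately show ?thesis using P(1)
        by (auto intro!: constructible_disj constructible_conj constructible_not constructible_eq0)
    next
      case (3 p1 m1' p2 m2' qs)
      have set_ps: "set ps = insert (p1, m1') (insert (p2, m2') (set qs))"
        using 3 by (metis set_mset_mset set_mset_union set_mset_add_mset_insert set_mset_empty insert_is_Un Un_insert_left)
      obtain m1 m2 where m: "m1' = Suc m1" "m2' = Suc m2"
        using nz set_ps by (cases m1'; cases m2') auto
      have b: "poly_family (Suc m1) p1" "poly_family (Suc m2) p2" using less.prems set_ps m by auto
      have sum_ps: "(\<Sum>(p, m)\<leftarrow>ps. Suc m) = Suc m1' + Suc m2' + (\<Sum>(p, m)\<leftarrow>qs. Suc m)"
      proof -
        have "(\<Sum>(p, m)\<leftarrow>ps. Suc m) = sum_mset (image_mset (\<lambda>(p, m). Suc m) (mset ps))"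
          by (metis mset_map sum_mset_sum_list)
        also have "\<dots> = Suc m1' + Suc m2' + sum_mset (image_mset (\<lambda>(p, m). Suc m) (mset qs))"
          unfolding 3 by simp
        finally show ?thesis by (metis mset_map sum_mset_sum_list)
      qed
      define p1' where "p1' = (\<lambda>v. p1 v - monom (coeff (p1 v) m1) m1)"
      define p2' where
        "p2' = (\<lambda>v. monom (coeff (p1 v) m1) 0 * p2 v - monom (coeff (p2 v) m2) (m2 - m1) * p1 v)"
      have p1': "poly_family m1 p1'" "\<And>v x. coeff (p1 v) m1 = 0 \<Longrightarrow> poly (p1' v) x = poly (p1 v) x"
        unfolding p1'_def using poly_family_truncate[OF b(1)] by auto
      have p2': "poly_family m2 p2'"
        unfolding p2'_def using poly_family_reduce[OF b] 3 m by auto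
      have p2'_root: "poly (p2' v) x = 0 \<longleftrightarrow> poly (p2 v) x = 0"
        if "coeff (p1 v) m1 \<noteq> 0" "poly (p1 v) x = 0" for v x
        using that by (simp add: p2'_def monom_0)
      let ?ps1 = "(p1', m1) # (p2, m2') # qs"
      let ?ps2 = "(p1, m1') # (p2', m2) # qs"
      have qs: "\<forall>(p, m)\<in>set qs. poly_family m p" using less.prems set_ps by auto
      have "constructible (?R ?ps1)"
        by (rule small) (use sum_ps m qs b p1'(1) in auto)
      moreover have "constructible (?R ?ps2)"
        by (rule small) (use sum_ps m qs b p2' in auto)
      moreover have "?R ps = (\<lambda>v. (coeff (p1 v) m1 = 0 \<and> ?R ?ps1 v) \<or> (\<not> coeff (p1 v) m1 = 0 \<and> ?R ?ps2 v))"
      proof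
        fix v show "?R ps v \<longleftrightarrow> (coeff (p1 v) m1 = 0 \<and> ?R ?ps1 v) \<or> (\<not> coeff (p1 v) m1 = 0 \<and> ?R ?ps2 v)"
          using p1'(2)[of v] p2'_root[of v] unfolding set_ps
          by (cases "coeff (p1 v) m1 = 0") (simp_all cong: conj_cong)
      qed
      moreover have "polyfun (\<lambda>v. coeff (p1 v) m1)" using b by (auto simp: poly_family_def)
      ultimately show ?thesis
        by (auto intro!: constructible_disj constructible_conj constructible_not constructible_eq0)
    qed
  qed
qed

section \<open>Disjunctive normal forms and elimination of one variable\<close>

type_synonym ('i, 'k) basic = "(('i \<Rightarrow> 'k) \<Rightarrow> 'k) list \<times> (('i \<Rightarrow> 'k) \<Rightarrow> 'k)"

definition basic_ok :: "('i, 'k::comm_ring_1) basic \<Rightarrow> bool" where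
  "basic_ok d \<longleftrightarrow> (\<forall>f\<in>set (fst d). polyfun f) \<and> polyfun (snd d)"

definition basic_holds :: "('i, 'k::comm_ring_1) basic \<Rightarrow> ('i \<Rightarrow> 'k) \<Rightarrow> bool" where
  "basic_holds d v \<longleftrightarrow> (\<forall>f\<in>set (fst d). f v = 0) \<and> snd d v \<noteq> 0"

definition is_dnf :: "(('i \<Rightarrow> 'k::comm_ring_1) \<Rightarrow> bool) \<Rightarrow> ('i, 'k) basic set \<Rightarrow> bool" where
  "is_dnf P Ds \<longleftrightarrow> finite Ds \<and> (\<forall>d\<in>Ds. basic_ok d) \<and> (\<forall>v. P v \<longleftrightarrow> (\<exists>d\<in>Ds. basic_holds d v))"

text \<open>In a domain a product is nonzero iff all factors are, so a disjunct never needs more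
  than one inequation.\<close>

lemma is_dnf_conj:
  fixes P Q :: "('i \<Rightarrow> 'k::idom) \<Rightarrow> bool"
  assumes "is_dnf P Ds" "is_dnf Q Es"
  shows "is_dnf (\<lambda>v. P v \<and> Q v)
    ((\<lambda>(d, e). (fst d @ fst e, \<lambda>v. snd d v * snd e v)) ` (Ds \<times> Es))"
proof -
  have ok: "basic_ok (fst d @ fst e, \<lambda>v. snd d v * snd e v)" if "basic_ok d" "basic_ok e"
    for d e :: "('i, 'k) basic"
    using that by (simp add: basic_ok_def ball_Un polyfun_mult)
  have "basic_holds (fst d @ fst e, \<lambda>v. snd d v * snd e v) v \<longleftrightarrow> basic_holds d v \<and> basic_holds e v"
    for d e :: "('i, 'k) basic" and v
    by (auto simp: basic_holds_def)
  then show ?thesis using assms ok unfolding is_dnf_def by fastforce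
qed

lemma basic_not_dnf:
  fixes d :: "('i, 'k::idom) basic"
  assumes "basic_ok d"
  shows "is_dnf (\<lambda>v. \<not> basic_holds d v) (insert ([snd d], \<lambda>v. 1) ((\<lambda>f. ([], f)) ` set (fst d)))"
  using assms by (simp add: is_dnf_def basic_ok_def basic_holds_def polyfun_const) blast

lemma is_dnf_not:
  fixes P :: "('i \<Rightarrow> 'k::idom) \<Rightarrow> bool"
  assumes "is_dnf P Ds"
  shows "\<exists>Es. is_dnf (\<lambda>v. \<not> P v) Es"
proof -
  have "finite Ds" "\<forall>d\<in>Ds. basic_ok d" "P = (\<lambda>v. \<exists>d\<in>Ds. basic_holds d v)"
    using assms by (simp_all add: is_dnf_def fun_eq_iff)
  then show ?thesis
  proof (induction Ds arbitrary: P rule: finite_induct)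
    case empty
    have "is_dnf (\<lambda>v. \<not> P v) {([], \<lambda>v. 1)}"
      using empty by (simp add: is_dnf_def basic_ok_def basic_holds_def polyfun_const)
    then show ?case by blast
  next
    case (insert d Ds)
    obtain Es where Es: "is_dnf (\<lambda>v. \<not> (\<exists>d\<in>Ds. basic_holds d v)) Es"
      using insert.IH[OF _ refl] insert.prems by auto
    have "basic_ok d" using insert.prems by simp
    from exI[of "is_dnf _", OF is_dnf_conj[OF basic_not_dnf[OF this] Es]]
    show ?case using insert.prems by simp
  qed
qed

lemma constructible_imp_dnf:
  fixes P :: "('i \<Rightarrow> 'k::idom) \<Rightarrow> bool"
  assumes "constructible P"
  shows "\<exists>Ds. is_dnf P Ds"
  using assms
proof induction
  case (constructible_eq0 f)
  then have "is_dnf (\<lambda>v. f v = 0) {([f], \<lambda>v. 1)}"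
    by (simp add: is_dnf_def basic_ok_def basic_holds_def polyfun_const)
  then show ?case by blast
next
  case (constructible_not P)
  then show ?case by (auto dest: is_dnf_not)
next
  case (constructible_conj P Q)
  then obtain Ds Es where "is_dnf P Ds" "is_dnf Q Es" by auto
  from exI[of "is_dnf _", OF is_dnf_conj[OF this]] show ?case .
qed

definition as_poly :: "'i \<Rightarrow> (('i \<Rightarrow> 'k::comm_ring_1) \<Rightarrow> 'k) \<Rightarrow> ('i \<Rightarrow> 'k) \<Rightarrow> 'k poly" where
  "as_poly i f = (SOME g. \<exists>n. poly_family n g \<and> (\<forall>v x. f (v(i := x)) = poly (g v) x))"

definition as_poly_bound :: "'i \<Rightarrow> (('i \<Rightarrow> 'k::comm_ring_1) \<Rightarrow> 'k) \<Rightarrow> nat" where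
  "as_poly_bound i f = (SOME n. poly_family n (as_poly i f))"

lemma
  assumes "polyfun f"
  shows poly_family_as_poly: "poly_family (as_poly_bound i f) (as_poly i f)"
    and poly_as_poly: "f (v(i := x)) = poly (as_poly i f v) x"
proof -
  have *: "\<exists>n. poly_family n (as_poly i f) \<and> (\<forall>v x. f (v(i := x)) = poly (as_poly i f v) x)"
    using someI_ex[OF polyfun_as_poly[OF assms, of i]] unfolding as_poly_def .
  then show "poly_family (as_poly_bound i f) (as_poly i f)" "f (v(i := x)) = poly (as_poly i f v) x"
    unfolding as_poly_bound_def by (auto intro: someI)
qed

text \<open>Chevalley's theorem for the projection along one variable: the quantifier passes through
  the disjunction, and each disjunct asks for a common root avoiding the zeros of one
  polynomial.\<close>

lemma constructible_Ex:
  fixes P :: "('i \<Rightarrow> 'k::alg_closed_field) \<Rightarrow> bool"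
  assumes "constructible P"
  shows "constructible (\<lambda>v. \<exists>x. P (v(i := x)))"
proof -
  obtain Ds where Ds: "is_dnf P Ds" using constructible_imp_dnf[OF assms] by blast
  let ?F = "as_poly i" and ?N = "as_poly_bound i"
  note FN = poly_family_as_poly[of _ i] poly_as_poly[of _ _ i]
  have pf: "polyfun f" if "d \<in> Ds" "f = snd d \<or> f \<in> set (fst d)" for d f
    using that Ds by (auto simp: is_dnf_def basic_ok_def)
  have fin: "finite Ds" using Ds by (simp add: is_dnf_def)
  have "(\<exists>x. P (v(i := x))) \<longleftrightarrow> (\<exists>d\<in>Ds. \<exists>x.
      (\<forall>(p, m)\<in>set (map (\<lambda>f. (?F f, ?N f)) (fst d)). poly (p v) x = 0) \<and> poly (?F (snd d) v) x \<noteq> 0)" for v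
  proof -
    have "(\<exists>x. P (v(i := x))) \<longleftrightarrow>
      (\<exists>d\<in>Ds. \<exists>x. (\<forall>f\<in>set (fst d). f (v(i := x)) = 0) \<and> snd d (v(i := x)) \<noteq> 0)"
      using Ds unfolding is_dnf_def basic_holds_def by blast
    also have "\<dots> \<longleftrightarrow> (\<exists>d\<in>Ds. \<exists>x. (\<forall>f\<in>set (fst d). poly (?F f v) x = 0) \<and> poly (?F (snd d) v) x \<noteq> 0)"
      using pf by (intro bex_cong refl ex_cong1) (simp add: FN(2)[symmetric] del: fun_upd_apply)
    finally show ?thesis by simp
  qed
  moreover have "constructible (\<lambda>v. \<exists>d\<in>Ds. \<exists>x.
      (\<forall>(p, m)\<in>set (map (\<lambda>f. (?F f, ?N f)) (fst d)). poly (p v) x = 0) \<and> poly (?F (snd d) v) x \<noteq> 0)"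
  proof (intro constructible_bex constructible_common_root)
    fix d assume d: "d \<in> Ds"
    show "poly_family (?N (snd d)) (?F (snd d))" using FN(1)[OF pf[OF d]] by auto
    show "\<forall>(p, m)\<in>set (map (\<lambda>f. (?F f, ?N f)) (fst d)). poly_family m p" using FN(1)[OF pf[OF d]] by auto
  qed (rule fin)
  ultimately show ?thesis by simp
qed

lemma infinite_common_root_iff:
  fixes q :: "'k::alg_closed_field poly"
  shows "infinite {x. (\<forall>p\<in>Ps. poly p x = 0) \<and> poly q x \<noteq> 0} \<longleftrightarrow> (\<forall>p\<in>Ps. p = 0) \<and> q \<noteq> 0"
proof
  assume inf: "infinite {x. (\<forall>p\<in>Ps. poly p x = 0) \<and> poly q x \<noteq> 0}"
  have "p = 0" if "p \<in> Ps" for p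
    using inf poly_roots_finite[of p] that
    by (metis (mono_tags, lifting) finite_subset mem_Collect_eq subsetI)
  moreover have "q \<noteq> 0" using inf by auto
  ultimately show "(\<forall>p\<in>Ps. p = 0) \<and> q \<noteq> 0" by blast
next
  assume "(\<forall>p\<in>Ps. p = 0) \<and> q \<noteq> 0"
  then have "{x. (\<forall>p\<in>Ps. poly p x = 0) \<and> poly q x \<noteq> 0} = UNIV - {x. poly q x = 0}" "q \<noteq> 0" by auto
  then show "infinite {x. (\<forall>p\<in>Ps. poly p x = 0) \<and> poly q x \<noteq> 0}"
    using poly_roots_finite[of q] infinite_UNIV_alg_closed[where 'k='k] by (simp add: Diff_infinite_finite)
qed

text \<open>A disjunct has an infinite fibre iff its equations vanish identically in the chosen
  variable and its inequation does not, which are conditions on coefficients. This is what makes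
  \<open>dim_ge\<close> constructible.\<close>

lemma constructible_Inf:
  fixes P :: "('i \<Rightarrow> 'k::alg_closed_field) \<Rightarrow> bool"
  assumes "constructible P"
  shows "constructible (\<lambda>v. infinite {x. P (v(i := x))})"
proof -
  obtain Ds where Ds: "is_dnf P Ds" using constructible_imp_dnf[OF assms] by blast
  let ?F = "as_poly i" and ?N = "as_poly_bound i"
  note FN = poly_family_as_poly[of _ i] poly_as_poly[of _ _ i]
  have pf: "polyfun f" if "d \<in> Ds" "f = snd d \<or> f \<in> set (fst d)" for d f
    using that Ds by (auto simp: is_dnf_def basic_ok_def)
  have fin: "finite Ds" using Ds by (simp add: is_dnf_def)
  have "infinite {x. P (v(i := x))} \<longleftrightarrow> (\<exists>d\<in>Ds. (\<forall>f\<in>set (fst d). ?F f v = 0) \<and> ?F (snd d) v \<noteq> 0)" for v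
  proof -
    have "{x. P (v(i := x))} = (\<Union>d\<in>Ds. {x. (\<forall>f\<in>set (fst d). f (v(i := x)) = 0) \<and> snd d (v(i := x)) \<noteq> 0})"
      using Ds unfolding is_dnf_def basic_holds_def by blast
    also have "\<dots> = (\<Union>d\<in>Ds. {x. (\<forall>p\<in>(\<lambda>f. ?F f v) ` set (fst d). poly p x = 0) \<and> poly (?F (snd d) v) x \<noteq> 0})"
      using pf by (intro SUP_cong refl Collect_cong) (simp add: FN(2)[symmetric] del: fun_upd_apply)
    finally have "infinite {x. P (v(i := x))} \<longleftrightarrow> (\<exists>d\<in>Ds. infinite
        {x. (\<forall>p\<in>(\<lambda>f. ?F f v) ` set (fst d). poly p x = 0) \<and> poly (?F (snd d) v) x \<noteq> 0})"
      using fin by simp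
    then show ?thesis unfolding infinite_common_root_iff by simp
  qed
  moreover have "constructible (\<lambda>v. \<exists>d\<in>Ds. (\<forall>f\<in>set (fst d). ?F f v = 0) \<and> \<not> ?F (snd d) v = 0)"
  proof (intro constructible_bex constructible_conj constructible_ball constructible_not)
    fix d assume d: "d \<in> Ds"
    show "constructible (\<lambda>v. ?F (snd d) v = 0)" using FN(1)[OF pf[OF d]] constructible_poly_eq0 by blast
    fix f assume "f \<in> set (fst d)"
    then show "constructible (\<lambda>v. ?F f v = 0)" using FN(1)[OF pf[OF d]] constructible_poly_eq0 by blast
  qed (use fin in auto)
  ultimately show ?thesis by simp
qed

section \<open>Uniform bounds for one-dimensional fibres\<close>

definition small :: "nat \<Rightarrow> 'k set \<Rightarrow> bool" where
  "small D A \<longleftrightarrow> finite A \<and> card A \<le> D"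

lemma small_mono: "small D A \<Longrightarrow> B \<subseteq> A \<Longrightarrow> D \<le> D' \<Longrightarrow> small D' B"
  unfolding small_def by (meson card_mono finite_subset le_trans)

lemma small_Un: "small D A \<Longrightarrow> small D' B \<Longrightarrow> small (D + D') (A \<union> B)"
  unfolding small_def by (meson add_mono card_Un_le finite_UnI le_trans)

text \<open>Strong minimality of algebraically closed fields, with a bound \<open>D\<close> that is
  uniform in the parameters: a polynomial that is not identically zero in the chosen variable has no
  more roots than its formal degree bound, and Boolean combinations add up such bounds.\<close>

lemma constructible_small_or_cosmall:
  fixes P :: "('i \<Rightarrow> 'k::alg_closed_field) \<Rightarrow> bool"
  assumes "constructible P"
  shows "\<exists>D. \<forall>v. small D {x. P (v(i := x))} \<or> small D {x. \<not> P (v(i := x))}"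
  using assms
proof induction
  case (constructible_eq0 f)
  obtain g n where g: "poly_family n g" "\<And>v x. f (v(i := x)) = poly (g v) x"
    using polyfun_as_poly[OF constructible_eq0] by metis
  have "small n {x. poly (g v) x = 0} \<or> small n {x. poly (g v) x \<noteq> 0}" for v
  proof (cases "g v = 0")
    case False
    then have "n > 0" using g(1) poly_family_eq0_iff[OF g(1), of v] by (cases n) auto
    then have "card {x. poly (g v) x = 0} \<le> n"
      using card_poly_roots_bound[OF False] poly_family_degree_less[OF g(1), of v] by linarith
    then show ?thesis using poly_roots_finite[OF False] by (auto simp: small_def)
  qed (auto simp: small_def)
  then show ?case unfolding g(2) by blast
next
  case (constructible_not P)
  then show ?case by (simp add: disj_commute)
next
  case (constructible_conj P Q)
  then obtain D1 D2 where D: "\<And>v. small D1 {x. P (v(i := x))} \<or> small D1 {x. \<not> P (v(i := x))}"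
    "\<And>v. small D2 {x. Q (v(i := x))} \<or> small D2 {x. \<not> Q (v(i := x))}" by metis
  have "small (D1 + D2) {x. P (v(i := x)) \<and> Q (v(i := x))} \<or>
      small (D1 + D2) {x. \<not> (P (v(i := x)) \<and> Q (v(i := x)))}" for v
  proof -
    have "{x. \<not> (P (v(i := x)) \<and> Q (v(i := x)))} = {x. \<not> P (v(i := x))} \<union> {x. \<not> Q (v(i := x))}" by auto
    moreover have "small (D1 + D2) {x. P (v(i := x)) \<and> Q (v(i := x))}" if "small D1 {x. P (v(i := x))}"
      by (rule small_mono[OF that]) auto
    moreover have "small (D1 + D2) {x. P (v(i := x)) \<and> Q (v(i := x))}" if "small D2 {x. Q (v(i := x))}"
      by (rule small_mono[OF that]) auto
    ultimately show ?thesis using D[of v] small_Un by metis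
  qed
  then show ?case by blast
qed

section \<open>Dimension\<close>

text \<open>The set of values of the variables \<open>is\<close> that satisfy \<open>P\<close>, the others being read off \<open>v\<close>, has
  dimension at least \<open>e\<close>. For constructible \<open>P\<close> the order of \<open>is\<close> turns out to be irrelevant.\<close>

fun dim_ge :: "nat \<Rightarrow> 'i list \<Rightarrow> (('i \<Rightarrow> 'k) \<Rightarrow> bool) \<Rightarrow> ('i \<Rightarrow> 'k) \<Rightarrow> bool" where
  "dim_ge e [] P v \<longleftrightarrow> e = 0 \<and> P v"
| "dim_ge e (i # is) P v \<longleftrightarrow> (\<exists>x. dim_ge e is P (v(i := x))) \<or>
     (e > 0 \<and> infinite {x. dim_ge (e - 1) is P (v(i := x))})"

abbreviation agree_off :: "'i list \<Rightarrow> ('i \<Rightarrow> 'k) \<Rightarrow> ('i \<Rightarrow> 'k) \<Rightarrow> bool" where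
  "agree_off is v w \<equiv> \<forall>i. i \<notin> set is \<longrightarrow> w i = v i"

lemma constructible_dim_ge:
  fixes P :: "('i \<Rightarrow> 'k::alg_closed_field) \<Rightarrow> bool"
  assumes "constructible P"
  shows "constructible (dim_ge e is P)"
proof (induction "is" arbitrary: e)
  case Nil
  have "dim_ge e [] P = (\<lambda>v. e = 0 \<and> P v)" by (simp add: fun_eq_iff)
  then show ?case using constructible_conj[OF constructible_const assms] by simp
next
  case (Cons i "is")
  have "dim_ge e (i # is) P = (\<lambda>v. (\<exists>x. dim_ge e is P (v(i := x))) \<or>
      (e > 0 \<and> infinite {x. dim_ge (e - 1) is P (v(i := x))}))"
    by (simp add: fun_eq_iff)
  moreover have "constructible \<dots>"
    by (intro constructible_disj constructible_conj constructible_const constructible_Ex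
        constructible_Inf Cons.IH)
  ultimately show ?case by simp
qed

lemma dim_ge_mono:
  assumes "dim_ge e is P v" "\<And>w. agree_off is v w \<Longrightarrow> P w \<Longrightarrow> Q w"
  shows "dim_ge e is Q v"
  using assms
proof (induction "is" arbitrary: e v)
  case (Cons i "is")
  have *: "dim_ge e is Q (v(i := x))" if "dim_ge e is P (v(i := x))" for e x
    by (rule Cons.IH[OF that]) (use Cons.prems(2) in auto)
  from Cons.prems(1) consider x where "dim_ge e is P (v(i := x))"
    | "e > 0" "infinite {x. dim_ge (e - 1) is P (v(i := x))}" by auto
  then show ?case
  proof cases
    case 2
    then have "infinite {x. dim_ge (e - 1) is Q (v(i := x))}"
      using * by (metis (mono_tags, lifting) finite_subset mem_Collect_eq subsetI)
    then show ?thesis using 2 by auto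
  qed (use * in auto)
qed auto

lemma dim_ge_ex: "dim_ge e is P v \<Longrightarrow> \<exists>w. agree_off is v w \<and> P w"
proof (induction "is" arbitrary: e v)
  case (Cons i "is")
  then obtain x e' where "dim_ge e' is P (v(i := x))"
    by (auto simp del: fun_upd_apply) (metis (mono_tags, lifting) Collect_empty_eq finite.emptyI)
  from Cons.IH[OF this] obtain w where "agree_off is (v(i := x)) w" "P w" by blast
  then show ?case by (intro exI[of _ w]) auto
qed auto

lemma dim_ge_le_length: "dim_ge e is P v \<Longrightarrow> e \<le> length is"
proof (induction "is" arbitrary: e v)
  case (Cons i "is")
  from Cons.prems consider x where "dim_ge e is P (v(i := x))"
    | x where "dim_ge (e - 1) is P (v(i := x))"
    by (auto simp del: fun_upd_apply) (metis (mono_tags, lifting) Collect_empty_eq finite.emptyI)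
  then show ?case using Cons.IH by cases fastforce+
qed auto

lemma ex_add_eq_iff: "(\<exists>a b. (e::nat) = a + b \<and> R a b) \<longleftrightarrow> (\<exists>a\<in>{..e}. R a (e - a))"
  by (metis atMost_iff diff_add_inverse le_add1 le_add_diff_inverse)

text \<open>Dimension of the base plus dimension of the fibre. Both orders of integration,
  coefficients first or unknowns first, are obtained from this together with
  \<open>dim_ge_perm\<close>.\<close>

lemma dim_ge_append:
  "dim_ge e (is @ js) P v \<longleftrightarrow> (\<exists>e1 e2. e = e1 + e2 \<and> dim_ge e1 is (\<lambda>w. dim_ge e2 js P w) v)"
proof (induction "is" arbitrary: e v)
  case (Cons i "is")
  let ?D = "\<lambda>e1 e2 v. dim_ge e1 is (\<lambda>w. dim_ge e2 js P w) v"
  have inf: "infinite {x. dim_ge e (is @ js) P (v(i := x))} \<longleftrightarrow>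
      (\<exists>e1 e2. e = e1 + e2 \<and> infinite {x. ?D e1 e2 (v(i := x))})" for e
  proof -
    \<comment> \<open>There are only \<open>e + 1\<close> ways to split \<open>e\<close>, so an
      infinite set of values contains infinitely many with the same splitting.\<close>
    have "{x. dim_ge e (is @ js) P (v(i := x))} = (\<Union>e1\<in>{..e}. {x. ?D e1 (e - e1) (v(i := x))})"
      unfolding Cons.IH ex_add_eq_iff by blast
    then have "infinite {x. dim_ge e (is @ js) P (v(i := x))} \<longleftrightarrow>
        (\<exists>e1\<in>{..e}. infinite {x. ?D e1 (e - e1) (v(i := x))})" by simp
    also have "\<dots> \<longleftrightarrow> (\<exists>e1 e2. e = e1 + e2 \<and> infinite {x. ?D e1 e2 (v(i := x))})"
      unfolding ex_add_eq_iff ..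
    finally show ?thesis .
  qed
  show ?case
  proof
    assume "dim_ge e ((i # is) @ js) P v"
    then consider x where "dim_ge e (is @ js) P (v(i := x))"
      | "e > 0" "infinite {x. dim_ge (e - 1) (is @ js) P (v(i := x))}" by auto
    then show "\<exists>e1 e2. e = e1 + e2 \<and> dim_ge e1 (i # is) (\<lambda>w. dim_ge e2 js P w) v"
    proof cases
      case 1
      then show ?thesis unfolding Cons.IH by auto
    next
      case 2
      then obtain e1 e2 where "e - 1 = e1 + e2" "infinite {x. ?D e1 e2 (v(i := x))}" using inf by blast
      then show ?thesis using \<open>e > 0\<close> by (intro exI[of _ "Suc e1"] exI[of _ e2]) auto
    qed
  next
    assume "\<exists>e1 e2. e = e1 + e2 \<and> dim_ge e1 (i # is) (\<lambda>w. dim_ge e2 js P w) v"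
    then obtain e1 e2 where e: "e = e1 + e2" "dim_ge e1 (i # is) (\<lambda>w. dim_ge e2 js P w) v" by blast
    then consider x where "?D e1 e2 (v(i := x))" | "e1 > 0" "infinite {x. ?D (e1 - 1) e2 (v(i := x))}"
      by auto
    then show "dim_ge e ((i # is) @ js) P v"
    proof cases
      case 1
      then have "\<exists>x. dim_ge e (is @ js) P (v(i := x))" unfolding Cons.IH using e by blast
      then show ?thesis by simp
    next
      case 2
      then have "infinite {x. dim_ge (e - 1) (is @ js) P (v(i := x))}"
        unfolding inf using e by (intro exI[of _ "e1 - 1"] exI[of _ e2]) auto
      then show ?thesis using 2 e by simp
    qed
  qed
qed auto

text \<open>Distinctness matters: if \<open>i\<close> occurred again in the tail, its value would be
  overwritten and infinitely many choices could lead to a single point.\<close>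

lemma dim_ge_finite:
  assumes "dim_ge e is P v" "distinct is" "finite {map w is |w. agree_off is v w \<and> P w}"
  shows "e = 0"
  using assms
proof (induction "is" arbitrary: e v)
  case (Cons i "is")
  let ?S = "\<lambda>x. {map w is |w. agree_off is (v(i := x)) w \<and> P w}"
  have sub: "{map w is |w. agree_off is (v(i := x)) w \<and> P w} \<subseteq>
      tl ` {map w (i # is) |w. agree_off (i # is) v w \<and> P w}" for x
  proof
    fix l assume "l \<in> ?S x"
    then obtain w where w: "l = map w is" "agree_off is (v(i := x)) w" "P w" by blast
    then have "agree_off (i # is) v w" by auto
    with w show "l \<in> tl ` {map w (i # is) |w. agree_off (i # is) v w \<and> P w}"
      by (intro image_eqI[of _ _ "map w (i # is)"]) auto
  qed
  have IH: "e' = 0" if "dim_ge e' is P (v(i := x))" for e' x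
    using Cons.IH[OF that _ finite_subset[OF sub finite_imageI[OF Cons.prems(3)]]] Cons.prems(2) by simp
  from Cons.prems(1) consider x where "dim_ge e is P (v(i := x))"
    | "e > 0" "infinite {x. dim_ge (e - 1) is P (v(i := x))}" by auto
  then show ?case
  proof cases
    case 2
    have "{x. dim_ge (e - 1) is P (v(i := x))} \<subseteq> hd ` {map w (i # is) |w. agree_off (i # is) v w \<and> P w}"
    proof
      fix x assume "x \<in> {x. dim_ge (e - 1) is P (v(i := x))}"
      then obtain w where w: "agree_off is (v(i := x)) w" "P w" using dim_ge_ex by blast
      then have "w i = x" "agree_off (i # is) v w" using Cons.prems(2) by auto
      with w show "x \<in> hd ` {map w (i # is) |w. agree_off (i # is) v w \<and> P w}"
        by (intro image_eqI[of _ _ "map w (i # is)"]) auto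
    qed
    then show ?thesis using 2 Cons.prems(3) finite_surj by blast
  qed (use IH in auto)
qed auto


section \<open>Independence of the order of the variables\<close>

lemma infinite_pairs_iff:
  "infinite {(x, y). R x y} \<longleftrightarrow> (\<exists>x. infinite {y. R x y}) \<or> infinite {x. \<exists>y. R x y}"
proof -
  have eq: "{(x, y). R x y} = Sigma {x. \<exists>y. R x y} (\<lambda>x. {y. R x y})" by auto
  have "finite {(x, y). R x y}" if "finite {x. \<exists>y. R x y}" "\<And>x. finite {y. R x y}"
    unfolding eq using that by (intro finite_SigmaI) auto
  moreover have "finite {x. \<exists>y. R x y}" if "finite {(x, y). R x y}"
    by (rule finite_surj[OF that, of _ fst]) force
  moreover have "finite {y. R x y}" if "finite {(x, y). R x y}" for x
    by (rule finite_surj[OF that, of _ snd]) force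
  ultimately show ?thesis by blast
qed

lemma infinite_pairs_swap: "infinite {(x, y). R x y} \<longleftrightarrow> infinite {(y, x). R x y}"
proof -
  have "{(y, x). R x y} = prod.swap ` {(x, y). R x y}" by force
  then show ?thesis by (metis finite_imageD inj_swap inj_on_subset subset_UNIV finite_imageI)
qed

text \<open>Infinite rows are cofinite. If only finitely many columns were infinite, some other
  \<open>y\<close> would lie in \<open>D' + 1\<close> chosen cofinite rows; its column then has more
  than \<open>D'\<close> elements, hence is cofinite and so infinite after all.\<close>

lemma infinite_infinite_swap:
  assumes small: "\<And>x. small D {y. R x y} \<or> small D {y. \<not> R x y}"
    and small': "\<And>y. small D' {x. R x y} \<or> small D' {x. \<not> R x y}"
    and inf: "infinite {x. infinite {y. R x y}}" and UNIV: "infinite (UNIV :: 'b set)"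
  shows "infinite {y :: 'b. infinite {x :: 'a. R x y}}"
proof
  assume fin: "finite {y. infinite {x. R x y}}"
  obtain A where A: "A \<subseteq> {x. infinite {y. R x y}}" "card A = Suc D'" "finite A"
    using infinite_arbitrarily_large[OF inf] by blast
  have "finite {y. \<not> R x y}" if "x \<in> A" for x
    using small[of x] A(1) that by (auto simp: small_def)
  then have "finite ({y. infinite {x. R x y}} \<union> (\<Union>x\<in>A. {y. \<not> R x y}))"
    using fin A(3) by auto
  then obtain y where y: "y \<notin> {y. infinite {x. R x y}} \<union> (\<Union>x\<in>A. {y. \<not> R x y})"
    using UNIV by (metis UNIV_I finite_subset subsetI)
  then have "A \<subseteq> {x. R x y}" "finite {x. R x y}" by auto
  moreover from this have "Suc D' \<le> card {x. R x y}" using A(2) card_mono by metis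
  moreover have "finite {x. \<not> R x y} \<Longrightarrow> infinite {x. R x y}"
  proof
    assume "finite {x. \<not> R x y}" "finite {x. R x y}"
    then have "finite ({x. \<not> R x y} \<union> {x. R x y})" by blast
    moreover have "{x. \<not> R x y} \<union> {x. R x y} = UNIV" by auto
    ultimately have "finite (UNIV :: 'a set)" by simp
    then show False using inf rev_finite_subset[OF _ subset_UNIV] by blast
  qed
  ultimately show False using small'[of y] by (auto simp: small_def)
qed

text \<open>Two variables contribute 0, 1 or 2 to the dimension. Contributing 1 means infinitely
  many pairs, which is symmetric; contributing 2 means infinitely many infinite rows, and there the
  symmetry is \<open>infinite_infinite_swap\<close>.\<close>

lemma dim_ge_swap:
  fixes P :: "('i \<Rightarrow> 'k::alg_closed_field) \<Rightarrow> bool"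
  assumes P: "constructible P" and ij: "i \<noteq> j" and D: "dim_ge e (i # j # is) P v"
  shows "dim_ge e (j # i # is) P v"
proof -
  let ?R = "\<lambda>e x y. dim_ge e is P (v(i := x, j := y))"
  have sw: "v(j := y, i := x) = v(i := x, j := y)" for x y using ij by (rule fun_upd_twist[symmetric])
  have c: "constructible (dim_ge e is P)" for e using P by (rule constructible_dim_ge)
  have expand: "dim_ge e (i # j # is) P v \<longleftrightarrow> (\<exists>x y. ?R e x y) \<or>
      (e > 0 \<and> infinite {(x, y). ?R (e - 1) x y}) \<or>
      (e > 1 \<and> infinite {x. infinite {y. ?R (e - 2) x y}})"
  proof -
    have "{x. dim_ge (e - 1) (j # is) P (v(i := x))} =
      {x. \<exists>y. ?R (e - 1) x y} \<union> {x. e > 1 \<and> infinite {y. ?R (e - 2) x y}}"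
      by (auto simp: numeral_2_eq_2 simp del: fun_upd_apply)
    then have "infinite {x. dim_ge (e - 1) (j # is) P (v(i := x))} \<longleftrightarrow>
      infinite {x. \<exists>y. ?R (e - 1) x y} \<or> (e > 1 \<and> infinite {x. infinite {y. ?R (e - 2) x y}})"
      by (cases "e > 1") auto
    then show ?thesis unfolding infinite_pairs_iff by auto
  qed
  have expand': "dim_ge e (j # i # is) P v \<longleftrightarrow> (\<exists>x y. ?R e x y) \<or>
      (e > 0 \<and> infinite {(y, x). ?R (e - 1) x y}) \<or>
      (e > 1 \<and> infinite {y. infinite {x. ?R (e - 2) x y}})"
  proof -
    have "{y. dim_ge (e - 1) (i # is) P (v(j := y))} =
      {y. \<exists>x. ?R (e - 1) x y} \<union> {y. e > 1 \<and> infinite {x. ?R (e - 2) x y}}"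
      by (auto simp: numeral_2_eq_2 sw simp del: fun_upd_apply)
    then have "infinite {y. dim_ge (e - 1) (i # is) P (v(j := y))} \<longleftrightarrow>
      infinite {y. \<exists>x. ?R (e - 1) x y} \<or> (e > 1 \<and> infinite {y. infinite {x. ?R (e - 2) x y}})"
      by (cases "e > 1") auto
    then show ?thesis unfolding infinite_pairs_iff by (auto simp: sw)
  qed
  have "infinite {y. infinite {x. ?R e' x y}}" if inf: "infinite {x. infinite {y. ?R e' x y}}" for e'
  proof -
    obtain D1 where D1: "\<And>v. small D1 {x. dim_ge e' is P (v(j := x))} \<or> small D1 {x. \<not> dim_ge e' is P (v(j := x))}"
      using constructible_small_or_cosmall[OF c] by blast
    obtain D2 where D2: "\<And>v. small D2 {x. dim_ge e' is P (v(i := x))} \<or> small D2 {x. \<not> dim_ge e' is P (v(i := x))}"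
      using constructible_small_or_cosmall[OF c] by blast
    show ?thesis
    proof (rule infinite_infinite_swap[OF _ _ inf infinite_UNIV_alg_closed])
      show "small D1 {y. ?R e' x y} \<or> small D1 {y. \<not> ?R e' x y}" for x by (rule D1)
      show "small D2 {x. ?R e' x y} \<or> small D2 {x. \<not> ?R e' x y}" for y using D2[of "v(j := y)"] unfolding sw .
    qed
  qed
  then show ?thesis using D unfolding expand expand' infinite_pairs_swap[of "?R (e - 1)"] by blast
qed

text \<open>Tails are permuted by induction. So \<open>i\<close> can be followed by the rest of
  \<open>js\<close> in order; one swap brings the true head of \<open>js\<close> to the front, and
  the tail is permuted once more.\<close>

lemma dim_ge_perm:
  fixes P :: "('i \<Rightarrow> 'k::alg_closed_field) \<Rightarrow> bool"
  assumes P: "constructible P" and "mset is = mset js" "distinct is" "dim_ge e is P v"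
  shows "dim_ge e js P v"
  using assms(2-)
proof (induction "length is" arbitrary: "is" js e v)
  case 0
  then show ?case by simp
next
  case (Suc n)
  then obtain i "is'" where i: "is = i # is'" by (cases "is") auto
  then have "i \<in> set js" using Suc.prems by (metis list.set_intros(1) mset_eq_setD)
  then obtain xs ys where js: "js = xs @ i # ys" by (meson split_list)
  have step: "dim_ge e (k # ks') P v"
    if D: "dim_ge e (k # ks) P v" and ks: "mset ks = mset ks'" "distinct ks" "length ks = n" for e v k ks ks'
  proof -
    have IH: "dim_ge e ks P v \<Longrightarrow> dim_ge e ks' P v" for e v
      using Suc.hyps(1)[of ks ks'] ks by simp
    from D consider x where "dim_ge e ks P (v(k := x))"
      | "e > 0" "infinite {x. dim_ge (e - 1) ks P (v(k := x))}" by auto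
    then show ?thesis
    proof cases
      case 1
      then show ?thesis using IH by auto
    next
      case 2
      have "infinite {x. dim_ge (e - 1) ks' P (v(k := x))}"
        using 2(2) by (rule infinite_super[rotated]) (use IH in blast)
      then show ?thesis using 2 by simp
    qed
  qed
  have dj: "distinct js" using Suc.prems by (metis mset_eq_imp_distinct_iff)
  have len: "length js = Suc n" using Suc by (metis size_mset)
  have front: "dim_ge e (i # xs @ ys) P v"
    by (rule step[OF Suc.prems(3)[unfolded i]]) (use Suc.prems Suc.hyps(2) i js in auto)
  show ?case
  proof (cases xs)
    case Nil
    then show ?thesis using front js by simp
  next
    case (Cons x xs')
    have "i \<noteq> x" using dj js Cons by auto
    then have "dim_ge e (x # i # xs' @ ys) P v" using dim_ge_swap[OF P _] front Cons by simp
    from step[OF this] show ?thesis using Cons js dj len by auto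
  qed
qed

lemma dim_ge_append_I:
  assumes "dim_ge e1 is Q v" "\<And>w. agree_off is v w \<Longrightarrow> Q w \<Longrightarrow> dim_ge e2 js P w"
  shows "dim_ge (e1 + e2) (is @ js) P v"
proof -
  have "dim_ge e1 is (\<lambda>w. dim_ge e2 js P w) v"
    using assms(1) by (rule dim_ge_mono) (rule assms(2))
  then show ?thesis unfolding dim_ge_append by (intro exI conjI) (rule refl)
qed

section \<open>Counting points with coordinates in a finite set\<close>

fun assign :: "('i \<Rightarrow> 'k) \<Rightarrow> 'i list \<Rightarrow> 'k list \<Rightarrow> 'i \<Rightarrow> 'k" where
  "assign v (i # is) (x # xs) = assign (v(i := x)) is xs"
| "assign v _ _ = v"

lemma assign_imp_dim_ge_0: "P (assign v is xs) \<Longrightarrow> length xs = length is \<Longrightarrow> dim_ge 0 is P v"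
proof (induction v "is" xs rule: assign.induct)
  case (1 v i "is" x xs)
  then have "dim_ge 0 is P (v(i := x))" by (simp del: fun_upd_apply)
  then show ?case by auto
qed auto

abbreviation points :: "'k set \<Rightarrow> 'i list \<Rightarrow> (('i \<Rightarrow> 'k) \<Rightarrow> bool) \<Rightarrow> ('i \<Rightarrow> 'k) \<Rightarrow> 'k list set" where
  "points A is P v \<equiv> {xs. length xs = length is \<and> set xs \<subseteq> A \<and> P (assign v is xs)}"

lemma finite_points: "finite A \<Longrightarrow> finite (points A is P v)"
  by (rule finite_subset[OF _ finite_lists_length_eq[of A "length is"]]) auto

text \<open>Induction on the variables: boundedly many values of the first one have a fibre of full
  dimension \<open>e\<close>, the at most \<open>card A\<close> others have fibres of dimension
  below \<open>e\<close>. The constant depends neither on \<open>A\<close> nor on the environment,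
  because the exceptional values are bounded uniformly.\<close>

lemma card_points_le:
  fixes P :: "('i \<Rightarrow> 'k::alg_closed_field) \<Rightarrow> bool"
  assumes "constructible P"
  shows "\<exists>D. \<forall>v A. finite A \<longrightarrow> A \<noteq> {} \<longrightarrow> \<not> dim_ge (Suc e) is P v \<longrightarrow>
           card (points A is P v) \<le> D * card A ^ e"
proof (induction "is" arbitrary: e)
  case Nil
  have "card (points A [] P v) \<le> 1 * card A ^ e" if "finite A" "A \<noteq> {}" for v and A :: "'k set"
  proof -
    have "card (points A [] P v) \<le> card {[] :: 'k list}" by (rule card_mono) auto
    also have "\<dots> \<le> card A ^ e" using that by (simp add: card_gt_0_iff Suc_leI)
    finally show ?thesis by simp
  qed
  then show ?case by blast
next
  case (Cons i "is")
  obtain D0 where D0: "\<And>v. small D0 {x. dim_ge e is P (v(i := x))} \<or> small D0 {x. \<not> dim_ge e is P (v(i := x))}"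
    using constructible_small_or_cosmall[OF constructible_dim_ge[OF assms]] by blast
  obtain D1 where D1: "\<And>v A. finite A \<Longrightarrow> A \<noteq> {} \<Longrightarrow> \<not> dim_ge (Suc e) is P v \<Longrightarrow>
           card (points A is P v) \<le> D1 * card A ^ e" using Cons.IH by blast
  obtain D2 where D2: "\<And>v A. finite A \<Longrightarrow> A \<noteq> {} \<Longrightarrow> \<not> dim_ge (Suc (e - 1)) is P v \<Longrightarrow>
           card (points A is P v) \<le> D2 * card A ^ (e - 1)" using Cons.IH by blast
  have "card (points A (i # is) P v) \<le> (D0 * D1 + D2) * card A ^ e"
    if A: "finite A" "A \<noteq> {}" and nd: "\<not> dim_ge (Suc e) (i # is) P v" for v A
  proof -
    let ?S = "{x. dim_ge e is P (v(i := x))}" and ?L = "\<lambda>x. points A is P (v(i := x))"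
    have nd1: "\<not> dim_ge (Suc e) is P (v(i := x))" for x using nd by auto
    have finS: "finite ?S" using nd by auto
    \<comment> \<open>\<open>?S\<close> is finite, but the bound must not depend on
      \<open>v\<close>: if it failed, the complement of \<open>?S\<close> would be finite as
      well.\<close>
    have cardS: "card ?S \<le> D0"
    proof (rule ccontr)
      assume "\<not> card ?S \<le> D0"
      then have "finite {x. \<not> dim_ge e is P (v(i := x))}" using D0[of v] by (auto simp: small_def)
      then have "finite (?S \<union> {x. \<not> dim_ge e is P (v(i := x))})" using finS by blast
      moreover have "?S \<union> {x. \<not> dim_ge e is P (v(i := x))} = UNIV" by auto
      ultimately show False using infinite_UNIV_alg_closed[where 'k='k] by metis
    qed
    have "points A (i # is) P v \<subseteq> (\<Union>x\<in>A. (#) x ` ?L x)"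
    proof
      fix ys assume "ys \<in> points A (i # is) P v"
      then show "ys \<in> (\<Union>x\<in>A. (#) x ` ?L x)" by (cases ys) auto
    qed
    then have "card (points A (i # is) P v) \<le> card (\<Union>x\<in>A. (#) x ` ?L x)"
      by (intro card_mono finite_UN_I finite_imageI finite_points A)
    also have "\<dots> \<le> (\<Sum>x\<in>A. card ((#) x ` ?L x))" by (rule card_UN_le[OF A(1)])
    also have "\<dots> \<le> (\<Sum>x\<in>A. card (?L x))"
      by (intro sum_mono card_image_le finite_points A)
    also have "\<dots> = (\<Sum>x\<in>A \<inter> ?S. card (?L x)) + (\<Sum>x\<in>A - ?S. card (?L x))"
      using sum.Int_Diff[OF A(1)] .
    also have "\<dots> \<le> D0 * (D1 * card A ^ e) + D2 * card A ^ e"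
    proof (rule add_mono)
      have "(\<Sum>x\<in>A \<inter> ?S. card (?L x)) \<le> card (A \<inter> ?S) * (D1 * card A ^ e)"
        using sum_bounded_above[of "A \<inter> ?S" "\<lambda>x. card (?L x)" "D1 * card A ^ e"] D1[OF A nd1] by simp
      also have "card (A \<inter> ?S) \<le> D0"
        using card_mono[OF finS, of "A \<inter> ?S"] cardS by auto
      finally show "(\<Sum>x\<in>A \<inter> ?S. card (?L x)) \<le> D0 * (D1 * card A ^ e)" by simp
    next
      show "(\<Sum>x\<in>A - ?S. card (?L x)) \<le> D2 * card A ^ e"
      proof (cases e)
        \<comment> \<open>There is no smaller dimension to fall back on; outside \<open>?S\<close>
          the fibres are empty.\<close>
        case 0
        have empty: "?L x = {}" if "x \<in> A - ?S" for x
          using assign_imp_dim_ge_0[of P _ "is"] that 0 by blast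
        have "(\<Sum>x\<in>A - ?S. card (?L x)) = 0"
        proof (rule sum.neutral, rule ballI)
          fix x assume "x \<in> A - ?S"
          from empty[OF this] show "card (?L x) = 0" by (simp only: card.empty)
        qed
        then show ?thesis by simp
      next
        case (Suc e')
        have "(\<Sum>x\<in>A - ?S. card (?L x)) \<le> card (A - ?S) * (D2 * card A ^ (e - 1))"
          using sum_bounded_above[of "A - ?S" "\<lambda>x. card (?L x)" "D2 * card A ^ (e - 1)"] D2[OF A] Suc by simp
        also have "\<dots> \<le> card A * (D2 * card A ^ (e - 1))"
          by (intro mult_right_mono card_mono A) auto
        finally show ?thesis using Suc by (simp add: mult_ac)
      qed
    qed
    finally show ?thesis by (simp add: algebra_simps)
  qed
  then show ?case by blast
qed

section \<open>A balanced rooted tree\<close>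

locale caterpillar =
  fixes a b :: nat
  assumes a_pos: "1 \<le> a" and a_le_b: "a \<le> b"
begin

text \<open>Position \<open>0\<close> is a root. Each later position is a new vertex joined to the last non-root before
  it (to \<open>0\<close> if there is none), and the non-roots (\<open>unk\<close>) are the points where \<open>rank i\<close>, which is
  \<open>a i / b\<close> rounded up, increases. Edge number \<open>i\<close> joins \<open>Suc i\<close> to \<open>cur i\<close>.\<close>

definition rank :: "nat \<Rightarrow> nat" where
  "rank i = (a * i + b - 1) div b"

definition unk :: "nat \<Rightarrow> bool" where
  "unk i \<longleftrightarrow> i > 0 \<and> rank i \<noteq> rank (i - 1)"

primrec cur :: "nat \<Rightarrow> nat" where
  "cur 0 = 0"
| "cur (Suc i) = (if unk (Suc i) then Suc i else cur i)"

text \<open>The bipartition of the tree: \<open>cur_side i\<close> is the class of the vertex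
  \<open>cur i\<close>, and the vertex \<open>Suc i\<close> attached to it gets the opposite class
  in \<open>side\<close>.\<close>

primrec cur_side :: "nat \<Rightarrow> bool" where
  "cur_side 0 = False"
| "cur_side (Suc i) = (if unk (Suc i) then \<not> cur_side i else cur_side i)"

definition side :: "nat \<Rightarrow> bool" where
  "side i = (case i of 0 \<Rightarrow> False | Suc j \<Rightarrow> \<not> cur_side j)"

lemma b_pos: "b > 0" using a_pos a_le_b by simp

lemma rank_bounds: "a * i \<le> b * rank i" "b * rank i < a * i + b"
proof -
  have "b * rank i + (a * i + b - 1) mod b = a * i + b - 1" unfolding rank_def by simp
  moreover have "(a * i + b - 1) mod b < b" using b_pos by simp
  ultimately show "a * i \<le> b * rank i" "b * rank i < a * i + b" using b_pos by linarith+
qed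

lemma rank_0: "rank 0 = 0" using b_pos by (simp add: rank_def)

lemma rank_Suc: "rank (Suc i) = rank i + (if unk (Suc i) then 1 else 0)"
proof -
  have "b * rank i < b * (rank (Suc i) + 1)"
    using rank_bounds[of i] rank_bounds[of "Suc i"] by (simp add: algebra_simps)
  then have "rank i \<le> rank (Suc i)" by (simp only: mult_less_cancel1) linarith
  moreover have "b * rank (Suc i) < b * (rank i + 2)"
    using rank_bounds[of i] rank_bounds[of "Suc i"] a_le_b by (simp add: algebra_simps)
  then have "rank (Suc i) \<le> rank i + 1" by (simp only: mult_less_cancel1) linarith
  ultimately show ?thesis by (auto simp: unk_def)
qed

lemma rank_b: "rank b = a"
proof -
  have "b * a \<le> b * rank b" "b * rank b < b * (a + 1)"
    using rank_bounds[of b] by (simp_all add: algebra_simps)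
  then show ?thesis using b_pos by (simp only: mult_le_cancel1 mult_less_cancel1) linarith
qed

lemma not_unk_0: "\<not> unk 0" by (simp add: unk_def)

lemma cur_le: "cur i \<le> i" by (induction i) auto

lemma side_cur: "side (cur i) = cur_side i"
  by (induction i) (auto simp: side_def)

lemma side_Suc: "side (Suc i) \<longleftrightarrow> \<not> side (cur i)"
  unfolding side_cur by (simp add: side_def)

lemma side_0: "\<not> side 0" by (simp add: side_def)

lemma card_unk: "card {i. i \<le> m \<and> unk i} = rank m"
proof (induction m)
  case 0
  have "{i. i \<le> 0 \<and> unk i} = {}" using not_unk_0 by auto
  then show ?case using rank_0 by simp
next
  case (Suc m)
  have "{i. i \<le> Suc m \<and> unk i} = {i. i \<le> m \<and> unk i} \<union> (if unk (Suc m) then {Suc m} else {})"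
    by (auto simp: le_Suc_eq)
  then show ?case using Suc rank_Suc[of m] by auto
qed

text \<open>Walking along the positions, the surplus \<open>a \<cdot> edges - b \<cdot> vertices\<close> stays nonnegative, except
  that it may drop to \<open>a \<cdot> m - b \<cdot> rank m > -b\<close> while the current path vertex belongs to \<open>S\<close>.\<close>

lemma balanced:
  assumes S: "S \<subseteq> {i. i \<le> b \<and> unk i}"
  shows "b * card S \<le> a * card {i. i < b \<and> (Suc i \<in> S \<or> cur i \<in> S)}"
proof -
  let ?T = "\<lambda>m. {i. i < m \<and> (Suc i \<in> S \<or> cur i \<in> S)}"
  let ?g = "\<lambda>m. int a * int (card (?T m)) - int b * int (card (S \<inter> {..m}))"
  have "(if cur m \<in> S then int a * int m - int b * int (rank m) else 0) \<le> ?g m" if "m \<le> b" for m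
    using that
  proof (induction m)
    case 0
    have "0 \<notin> S" using S not_unk_0 by auto
    then show ?case by simp
  next
    case (Suc m)
    have T: "?T (Suc m) = (if Suc m \<in> S \<or> cur m \<in> S then insert m (?T m) else ?T m)"
      by (auto simp: less_Suc_eq)
    have cT: "card (?T (Suc m)) = card (?T m) + (if Suc m \<in> S \<or> cur m \<in> S then 1 else 0)"
      unfolding T by simp
    have "S \<inter> {..Suc m} = (if Suc m \<in> S then insert (Suc m) (S \<inter> {..m}) else S \<inter> {..m})"
      by (auto simp: le_Suc_eq)
    then have cS: "card (S \<inter> {..Suc m}) = card (S \<inter> {..m}) + (if Suc m \<in> S then 1 else 0)"
      by simp
    have unk: "unk (Suc m)" if "Suc m \<in> S" using S that by auto
    have "int (a * m) \<le> int (b * rank m)" "int (b * rank (Suc m)) < int (a * Suc m + b)"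
      by (simp_all only: of_nat_le_iff of_nat_less_iff rank_bounds)
    then have l': "int a * int m \<le> int b * int (rank m)"
      "int b * int (rank (Suc m)) < int a * int m + int a + int b"
      by (simp_all add: algebra_simps)
    show ?case using Suc unk l' rank_Suc[of m] unfolding cT cS
      by (cases "Suc m \<in> S"; cases "cur m \<in> S"; cases "unk (Suc m)") (auto simp: algebra_simps)
  qed
  \<comment> \<open>At the last position the permitted deficit \<open>a * b - b * rank b\<close> is
    zero because \<open>rank b = a\<close>.\<close>
  from this[of b] have "0 \<le> ?g b" by (auto simp: rank_b split: if_splits)
  moreover have "S \<inter> {..b} = S" using S by auto
  ultimately have "int (b * card S) \<le> int (a * card (?T b))" by simp
  then show ?thesis by (simp only: of_nat_le_iff)
qed

definition embedding :: "('v \<Rightarrow> 'v \<Rightarrow> bool) \<Rightarrow> (nat \<Rightarrow> 'v) \<Rightarrow> bool" where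
  "embedding R \<phi> \<longleftrightarrow> inj_on \<phi> {..b} \<and> (\<forall>i<b. R (\<phi> (Suc i)) (\<phi> (cur i)))"

definition same_roots :: "(nat \<Rightarrow> 'v) \<Rightarrow> (nat \<Rightarrow> 'v) \<Rightarrow> bool" where
  "same_roots \<phi> \<psi> \<longleftrightarrow> (\<forall>i\<le>b. \<not> unk i \<longrightarrow> \<phi> i = \<psi> i)"

text \<open>The copies may also share non-roots, so this covers the whole finite family of powers of
  the rooted tree in the sense of Bukh and Conlon. Extensionality makes distinct members differ on
  \<open>{..b}\<close>.\<close>

definition rooted_power :: "nat \<Rightarrow> ('v \<Rightarrow> 'v \<Rightarrow> bool) \<Rightarrow> bool" where
  "rooted_power p R \<longleftrightarrow> (\<exists>\<Phi>. finite \<Phi> \<and> card \<Phi> = p \<and> \<Phi> \<subseteq> extensional {..b} \<and>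
     (\<forall>\<phi>\<in>\<Phi>. embedding R \<phi>) \<and> (\<forall>\<phi>\<in>\<Phi>. \<forall>\<psi>\<in>\<Phi>. same_roots \<phi> \<psi>))"

text \<open>Copies are added one at a time. The edges of the last copy that touch a new vertex are
  new and pairwise distinct, and \<open>balanced\<close>, applied to its set of new non-roots,
  provides enough of them.\<close>

lemma card_union_le:
  fixes \<phi> :: "nat \<Rightarrow> nat \<Rightarrow> 'v"
  assumes inj: "\<And>c. c < s \<Longrightarrow> inj_on (\<phi> c) {..b}"
    and roots: "\<And>c d. c < s \<Longrightarrow> d < s \<Longrightarrow> same_roots (\<phi> c) (\<phi> d)"
  shows "b * card (\<Union>c<s. \<phi> c ` {i. i \<le> b \<and> unk i}) \<le>
     a * card (\<Union>c<s. (\<lambda>i. {\<phi> c (Suc i), \<phi> c (cur i)}) ` {..<b})"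
  using assms
proof (induction s)
  case (Suc s)
  let ?U = "{i. i \<le> b \<and> unk i}"
  let ?V = "\<lambda>s. \<Union>c<s. \<phi> c ` ?U" and ?E = "\<lambda>s. \<Union>c<s. (\<lambda>i. {\<phi> c (Suc i), \<phi> c (cur i)}) ` {..<b}"
  define S where "S = {i \<in> ?U. \<phi> s i \<notin> ?V s}"
  define T where "T = {i. i < b \<and> (Suc i \<in> S \<or> cur i \<in> S)}"
  have IH: "b * card (?V s) \<le> a * card (?E s)" by (rule Suc.IH) (use Suc.prems in auto)
  have finU: "finite ?U" by simp
  have V: "?V (Suc s) = ?V s \<union> \<phi> s ` S" unfolding S_def lessThan_Suc by auto
  have "card (?V (Suc s)) \<le> card (?V s) + card (\<phi> s ` S)" unfolding V by (rule card_Un_le)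
  also have "card (\<phi> s ` S) \<le> card S" unfolding S_def using finU by (intro card_image_le) auto
  finally have cV: "card (?V (Suc s)) \<le> card (?V s) + card S" by simp
  have injT: "inj_on (\<lambda>i. {\<phi> s (Suc i), \<phi> s (cur i)}) T"
  proof (rule inj_onI)
    fix i j assume ij: "i \<in> T" "j \<in> T" "{\<phi> s (Suc i), \<phi> s (cur i)} = {\<phi> s (Suc j), \<phi> s (cur j)}"
    have "i < b" "j < b" using ij by (auto simp: T_def)
    have "cur i \<le> i" "cur j \<le> j" by (rule cur_le)+
    have im: "\<phi> s ` {Suc i, cur i} = \<phi> s ` {Suc j, cur j}" using ij by simp
    have sub: "{Suc i, cur i} \<subseteq> {..b}" "{Suc j, cur j} \<subseteq> {..b}"
      using \<open>i < b\<close> \<open>j < b\<close> \<open>cur i \<le> i\<close> \<open>cur j \<le> j\<close> by auto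
    have "{Suc i, cur i} = {Suc j, cur j}"
      using inj_on_image_eq_iff[OF Suc.prems(1)[OF lessI] sub] im by (rule iffD1)
    then show "i = j" using \<open>cur i \<le> i\<close> \<open>cur j \<le> j\<close> by (auto simp: doubleton_eq_iff)
  qed
  \<comment> \<open>A new vertex is not a non-root of an earlier copy by the choice of
    \<open>S\<close>, and not a root either, since roots are shared and the last copy is
    injective.\<close>
  have root_or: "\<phi> s i \<notin> (\<Union>c<s. \<phi> c ` {..b})" if "i \<in> S" for i
  proof
    assume "\<phi> s i \<in> (\<Union>c<s. \<phi> c ` {..b})"
    then obtain c j where cj: "c < s" "j \<le> b" "\<phi> s i = \<phi> c j" by auto
    show False
    proof (cases "unk j")
      case True
      then show False using that cj unfolding S_def by auto
    next
      case False
      then have "\<phi> s i = \<phi> s j" using Suc.prems(2)[of c s] cj unfolding same_roots_def by auto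
      then have "i = j" using inj_onD[OF Suc.prems(1)[of s]] cj that unfolding S_def by auto
      then show False using False that unfolding S_def by auto
    qed
  qed
  have disj: "?E s \<inter> (\<lambda>i. {\<phi> s (Suc i), \<phi> s (cur i)}) ` T = {}"
  proof (rule ccontr)
    assume "\<not> ?thesis"
    then obtain c i j where *: "c < s" "i < b" "j \<in> T"
      "{\<phi> c (Suc i), \<phi> c (cur i)} = {\<phi> s (Suc j), \<phi> s (cur j)}" by auto
    have "{\<phi> c (Suc i), \<phi> c (cur i)} \<subseteq> (\<Union>c<s. \<phi> c ` {..b})"
      using *(1,2) cur_le[of i] by (intro subset_trans[OF _ UN_upper[of c]]) auto
    moreover have "Suc j \<in> S \<or> cur j \<in> S" using *(3) by (auto simp: T_def)
    then have "\<exists>k\<in>S. \<phi> s k \<in> {\<phi> s (Suc j), \<phi> s (cur j)}" by auto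
    ultimately show False using root_or unfolding *(4) by blast
  qed
  have "card (?E s) + card T = card (?E s \<union> (\<lambda>i. {\<phi> s (Suc i), \<phi> s (cur i)}) ` T)"
    using card_image[OF injT] disj by (subst card_Un_disjoint) (auto simp: T_def)
  also have "\<dots> \<le> card (?E (Suc s))"
    by (rule card_mono) (auto simp: T_def lessThan_Suc)
  finally have cE: "card (?E s) + card T \<le> card (?E (Suc s))" .
  have "b * card S \<le> a * card T" unfolding T_def by (rule balanced) (auto simp: S_def)
  then have "b * (card (?V s) + card S) \<le> a * (card (?E s) + card T)"
    using IH by (simp add: algebra_simps)
  then show ?case using mult_le_mono2[OF cV, of b] mult_le_mono2[OF cE, of a] by linarith
qed simp

end

section \<open>Copies of the tree in a polynomial bipartite graph\<close>

lemma dim_ge_local: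
  assumes P: "\<And>v w. (\<And>i. i \<in> Z \<Longrightarrow> v i = w i) \<Longrightarrow> P v \<longleftrightarrow> P w"
    and "\<And>i. i \<in> Z \<Longrightarrow> i \<notin> set is \<Longrightarrow> v i = w i"
  shows "dim_ge e is P v \<longleftrightarrow> dim_ge e is P w"
  using assms(2)
proof (induction "is" arbitrary: e v w)
  case Nil
  then have "P v \<longleftrightarrow> P w" by (intro P) auto
  then show ?case by simp
next
  case (Cons i "is")
  have "dim_ge e is P (v(i := x)) \<longleftrightarrow> dim_ge e is P (w(i := x))" for e x
    by (rule Cons.IH) (use Cons.prems in auto)
  then show ?case by (simp del: fun_upd_apply)
qed

text \<open>A block is the coordinate vector of one vertex. If the first block can take a value
  outside \<open>Old\<close>, it contributes at most \<open>b\<close> and uses up one of the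
  \<open>h\<close> permitted new values; otherwise it ranges over a finite set and contributes
  nothing.\<close>

lemma dim_ge_blocks:
  fixes P :: "('i \<Rightarrow> 'k) \<Rightarrow> bool"
  assumes D: "dim_ge e (concat bs) P v" and dist: "distinct (concat bs)"
    and len: "\<And>B. B \<in> set bs \<Longrightarrow> length B \<le> b" and fin: "finite Old"
    and card: "\<And>w. agree_off (concat bs) v w \<Longrightarrow> P w \<Longrightarrow> card (Old \<union> map w ` set bs) \<le> card Old + h"
  shows "e \<le> b * h"
  using assms
proof (induction bs arbitrary: e v Old h)
  case Nil
  then show ?case by simp
next
  case (Cons B bs)
  let ?Q = "\<lambda>e2 w. dim_ge e2 (concat bs) P w"
  obtain e1 e2 where e: "e = e1 + e2" "dim_ge e1 B (?Q e2) v"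
    using Cons.prems(1) unfolding concat.simps dim_ge_append by auto
  have dB: "distinct B" "distinct (concat bs)" "set B \<inter> set (concat bs) = {}"
    using Cons.prems(2) by auto
  have mapB: "map w' B = map w B" if "agree_off (concat bs) w w'" for w w' :: "'i \<Rightarrow> 'k"
    using that dB(3) by auto
  have off: "agree_off (concat (B # bs)) v w'" if "agree_off B v w" "agree_off (concat bs) w w'"
    for w w' :: "'i \<Rightarrow> 'k" using that by auto
  have old: "e2 \<le> b * h" if w: "agree_off B v w" "?Q e2 w" and "map w B \<in> Old" for w
  proof (rule Cons.IH[OF w(2) dB(2) _ Cons.prems(4)])
    show "length B \<le> b" if "B \<in> set bs" for B using Cons.prems(3) that by simp
    fix w' assume w': "agree_off (concat bs) w w'" "P w'"
    have "card (Old \<union> map w' ` set (B # bs)) \<le> card Old + h"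
      by (rule Cons.prems(5)[OF off[OF w(1) w'(1)] w'(2)])
    moreover have "Old \<union> map w' ` set (B # bs) = Old \<union> map w' ` set bs"
      unfolding list.set(2) image_insert mapB[OF w'(1)] using that(3) by blast
    ultimately show "card (Old \<union> map w' ` set bs) \<le> card Old + h" by simp
  qed
  have new: "h > 0 \<and> e2 \<le> b * (h - 1)" if w: "agree_off B v w" "?Q e2 w" and nw: "map w B \<notin> Old" for w
  proof
    have bound: "card (insert (map w B) Old \<union> map w' ` set bs) \<le> card Old + h"
      if w': "agree_off (concat bs) w w'" "P w'" for w'
    proof -
      have "card (Old \<union> map w' ` set (B # bs)) \<le> card Old + h"
        by (rule Cons.prems(5)[OF off[OF w(1) w'(1)] w'(2)])
      moreover have "Old \<union> map w' ` set (B # bs) = insert (map w B) Old \<union> map w' ` set bs"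
        unfolding list.set(2) image_insert mapB[OF w'(1)] by blast
      ultimately show ?thesis by simp
    qed
    obtain w' where "agree_off (concat bs) w w'" "P w'" using dim_ge_ex[OF w(2)] by blast
    from bound[OF this] have "card (insert (map w B) Old) \<le> card Old + h"
      by (meson Cons.prems(4) card_mono finite.insertI finite_UnI finite_imageI finite_set le_trans sup_ge1)
    then show "h > 0" using nw Cons.prems(4) by simp
    have "card (insert (map w B) Old) + (h - 1) = card Old + h"
      using \<open>h > 0\<close> nw Cons.prems(4) by simp
    then show "e2 \<le> b * (h - 1)"
      using Cons.IH[OF w(2) dB(2) _ finite.insertI[OF Cons.prems(4)], of "map w B" "h - 1"] bound Cons.prems(3)
      by simp
  qed
  have e1: "e1 \<le> b" using dim_ge_le_length[OF e(2)] Cons.prems(3)[of B] by simp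
  show ?case
  proof (cases "\<exists>w. agree_off B v w \<and> ?Q e2 w \<and> map w B \<notin> Old")
    case True
    then have "h > 0" "e2 \<le> b * (h - 1)" using new by blast+
    then have "e \<le> b + b * (h - 1)" using e1 e(1) by simp
    also have "\<dots> = b * h" using \<open>h > 0\<close> by (cases h) auto
    finally show ?thesis .
  next
    case False
    then have "{map w B |w. agree_off B v w \<and> ?Q e2 w} \<subseteq> Old" by blast
    then have "e1 = 0" using dim_ge_finite[OF e(2) dB(1)] finite_subset[OF _ Cons.prems(4)] by simp
    moreover obtain w where "agree_off B v w" "?Q e2 w" using dim_ge_ex[OF e(2)] by blast
    then have "e2 \<le> b * h" using old False by blast
    ultimately show ?thesis using e by simp
  qed
qed

text \<open>Variables: coefficients \<open>Cf l j k\<close> of the \<open>l\<close>-th equation, parameters \<open>Lm j\<close> of the linear forms,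
  coordinates \<open>Rt i j\<close> of the roots, and coordinates \<open>Uk c i j\<close> of the non-root \<open>i\<close> in copy number \<open>c\<close>.\<close>

datatype ix = Cf nat nat nat | Lm nat | Rt nat nat | Uk nat nat nat

text \<open>Nonsingularity of the Vandermonde matrix. It is applied in the parameter of the linear
  forms, to separate edges, and in the values of one form, to determine coefficients.\<close>

lemma poly_lessThan_zero:
  fixes c :: "nat \<Rightarrow> 'k::idom"
  assumes "finite T" "card T \<ge> N" "\<And>t. t \<in> T \<Longrightarrow> (\<Sum>k<N. c k * t ^ k) = 0" "k < N"
  shows "c k = 0"
proof (rule ccontr)
  assume ck: "c k \<noteq> 0"
  define p where "p = (\<Sum>k<N. monom (c k) k)"
  have coeff: "coeff p j = (if j < N then c j else 0)" for j
    by (simp add: p_def coeff_sum)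
  then have "p \<noteq> 0" using ck assms(4) by (metis coeff_0)
  have "degree p < N" using assms(4) coeff[of "degree p"] \<open>p \<noteq> 0\<close> by (metis leading_coeff_0_iff)
  have "T \<subseteq> {t. poly p t = 0}"
    using assms(3) by (auto simp: p_def poly_sum poly_monom)
  then have "card T \<le> card {t. poly p t = 0}"
    using poly_roots_finite[OF \<open>p \<noteq> 0\<close>] by (intro card_mono)
  also have "\<dots> \<le> degree p" by (rule card_poly_roots_bound[OF \<open>p \<noteq> 0\<close>])
  finally show False using \<open>degree p < N\<close> assms(2) by simp
qed

context caterpillar
begin

text \<open>Roots are shared by all copies, non-roots belong to copy \<open>c\<close>. Padding with
  0 lets equality of functions express equality of the \<open>b\<close> coordinates.\<close>

definition vertex :: "(ix \<Rightarrow> 'k::comm_ring_1) \<Rightarrow> nat \<Rightarrow> nat \<Rightarrow> nat \<Rightarrow> 'k" where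
  "vertex v c i = (\<lambda>j. if j < b then (if unk i then v (Uk c i j) else v (Rt i j)) else 0)"

text \<open>The polynomials are sums of univariate polynomials in linear forms on a moment curve. Any few
  points are separated by one of the forms, so a Vandermonde argument shows that vanishing there
  imposes independent conditions on the coefficients.\<close>

definition lin_form :: "(ix \<Rightarrow> 'k::comm_ring_1) \<Rightarrow> nat \<Rightarrow> (nat \<Rightarrow> 'k) \<Rightarrow> (nat \<Rightarrow> 'k) \<Rightarrow> 'k" where
  "lin_form v j x y = (\<Sum>i<2*b. (if i < b then x i else y (i - b)) * v (Lm j) ^ i)"

definition edge_poly :: "nat \<Rightarrow> nat \<Rightarrow> (ix \<Rightarrow> 'k::comm_ring_1) \<Rightarrow> nat \<Rightarrow> (nat \<Rightarrow> 'k) \<Rightarrow> (nat \<Rightarrow> 'k) \<Rightarrow> 'k" where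
  "edge_poly J D v l x y = (\<Sum>j<J. \<Sum>k<D. v (Cf l j k) * lin_form v j x y ^ k)"

text \<open>The flag \<open>h\<close> says which of the two sides of the tree is mapped to the left.\<close>

definition edge_left :: "bool \<Rightarrow> (ix \<Rightarrow> 'k::comm_ring_1) \<Rightarrow> nat \<Rightarrow> nat \<Rightarrow> nat \<Rightarrow> 'k" where
  "edge_left h v c i = (if side (cur i) = h then vertex v c (cur i) else vertex v c (Suc i))"

definition edge_right :: "bool \<Rightarrow> (ix \<Rightarrow> 'k::comm_ring_1) \<Rightarrow> nat \<Rightarrow> nat \<Rightarrow> nat \<Rightarrow> 'k" where
  "edge_right h v c i = (if side (cur i) = h then vertex v c (Suc i) else vertex v c (cur i))"

text \<open>Injectivity is demanded only within a side of the tree, as the two sides go to different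
  parts of the bipartite graph. It is written coordinatewise so that it is visibly
  constructible.\<close>

definition is_copy :: "nat \<Rightarrow> nat \<Rightarrow> bool \<Rightarrow> nat \<Rightarrow> (ix \<Rightarrow> 'k::comm_ring_1) \<Rightarrow> bool" where
  "is_copy J D h c v \<longleftrightarrow> (\<forall>i\<in>{..<b}. \<forall>l\<in>{..<a}. edge_poly J D v l (edge_left h v c i) (edge_right h v c i) = 0) \<and>
     (\<forall>i\<in>{..b}. \<forall>j\<in>{..b}. (i \<noteq> j \<and> side i = side j) \<longrightarrow> \<not> (\<forall>t\<in>{..<b}. vertex v c i t = vertex v c j t))"

lemma polyfun_vertex: "polyfun (\<lambda>v. vertex v c i t)"
  unfolding vertex_def by (cases "t < b"; cases "unk i") (simp_all add: polyfun_var polyfun_const)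

lemma polyfun_edge_left: "polyfun (\<lambda>v. edge_left h v c i t)"
  unfolding edge_left_def by (cases "side (cur i) = h") (simp_all add: polyfun_vertex)

lemma polyfun_edge_right: "polyfun (\<lambda>v. edge_right h v c i t)"
  unfolding edge_right_def by (cases "side (cur i) = h") (simp_all add: polyfun_vertex)

lemma polyfun_edge_poly: "polyfun (\<lambda>v. edge_poly J D v l (edge_left h v c i) (edge_right h v c i))"
proof -
  have "polyfun (\<lambda>v. if i' < b then edge_left h v c i i' else edge_right h v c i (i' - b))" for i'
    by (cases "i' < b") (simp_all add: polyfun_edge_left polyfun_edge_right)
  then show ?thesis unfolding edge_poly_def lin_form_def
    by (intro polyfun_sum polyfun_mult polyfun_power polyfun_var)
qed

lemma constructible_imp: "constructible Q \<Longrightarrow> constructible (\<lambda>v. B \<longrightarrow> Q v)"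
  by (cases B) (simp_all add: constructible_const)

lemma constructible_is_copy: "constructible (is_copy J D h c)"
  unfolding is_copy_def[abs_def]
  by (intro constructible_conj constructible_ball constructible_imp constructible_not
      constructible_eq0 constructible_eq polyfun_edge_poly polyfun_vertex) auto

lemma is_copy_local:
  assumes "\<And>l j k. v (Cf l j k) = w (Cf l j k)" "\<And>j. v (Lm j) = w (Lm j)"
    "\<And>i j. v (Rt i j) = w (Rt i j)" "\<And>i j. v (Uk c i j) = w (Uk c i j)"
  shows "is_copy J D h c v \<longleftrightarrow> is_copy J D h c w"
proof -
  have 1: "vertex v c = vertex w c" using assms by (simp add: vertex_def fun_eq_iff)
  have 2: "edge_poly J D v = edge_poly J D w" using assms by (simp add: edge_poly_def lin_form_def fun_eq_iff)
  show ?thesis unfolding is_copy_def edge_left_def edge_right_def 1 2 ..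
qed

definition unk_vars :: "nat \<Rightarrow> ix list list" where
  "unk_vars c = map (\<lambda>i. map (Uk c i) [0..<b]) (filter unk [0..<Suc b])"

definition unk_vars_upto :: "nat \<Rightarrow> ix list list" where
  "unk_vars_upto s = concat (map unk_vars [0..<s])"

definition coeff_vars :: "nat \<Rightarrow> nat \<Rightarrow> ix list" where
  "coeff_vars J D = map (\<lambda>(l, j, k). Cf l j k) (List.product [0..<a] (List.product [0..<J] [0..<D]))"

lemma coeff_vars: "distinct (coeff_vars J D)" "length (coeff_vars J D) = a * J * D"
  "set (coeff_vars J D) = {Cf l j k |l j k. l < a \<and> j < J \<and> k < D}"
  unfolding coeff_vars_def by (auto simp: distinct_map distinct_product inj_on_def image_iff)

lemma unk_vars_upto_Suc: "unk_vars_upto (Suc s) = unk_vars_upto s @ unk_vars s"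
  by (simp add: unk_vars_upto_def)

lemma set_unk_vars: "set (concat (unk_vars c)) = {Uk c i j |i j. unk i \<and> i \<le> b \<and> j < b}"
  by (auto simp: unk_vars_def less_Suc_eq_le image_iff simp del: upt_Suc)

lemma set_unk_vars_upto: "set (concat (unk_vars_upto s)) = {Uk c i j |c i j. c < s \<and> unk i \<and> i \<le> b \<and> j < b}"
proof (induction s)
  case (Suc s)
  then show ?case unfolding unk_vars_upto_Suc concat_append set_append set_unk_vars by (auto simp: less_Suc_eq)
qed (simp add: unk_vars_upto_def)

lemma distinct_unk_vars: "distinct (concat (unk_vars c))"
proof -
  have "distinct (concat (map (\<lambda>i. map (Uk c i) [0..<b]) xs))" if "distinct xs" for xs
    using that by (induction xs) (auto simp: distinct_map inj_on_def)
  then show ?thesis unfolding unk_vars_def by (simp del: upt_Suc)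
qed

lemma distinct_unk_vars_upto: "distinct (concat (unk_vars_upto s))"
proof (induction s)
  case (Suc s)
  then show ?case unfolding unk_vars_upto_Suc concat_append distinct_append set_unk_vars set_unk_vars_upto
    using distinct_unk_vars by auto
qed (simp add: unk_vars_upto_def)

lemma set_unk_vars_upto_blocks: "set (unk_vars_upto s) = (\<Union>c<s. (\<lambda>i. map (Uk c i) [0..<b]) ` {i. i \<le> b \<and> unk i})"
proof -
  have "set (unk_vars c) = (\<lambda>i. map (Uk c i) [0..<b]) ` {i. i \<le> b \<and> unk i}" for c
    by (auto simp: unk_vars_def less_Suc_eq_le simp del: upt_Suc)
  then show ?thesis by (simp add: unk_vars_upto_def atLeast0LessThan)
qed

section \<open>Dimension of the incidence variety of coefficients and tuples of copies\<close>

definition copy_edges :: "bool \<Rightarrow> nat \<Rightarrow> (ix \<Rightarrow> 'k::comm_ring_1) \<Rightarrow> ((nat \<Rightarrow> 'k) \<times> (nat \<Rightarrow> 'k)) set" where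
  "copy_edges h s v = (\<Union>c<s. (\<lambda>i. (edge_left h v c i, edge_right h v c i)) ` {..<b})"

lemma finite_copy_edges: "finite (copy_edges h s v)" by (simp add: copy_edges_def)

lemma card_copy_edges: "card (copy_edges h s v) \<le> s * b"
proof -
  have "card (copy_edges h s v) \<le> (\<Sum>c<s. card ((\<lambda>i. (edge_left h v c i, edge_right h v c i)) ` {..<b}))"
    unfolding copy_edges_def by (rule card_UN_le) simp
  also have "\<dots> \<le> (\<Sum>c<s. b)" by (intro sum_mono order.trans[OF card_image_le]) auto
  finally show ?thesis by simp
qed

lemma copy_edges_support: "(x, y) \<in> copy_edges h s v \<Longrightarrow> t \<ge> b \<Longrightarrow> x t = 0 \<and> y t = 0"
  by (auto simp: copy_edges_def edge_left_def edge_right_def vertex_def)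

text \<open>Two distinct edges differ as vectors of length \<open>2 * b\<close>, and they collide
  under a form exactly when its parameter is a root of a nonzero polynomial of degree below
  \<open>2 * b\<close>. All pairs together spoil at most \<open>N^2 * (2 * b)\<close> forms.\<close>

lemma exists_separating_form:
  fixes v :: "ix \<Rightarrow> 'k::idom"
  assumes fin: "finite E" and cE: "card E \<le> N"
    and supp: "\<And>x y t. (x, y) \<in> E \<Longrightarrow> t \<ge> b \<Longrightarrow> x t = 0 \<and> y t = 0"
    and lam: "inj_on (\<lambda>j. v (Lm j)) {..<J}" and J: "J > N\<^sup>2 * (2 * b)"
  shows "\<exists>j<J. inj_on (\<lambda>(x, y). lin_form v j x y) E"
proof (rule ccontr)
  assume neg: "\<not> ?thesis"
  let ?L = "\<lambda>j e. lin_form v j (fst e) (snd e)"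
  let ?bad = "\<lambda>e e'. {j \<in> {..<J}. e \<noteq> e' \<and> ?L j e = ?L j e'}"
  have bad: "card (?bad e e') \<le> 2 * b" if ee: "e \<in> E" "e' \<in> E" for e e'
  proof (rule ccontr)
    assume big: "\<not> card (?bad e e') \<le> 2 * b"
    then have ne: "e \<noteq> e'" by (auto simp: not_le)
    define z where "z = (\<lambda>e i. if i < b then fst e i else snd e (i - b) :: 'k)"
    have "z e i - z e' i = 0" if "i < 2 * b" for i
    proof (rule poly_lessThan_zero[where N = "2 * b" and T = "(\<lambda>j. v (Lm j)) ` ?bad e e'"])
      have "inj_on (\<lambda>j. v (Lm j)) (?bad e e')" by (rule inj_on_subset[OF lam]) auto
      then show "2 * b \<le> card ((\<lambda>j. v (Lm j)) ` ?bad e e')" using big by (simp add: card_image)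
      fix t assume "t \<in> (\<lambda>j. v (Lm j)) ` ?bad e e'"
      then obtain j where "?L j e = ?L j e'" "t = v (Lm j)" by auto
      then have "(\<Sum>k<2 * b. z e k * t ^ k) = (\<Sum>k<2 * b. z e' k * t ^ k)" by (simp add: lin_form_def z_def)
      then show "(\<Sum>k<2 * b. (z e k - z e' k) * t ^ k) = 0" by (simp add: left_diff_distrib sum_subtractf)
    qed (use that in auto)
    then have zz: "z e i = z e' i" if "i < 2 * b" for i using that by simp
    have "fst e i = fst e' i" for i
      using zz[of i] supp[of "fst e" "snd e" i] supp[of "fst e'" "snd e'" i] ee by (cases "i < b") (auto simp: z_def)
    moreover have "snd e i = snd e' i" for i
      using zz[of "b + i"] supp[of "fst e" "snd e" i] supp[of "fst e'" "snd e'" i] ee by (cases "i < b") (auto simp: z_def)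
    ultimately show False using ne by (metis ext prod_eqI)
  qed
  have "{..<J} \<subseteq> (\<Union>(e, e')\<in>E \<times> E. ?bad e e')"
  proof
    fix j assume "j \<in> {..<J}"
    then have "\<not> inj_on (\<lambda>(x, y). lin_form v j x y) E" using neg by blast
    then obtain e e' where "e \<in> E" "e' \<in> E" "e \<noteq> e'" "?L j e = ?L j e'"
      unfolding inj_on_def case_prod_unfold by blast
    then show "j \<in> (\<Union>(e, e')\<in>E \<times> E. ?bad e e')"
      using \<open>j \<in> {..<J}\<close> by (intro UN_I[of "(e, e')"]) auto
  qed
  then have "card {..<J} \<le> card (\<Union>(e, e')\<in>E \<times> E. ?bad e e')"
    using fin by (intro card_mono finite_UN_I) auto
  also have "\<dots> \<le> (\<Sum>(e, e')\<in>E \<times> E. card (?bad e e'))"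
    unfolding case_prod_unfold by (rule card_UN_le) (use fin in auto)
  also have "\<dots> \<le> (\<Sum>(e, e')\<in>E \<times> E. 2 * b)" using bad by (intro sum_mono) auto
  also have "\<dots> = (card E)\<^sup>2 * (2 * b)" by (simp add: card_cartesian_product power2_eq_square case_prod_unfold)
  also have "\<dots> \<le> N\<^sup>2 * (2 * b)" using cE by (intro mult_right_mono power_mono) auto
  finally show False using J by simp
qed

lemma vertex_cong:
  assumes "\<And>i j. v (Rt i j) = w (Rt i j)" "\<And>i j. v (Uk c i j) = w (Uk c i j)"
  shows "vertex v c = vertex w c"
  using assms by (simp add: vertex_def fun_eq_iff)

lemma copy_edges_cong:
  assumes "\<And>i j. v (Rt i j) = w (Rt i j)" "\<And>c i j. v (Uk c i j) = w (Uk c i j)"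
  shows "copy_edges h s v = copy_edges h s w"
proof -
  have "vertex v = vertex w" by (rule ext, rule vertex_cong) (use assms in auto)
  then show ?thesis unfolding copy_edges_def edge_left_def[abs_def] edge_right_def[abs_def] by (simp only:)
qed

lemma constructible_is_copies: "constructible (\<lambda>w. \<forall>c\<in>{..<s}. is_copy J D h c w)"
  by (intro constructible_ball constructible_is_copy) auto

text \<open>Every distinct edge imposes \<open>a\<close> independent conditions. A form
  \<open>j0\<close> that separates the \<open>N\<close> edges turns them into \<open>N\<close>
  distinct points, so the coefficients \<open>Cf l j0 k\<close> with \<open>k < N\<close> are
  determined by all the others. Moving them to the end of the list shows that they contribute no
  dimension.\<close>

lemma dim_coefficients:
  fixes v :: "ix \<Rightarrow> 'k::alg_closed_field"
  assumes lam: "inj_on (\<lambda>j. v (Lm j)) {..<J}" and J: "J > (s * b)\<^sup>2 * (2 * b)" and D: "s * b \<le> D"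
    and dim: "dim_ge e (coeff_vars J D) (\<lambda>w. \<forall>c\<in>{..<s}. is_copy J D h c w) v"
  shows "e + a * card (copy_edges h s v) \<le> a * J * D"
proof -
  let ?P = "\<lambda>w. \<forall>c\<in>{..<s}. is_copy J D h c w"
  define N where "N = card (copy_edges h s v)"
  obtain j0 where j0: "j0 < J" "inj_on (\<lambda>(x, y). lin_form v j0 x y) (copy_edges h s v)"
    using exists_separating_form[OF finite_copy_edges card_copy_edges _ lam J] copy_edges_support by metis
  define sel where "sel = (\<lambda>z. \<exists>l k. z = Cf l j0 k \<and> k < N)"
  define js1 where "js1 = filter (\<lambda>z. \<not> sel z) (coeff_vars J D)"
  define js2 where "js2 = filter sel (coeff_vars J D)"
  have m: "mset (coeff_vars J D) = mset (js1 @ js2)"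
    unfolding js1_def js2_def using multiset_partition[of "mset (coeff_vars J D)" sel] by (simp add: union_commute)
  have "dim_ge e (js1 @ js2) ?P v"
    by (rule dim_ge_perm[OF constructible_is_copies m coeff_vars(1) dim])
  then obtain e1 e2 where e: "e = e1 + e2" "dim_ge e1 js1 (\<lambda>w. dim_ge e2 js2 ?P w) v"
    unfolding dim_ge_append by auto
  have e1: "e1 \<le> length js1" by (rule dim_ge_le_length[OF e(2)])
  obtain w where w: "agree_off js1 v w" "dim_ge e2 js2 ?P w" using dim_ge_ex[OF e(2)] by blast
  have sub: "set js1 \<subseteq> set (coeff_vars J D)" "set js2 \<subseteq> set (coeff_vars J D)" by (auto simp: js1_def js2_def)
  have unique: "map u js2 = map u' js2"
    if u: "agree_off js2 w u" "?P u" and u': "agree_off js2 w u'" "?P u'" for u u'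
  proof -
    have same: "u z = v z" "u' z = v z" if "z \<notin> set (coeff_vars J D)" for z
      using that u(1) u'(1) w(1) sub by (metis subsetD)+
    have diff: "u (Cf l j k) = u' (Cf l j k)" if "\<not> (j = j0 \<and> k < N)" for l j k
      using that u(1) u'(1) by (auto simp: js2_def sel_def)
    have EpU: "copy_edges h s u = copy_edges h s v" "copy_edges h s u' = copy_edges h s v"
      by (rule copy_edges_cong; simp add: same coeff_vars)+
    have lin_form: "lin_form u j x y = lin_form v j x y" "lin_form u' j x y = lin_form v j x y" for j x y
      by (simp_all add: lin_form_def same coeff_vars)
    have ev0: "edge_poly J D u l x y = 0" if "l < a" "(x, y) \<in> copy_edges h s v" for l x y
      using u(2) that unfolding EpU(1)[symmetric] by (auto simp: copy_edges_def is_copy_def)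
    have ev0': "edge_poly J D u' l x y = 0" if "l < a" "(x, y) \<in> copy_edges h s v" for l x y
      using u'(2) that unfolding EpU(2)[symmetric] by (auto simp: copy_edges_def is_copy_def)
    have ND: "N \<le> D" using card_copy_edges[of h s v] D unfolding N_def by linarith
    have "u (Cf l j0 k) - u' (Cf l j0 k) = 0" if l: "l < a" and k: "k < N" for l k
    proof (rule poly_lessThan_zero[where N = N and T = "(\<lambda>(x, y). lin_form v j0 x y) ` copy_edges h s v"])
      show "N \<le> card ((\<lambda>(x, y). lin_form v j0 x y) ` copy_edges h s v)"
        unfolding N_def card_image[OF j0(2)] ..
      show "finite ((\<lambda>(x, y). lin_form v j0 x y) ` copy_edges h s v)" using finite_copy_edges by blast
      show "k < N" by (rule k)
      fix t assume "t \<in> (\<lambda>(x, y). lin_form v j0 x y) ` copy_edges h s v"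
      then obtain x y where xy: "(x, y) \<in> copy_edges h s v" "t = lin_form v j0 x y" by auto
      have "0 = edge_poly J D u l x y - edge_poly J D u' l x y" using ev0[OF l xy(1)] ev0'[OF l xy(1)] by simp
      also have "\<dots> = (\<Sum>j<J. \<Sum>k<D. (u (Cf l j k) - u' (Cf l j k)) * lin_form v j x y ^ k)"
        unfolding edge_poly_def lin_form by (simp add: sum_subtractf left_diff_distrib)
      also have "\<dots> = (\<Sum>j<J. if j = j0 then (\<Sum>k<D. (u (Cf l j0 k) - u' (Cf l j0 k)) * t ^ k) else 0)"
        by (intro sum.cong refl) (auto simp: diff xy(2))
      also have "\<dots> = (\<Sum>k<D. (u (Cf l j0 k) - u' (Cf l j0 k)) * t ^ k)"
        using j0(1) by simp
      also have "\<dots> = (\<Sum>k<N. (u (Cf l j0 k) - u' (Cf l j0 k)) * t ^ k)"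
        by (rule sum.mono_neutral_right) (use ND diff in auto)
      finally show "(\<Sum>k<N. (u (Cf l j0 k) - u' (Cf l j0 k)) * t ^ k) = 0" by simp
    qed
    then show ?thesis by (auto simp: js2_def sel_def coeff_vars)
  qed
  have "finite {map u js2 |u. agree_off js2 w u \<and> ?P u}"
  proof (cases "\<exists>u. agree_off js2 w u \<and> ?P u")
    case True
    then obtain u where "agree_off js2 w u" "?P u" by blast
    then have "{map u js2 |u. agree_off js2 w u \<and> ?P u} \<subseteq> {map u js2}" using unique by blast
    then show ?thesis by (rule finite_subset) simp
  next
    case False
    then have "{map u js2 |u. agree_off js2 w u \<and> ?P u} = {}" by blast
    then show ?thesis by (simp only: finite.emptyI)
  qed
  moreover have "distinct js2" using coeff_vars(1) by (simp add: js2_def)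
  ultimately have e2: "e2 = 0" using dim_ge_finite[OF w(2)] by blast
  have "inj_on (\<lambda>(l, k). Cf l j0 k) ({..<a} \<times> {..<N})" by (auto simp: inj_on_def)
  then have "a * N = card ((\<lambda>(l, k). Cf l j0 k) ` ({..<a} \<times> {..<N}))"
    by (simp add: card_image card_cartesian_product)
  also have "\<dots> \<le> card (set js2)"
    using card_copy_edges[of h s v] D j0(1) unfolding N_def
    by (intro card_mono finite_set) (auto simp: js2_def sel_def coeff_vars N_def)
  also have "\<dots> = length js2" using \<open>distinct js2\<close> by (rule distinct_card)
  finally have "a * N \<le> length js2" .
  moreover have "length js1 + length js2 = a * J * D"
    using m coeff_vars(2) by (metis length_append size_mset)
  ultimately show ?thesis using e1 e2 e(1) unfolding N_def by linarith
qed

text \<open>This carries the balance of the tree over to the geometry: distinct non-root vectors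
  against distinct edges of the whole tuple.\<close>

lemma card_blocks_le:
  fixes v :: "ix \<Rightarrow> 'k::comm_ring_1"
  assumes P: "\<forall>c\<in>{..<s}. is_copy J D h c v"
  shows "b * card (map v ` set (unk_vars_upto s)) \<le> a * card (copy_edges h s v)"
proof -
  \<comment> \<open>Both parts use the same coordinate space, so a vertex is tagged with its part.
    Dropping the tag later can only identify non-roots, which is harmless for an upper
    bound.\<close>
  define \<phi> where "\<phi> = (\<lambda>c i. (side i = h, vertex v c i))"
  have inj: "inj_on (\<phi> c) {..b}" if "c < s" for c
  proof (rule inj_onI, rule ccontr)
    fix i j assume ij: "i \<in> {..b}" "j \<in> {..b}" "\<phi> c i = \<phi> c j" "i \<noteq> j"
    then have "side i = side j" "vertex v c i = vertex v c j" by (auto simp: \<phi>_def)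
    have "is_copy J D h c v" using P \<open>c < s\<close> by simp
    then have "\<not> (\<forall>t\<in>{..<b}. vertex v c i t = vertex v c j t)"
      using ij(1,2,4) \<open>side i = side j\<close> unfolding is_copy_def by blast
    then show False using \<open>vertex v c i = vertex v c j\<close> by simp
  qed
  have roots: "same_roots (\<phi> c) (\<phi> d)" for c d
    by (auto simp: same_roots_def \<phi>_def vertex_def)
  let ?V = "\<Union>c<s. \<phi> c ` {i. i \<le> b \<and> unk i}"
  let ?E = "\<Union>c<s. (\<lambda>i. {\<phi> c (Suc i), \<phi> c (cur i)}) ` {..<b}"
  have "map v ` set (unk_vars_upto s) \<subseteq> (\<lambda>(_, x). map x [0..<b]) ` ?V"
  proof
    fix l assume "l \<in> map v ` set (unk_vars_upto s)"
    then obtain c i where ci: "c < s" "i \<le> b" "unk i" "l = map v (map (Uk c i) [0..<b])"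
      unfolding set_unk_vars_upto_blocks by auto
    then have "l = map (vertex v c i) [0..<b]" by (auto simp: vertex_def)
    then show "l \<in> (\<lambda>(_, x). map x [0..<b]) ` ?V"
      using ci by (intro image_eqI[of _ _ "\<phi> c i"]) (auto simp: \<phi>_def)
  qed
  then have "card (map v ` set (unk_vars_upto s)) \<le> card ?V"
    by (intro surj_card_le) auto
  then have "b * card (map v ` set (unk_vars_upto s)) \<le> b * card ?V" by simp
  also have "\<dots> \<le> a * card ?E" by (rule card_union_le[OF inj roots])
  also have "?E \<subseteq> (\<lambda>(x, y). {(True, x), (False, y)}) ` copy_edges h s v"
  proof
    fix z assume "z \<in> ?E"
    then obtain c i where ci: "c < s" "i < b" "z = {\<phi> c (Suc i), \<phi> c (cur i)}" by auto
    have "z = (\<lambda>(x, y). {(True, x), (False, y)}) (edge_left h v c i, edge_right h v c i)"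
      using side_Suc[of i] unfolding ci(3) \<phi>_def edge_left_def edge_right_def by (cases h) auto
    then show "z \<in> (\<lambda>(x, y). {(True, x), (False, y)}) ` copy_edges h s v"
      using ci by (intro image_eqI[of _ _ "(edge_left h v c i, edge_right h v c i)"]) (auto simp: copy_edges_def)
  qed
  then have "a * card ?E \<le> a * card (copy_edges h s v)"
    by (intro mult_le_mono2 surj_card_le finite_copy_edges)
  finally show ?thesis .
qed

lemma dim_unknowns:
  fixes v :: "ix \<Rightarrow> 'k"
  assumes D: "dim_ge e (concat (unk_vars_upto s)) P v"
    and P: "\<And>w. agree_off (concat (unk_vars_upto s)) v w \<Longrightarrow> P w \<Longrightarrow> b * card (map w ` set (unk_vars_upto s)) \<le> m"
  shows "e \<le> m"
proof -
  have "e \<le> b * (m div b)"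
  proof (rule dim_ge_blocks[OF D distinct_unk_vars_upto, where Old = "{}"])
    show "length B \<le> b" if "B \<in> set (unk_vars_upto s)" for B
      using that unfolding set_unk_vars_upto_blocks by auto
    fix w assume "agree_off (concat (unk_vars_upto s)) v w" "P w"
    from P[OF this] show "card ({} \<union> map w ` set (unk_vars_upto s)) \<le> card {} + m div b"
      using b_pos by (simp add: less_eq_div_iff_mult_less_eq mult.commute)
  qed simp
  also have "\<dots> \<le> m" by simp
  finally show ?thesis .
qed

text \<open>Different copy numbers have disjoint sets of unknowns, so the dimensions of their fibres
  add up.\<close>

lemma dim_product:
  fixes v :: "ix \<Rightarrow> 'k::comm_ring_1"
  assumes "\<And>c. c < s \<Longrightarrow> dim_ge 1 (concat (unk_vars c)) (is_copy J D h c) v"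
  shows "dim_ge s (concat (unk_vars_upto s)) (\<lambda>w. \<forall>c\<in>{..<s}. is_copy J D h c w) v"
  using assms
proof (induction s)
  case 0
  then show ?case by (simp add: unk_vars_upto_def)
next
  case (Suc s)
  have "dim_ge (s + 1) (concat (unk_vars_upto s) @ concat (unk_vars s)) (\<lambda>w. \<forall>c\<in>{..<Suc s}. is_copy J D h c w) v"
  proof (rule dim_ge_append_I)
    show "dim_ge s (concat (unk_vars_upto s)) (\<lambda>w. \<forall>c\<in>{..<s}. is_copy J D h c w) v"
      by (rule Suc.IH) (use Suc.prems in simp)
    fix w assume w: "agree_off (concat (unk_vars_upto s)) v w" "\<forall>c\<in>{..<s}. is_copy J D h c w"
    have "dim_ge 1 (concat (unk_vars s)) (is_copy J D h s) v" using Suc.prems by simp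
    moreover have "dim_ge 1 (concat (unk_vars s)) (is_copy J D h s) v \<longleftrightarrow> dim_ge 1 (concat (unk_vars s)) (is_copy J D h s) w"
    proof (rule dim_ge_local[where Z = "{z. \<forall>c i j. z = Uk c i j \<longrightarrow> c = s}"])
      show "is_copy J D h s v' \<longleftrightarrow> is_copy J D h s w'"
        if "\<And>z. z \<in> {z. \<forall>c i j. z = Uk c i j \<longrightarrow> c = s} \<Longrightarrow> v' z = w' z" for v' w' :: "ix \<Rightarrow> 'k"
        by (rule is_copy_local; rule that; simp)
      show "v z = w z" if "z \<in> {z. \<forall>c i j. z = Uk c i j \<longrightarrow> c = s}" for z
      proof -
        have "z \<notin> set (concat (unk_vars_upto s))" using that unfolding set_unk_vars_upto by blast
        then show ?thesis using w(1) by simp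
      qed
    qed
    ultimately have "dim_ge 1 (concat (unk_vars s)) (is_copy J D h s) w" by simp
    then show "dim_ge 1 (concat (unk_vars s)) (\<lambda>w. \<forall>c\<in>{..<Suc s}. is_copy J D h c w) w"
    proof (rule dim_ge_mono)
      fix w' assume w': "agree_off (concat (unk_vars s)) w w'" "is_copy J D h s w'"
      have "is_copy J D h c w'" if "c < s" for c
      proof -
        have "is_copy J D h c w' \<longleftrightarrow> is_copy J D h c w"
          by (rule is_copy_local; rule w'(1)[rule_format]; use that in \<open>unfold set_unk_vars, blast\<close>)
        then show ?thesis using w(2) that by simp
      qed
      then show "\<forall>c\<in>{..<Suc s}. is_copy J D h c w'" using w'(2) by (auto simp: less_Suc_eq)
    qed
  qed
  then show ?case by (simp add: unk_vars_upto_Suc)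
qed

text \<open>The incidence set is measured twice. Coefficients first: dimension at least
  \<open>e + s\<close>. Unknowns first: for a tuple with V distinct non-root vectors and E edges the
  coefficients have dimension \<open>e2\<close> at most \<open>a * J * D - a * E\<close>, hence at
  most \<open>a * J * D - b * V\<close>. So \<open>b * V\<close> is at most
  \<open>a * J * D - e2\<close>, which bounds the dimension of the unknowns.\<close>

lemma dim_bad_coefficients:
  fixes v :: "ix \<Rightarrow> 'k::alg_closed_field"
  assumes lam: "inj_on (\<lambda>j. v (Lm j)) {..<J}" and J: "J > (s * b)\<^sup>2 * (2 * b)" and D: "s * b \<le> D"
    and dim: "dim_ge e (coeff_vars J D) (\<lambda>w. \<forall>c\<in>{..<s}. dim_ge 1 (concat (unk_vars c)) (is_copy J D h c) w) v"
  shows "e + s \<le> a * J * D"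
proof -
  let ?P = "\<lambda>w. \<forall>c\<in>{..<s}. is_copy J D h c w"
  have "dim_ge (e + s) (coeff_vars J D @ concat (unk_vars_upto s)) ?P v"
    by (rule dim_ge_append_I[OF dim]) (rule dim_product, simp)
  then have "dim_ge (e + s) (concat (unk_vars_upto s) @ coeff_vars J D) ?P v"
    by (rule dim_ge_perm[OF constructible_is_copies, rotated 2])
      (use coeff_vars(1) distinct_unk_vars_upto in \<open>auto simp: coeff_vars(3) set_unk_vars_upto simp del: set_concat\<close>)
  then obtain e1 e2 where e: "e + s = e1 + e2" "dim_ge e1 (concat (unk_vars_upto s)) (\<lambda>w. dim_ge e2 (coeff_vars J D) ?P w) v"
    unfolding dim_ge_append by auto
  have bound: "b * card (map w ` set (unk_vars_upto s)) + e2 \<le> a * J * D"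
    if w: "agree_off (concat (unk_vars_upto s)) v w" "dim_ge e2 (coeff_vars J D) ?P w" for w
  proof -
    have "v (Lm j) = w (Lm j)" for j using w(1) unfolding set_unk_vars_upto by auto
    then have "inj_on (\<lambda>j. w (Lm j)) {..<J}" using lam by simp
    from dim_coefficients[OF this J D w(2)] have 1: "e2 + a * card (copy_edges h s w) \<le> a * J * D" .
    obtain w' where w': "agree_off (coeff_vars J D) w w'" "?P w'" using dim_ge_ex[OF w(2)] by blast
    have eq: "w' z = w z" if "\<And>l j k. z \<noteq> Cf l j k" for z using w'(1) that unfolding coeff_vars(3) by auto
    have "copy_edges h s w' = copy_edges h s w" by (rule copy_edges_cong; rule eq; simp)
    moreover have "map w' ` set (unk_vars_upto s) = map w ` set (unk_vars_upto s)"
      unfolding set_unk_vars_upto_blocks by (intro image_cong refl) (auto intro!: eq)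
    ultimately have "b * card (map w ` set (unk_vars_upto s)) \<le> a * card (copy_edges h s w)"
      using card_blocks_le[OF w'(2)] by simp
    then show ?thesis using 1 by linarith
  qed
  obtain w where "agree_off (concat (unk_vars_upto s)) v w" "dim_ge e2 (coeff_vars J D) ?P w" using dim_ge_ex[OF e(2)] by blast
  from bound[OF this] have "e2 \<le> a * J * D" by simp
  moreover have "e1 \<le> a * J * D - e2"
  proof (rule dim_unknowns[OF e(2)])
    fix w assume "agree_off (concat (unk_vars_upto s)) v w" "dim_ge e2 (coeff_vars J D) ?P w"
    from bound[OF this] show "b * card (map w ` set (unk_vars_upto s)) \<le> a * J * D - e2" by linarith
  qed
  ultimately show ?thesis using e(1) by linarith
qed
end

section \<open>Finite subfields\<close>

definition fixed_field :: "nat \<Rightarrow> 'k::field set" where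
  "fixed_field m = {x. x ^ (CHAR('k) ^ m) = x}"

definition finite_subring :: "'k::comm_ring_1 set \<Rightarrow> bool" where
  "finite_subring A \<longleftrightarrow> finite A \<and> 0 \<in> A \<and> 1 \<in> A \<and>
     (\<forall>x\<in>A. \<forall>y\<in>A. x + y \<in> A \<and> x * y \<in> A) \<and> (\<forall>x\<in>A. - x \<in> A)"

text \<open>A multiple root would also be a root of the derivative, so the multiset of linear
  factors is a set.\<close>

lemma distinct_roots_card:
  fixes p :: "'k::alg_closed_field poly"
  assumes p: "p \<noteq> 0" and sep: "\<And>x. poly p x = 0 \<Longrightarrow> poly (pderiv p) x \<noteq> 0"
  shows "card {x. poly p x = 0} = degree p"
proof -
  obtain M where M: "size M = degree p" "p = smult (lead_coeff p) (\<Prod>x\<in>#M. [:-x, 1:])"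
    using alg_closed_imp_factorization[OF p] by blast
  have "count M x \<le> 1" for x
  proof (rule ccontr)
    assume "\<not> count M x \<le> 1"
    then have "{#x, x#} \<subseteq># M" by (simp add: subseteq_mset_def)
    then obtain M' where "M = {#x, x#} + M'" by (metis mset_subset_eq_exists_conv)
    then have "p = [:-x, 1:] * ([:-x, 1:] * smult (lead_coeff p) (\<Prod>x\<in>#M'. [:-x, 1:]))"
      by (subst M(2)) simp
    then obtain r where "p = [:-x, 1:] * ([:-x, 1:] * r)" by blast
    then have "poly p x = 0" "poly (pderiv p) x = 0"
      by (simp_all add: pderiv_mult del: mult_pCons_left)
    then show False using sep by blast
  qed
  then have "M = mset_set (set_mset M)"
    by (metis (no_types) count_eq_zero_iff count_mset_set(1,3) finite_set_mset le_antisym less_one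
        linorder_not_less multiset_eqI)
  then have "size M = card (set_mset M)" by (metis size_mset_set)
  moreover have "poly p x = 0 \<longleftrightarrow> x \<in># M" for x
  proof -
    have "poly p x = lead_coeff p * (\<Prod>y\<in>#M. x - y)"
      by (subst M(2)) (simp add: poly_prod_mset)
    also have "\<dots> = 0 \<longleftrightarrow> x \<in># M" using p by (auto simp: prod_mset_zero_iff image_iff)
    finally show ?thesis .
  qed
  then have "{x. poly p x = 0} = set_mset M" by auto
  ultimately show ?thesis using M(1) by simp
qed

lemma card_fixed_field:
  assumes p: "prime CHAR('k::alg_closed_field)" and m: "m > 0"
  shows "card (fixed_field m :: 'k set) = CHAR('k) ^ m"
proof -
  let ?q = "CHAR('k) ^ m"
  have q: "?q > 1" using prime_gt_1_nat[OF p] m by (metis one_less_power)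
  define f :: "'k poly" where "f = monom 1 ?q - monom 1 1"
  have deg: "degree f = ?q"
    unfolding f_def diff_conv_add_uminus using q by (subst degree_add_eq_left) (simp_all add: degree_monom_eq)
  \<comment> \<open>Since \<open>m > 0\<close>, the exponent is zero in the field, and the
    derivative of X^q - X is the constant -1.\<close>
  have "poly (pderiv f) x = - 1" for x
    using m by (simp add: f_def pderiv_diff pderiv_monom poly_monom of_nat_CHAR)
  then have "card {x. poly f x = 0} = degree f"
    using deg q by (intro distinct_roots_card) auto
  moreover have "{x. poly f x = 0} = fixed_field m"
    by (auto simp: f_def fixed_field_def poly_monom)
  ultimately show ?thesis using deg by simp
qed

lemma finite_subring_fixed_field:
  assumes p: "prime CHAR('k::alg_closed_field)" and m: "m > 0"
  shows "finite_subring (fixed_field m :: 'k set)"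
proof -
  let ?q = "CHAR('k) ^ m"
  have q: "?q > 0" using prime_gt_0_nat[OF p] by simp
  have add: "(x + y) ^ ?q = x ^ ?q + y ^ ?q" for x y :: 'k
    by (rule freshmans_dream'[OF p refl])
  have "(- x) ^ ?q = - (x ^ ?q)" for x :: 'k
    using add[of x "- x"] prime_gt_0_nat[OF p] by (simp add: power_0_left eq_neg_iff_add_eq_0 add.commute)
  moreover have "finite (fixed_field m :: 'k set)"
    using card_fixed_field[OF assms] q by (metis card_ge_0_finite)
  ultimately show ?thesis using q add
    by (auto simp: finite_subring_def fixed_field_def power_mult_distrib)
qed

lemma CHAR_bit: "CHAR(bit) = 2"
proof (rule CHAR_eqI)
  show "of_nat 2 = (0 :: bit)" by simp
  fix n :: nat assume n: "of_nat n = (0 :: bit)"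
  show "2 dvd n"
  proof (rule ccontr)
    assume "odd n"
    then obtain k where "n = 2 * k + 1" by (elim oddE)
    then show False using n by simp
  qed
qed

section \<open>Random polynomials over a finite field\<close>

lemma assign_map: "assign w zs (map f zs) z = (if z \<in> set zs then f z else w z)"
  by (induction zs arbitrary: w) auto

lemma finite_subring_sum:
  "finite_subring A \<Longrightarrow> (\<And>i. i \<in> I \<Longrightarrow> f i \<in> A) \<Longrightarrow> sum f I \<in> A"
  by (induction I rule: infinite_finite_induct) (auto simp: finite_subring_def)

lemma finite_subring_power: "finite_subring A \<Longrightarrow> x \<in> A \<Longrightarrow> x ^ n \<in> A"
  by (induction n) (auto simp: finite_subring_def)

context caterpillar
begin

text \<open>Injectivity of \<open>f\<close> is asked only on \<open>S\<close>, which contains the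
  ends of all edges: every vertex of the tree lies on an edge because \<open>b > 0\<close>.\<close>

lemma rooted_power_map:
  assumes R: "\<And>u w. R u w \<Longrightarrow> u \<in> S \<and> w \<in> S \<and> R' (f u) (f w)" and inj: "inj_on f S"
    and pow: "rooted_power p R"
  shows "rooted_power p R'"
proof -
  obtain \<Phi> where \<Phi>: "finite \<Phi>" "card \<Phi> = p" "\<Phi> \<subseteq> extensional {..b}"
    "\<And>\<phi>. \<phi> \<in> \<Phi> \<Longrightarrow> embedding R \<phi>" "\<And>\<phi> \<psi>. \<phi> \<in> \<Phi> \<Longrightarrow> \<psi> \<in> \<Phi> \<Longrightarrow> same_roots \<phi> \<psi>"
    using pow unfolding rooted_power_def by blast
  have S: "\<phi> i \<in> S" if "\<phi> \<in> \<Phi>" "i \<le> b" for \<phi> i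
  proof (cases i)
    case 0
    then show ?thesis using \<Phi>(4)[OF that(1)] R[of "\<phi> (Suc 0)" "\<phi> (cur 0)"] b_pos
      unfolding embedding_def by auto
  next
    case (Suc j)
    then show ?thesis using \<Phi>(4)[OF that(1)] R[of "\<phi> (Suc j)" "\<phi> (cur j)"] that(2)
      unfolding embedding_def by auto
  qed
  let ?t = "\<lambda>\<phi>. restrict (f \<circ> \<phi>) {..b}"
  have t: "?t \<phi> i = f (\<phi> i)" if "i \<le> b" for \<phi> i using that by simp
  have injt: "inj_on ?t \<Phi>"
  proof (rule inj_onI)
    fix \<phi> \<psi> assume *: "\<phi> \<in> \<Phi>" "\<psi> \<in> \<Phi>" "?t \<phi> = ?t \<psi>"
    show "\<phi> = \<psi>"
    proof (rule extensionalityI[where A = "{..b}"])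
      fix i assume i: "i \<in> {..b}"
      have "f (\<phi> i) = f (\<psi> i)" using fun_cong[OF *(3), of i] i by simp
      then show "\<phi> i = \<psi> i" using inj_onD[OF inj] S * i by auto
    qed (use * \<Phi>(3) in auto)
  qed
  have "embedding R' (?t \<phi>)" if "\<phi> \<in> \<Phi>" for \<phi>
    unfolding embedding_def
  proof
    have "inj_on \<phi> {..b}" using \<Phi>(4)[OF that] by (simp add: embedding_def)
    moreover have "inj_on f (\<phi> ` {..b})" by (rule inj_on_subset[OF inj]) (use S[OF that] in auto)
    ultimately show "inj_on (?t \<phi>) {..b}" by (simp add: comp_inj_on)
    show "\<forall>i<b. R' (?t \<phi> (Suc i)) (?t \<phi> (cur i))"
    proof (intro allI impI)
      fix i assume "i < b"
      then have "cur i \<le> b" using cur_le[of i] by simp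
      then show "R' (?t \<phi> (Suc i)) (?t \<phi> (cur i))"
        using \<open>i < b\<close> \<Phi>(4)[OF that] R by (simp add: embedding_def)
    qed
  qed
  moreover have "same_roots (?t \<phi>) (?t \<psi>)" if "\<phi> \<in> \<Phi>" "\<psi> \<in> \<Phi>" for \<phi> \<psi>
    using \<Phi>(5)[OF that] by (simp add: same_roots_def)
  moreover have "finite (?t ` \<Phi>)" "card (?t ` \<Phi>) = p" "?t ` \<Phi> \<subseteq> extensional {..b}"
    using \<Phi> card_image[OF injt] by auto
  ultimately show ?thesis unfolding rooted_power_def by (intro exI[of _ "?t ` \<Phi>"]) blast
qed

definition bip :: "('x \<times> 'x) set \<Rightarrow> bool \<times> 'x \<Rightarrow> bool \<times> 'x \<Rightarrow> bool" where
  "bip E u w \<longleftrightarrow> (fst u \<and> \<not> fst w \<and> (snd u, snd w) \<in> E) \<or> (fst w \<and> \<not> fst u \<and> (snd w, snd u) \<in> E)"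

text \<open>The tree is connected, so the part containing position 0 determines the parts of all its
  vertices.\<close>

lemma embedding_bip_side:
  assumes \<phi>: "embedding (bip E) \<phi>" and i: "i \<le> b"
  shows "fst (\<phi> i) \<longleftrightarrow> side i \<noteq> fst (\<phi> 0)"
  using i
proof (induction i rule: less_induct)
  case (less i)
  show ?case
  proof (cases i)
    case 0
    then show ?thesis using side_0 by auto
  next
    case (Suc j)
    have "bip E (\<phi> (Suc j)) (\<phi> (cur j))" using \<phi> less.prems Suc by (simp add: embedding_def)
    then have "fst (\<phi> i) \<longleftrightarrow> \<not> fst (\<phi> (cur j))" unfolding Suc bip_def by auto
    moreover have "fst (\<phi> (cur j)) \<longleftrightarrow> side (cur j) \<noteq> fst (\<phi> 0)"
      using less.IH[of "cur j"] cur_le[of j] Suc less.prems by simp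
    ultimately show ?thesis using side_Suc[of j] Suc by auto
  qed
qed

text \<open>The vectors of length \<open>b\<close> over \<open>A\<close>, in the zero-padded form of
  \<open>vertex\<close>.\<close>

definition Vec :: "'k::zero set \<Rightarrow> (nat \<Rightarrow> 'k) set" where
  "Vec A = {x. (\<forall>t<b. x t \<in> A) \<and> (\<forall>t\<ge>b. x t = 0)}"

lemma bij_Vec: "bij_betw (\<lambda>x. restrict x {..<b}) (Vec A) ({..<b} \<rightarrow>\<^sub>E A)"
proof (rule bij_betw_byWitness[where f' = "\<lambda>x t. if t < b then x t else 0"])
  show "\<forall>x\<in>Vec A. (\<lambda>t. if t < b then restrict x {..<b} t else 0) = x"
    by (auto simp: Vec_def fun_eq_iff)
  show "\<forall>x\<in>{..<b} \<rightarrow>\<^sub>E A. restrict (\<lambda>t. if t < b then x t else 0) {..<b} = x"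
    by (auto simp: fun_eq_iff PiE_def extensional_def)
  show "(\<lambda>x. restrict x {..<b}) ` Vec A \<subseteq> {..<b} \<rightarrow>\<^sub>E A"
    by (rule image_subsetI) (simp add: Vec_def)
  show "(\<lambda>x t. if t < b then x t else 0) ` ({..<b} \<rightarrow>\<^sub>E A) \<subseteq> Vec A"
    by (rule image_subsetI) (simp add: Vec_def PiE_iff)
qed

lemma finite_Vec: "finite A \<Longrightarrow> finite (Vec A)"
  using bij_betw_finite[OF bij_Vec[of A]] by (simp add: finite_PiE)

lemma card_Vec: "finite A \<Longrightarrow> card (Vec A) = card A ^ b"
  using bij_betw_same_card[OF bij_Vec[of A]] by (simp add: card_funcsetE)

definition zero_edges :: "nat \<Rightarrow> nat \<Rightarrow> (ix \<Rightarrow> 'k::comm_ring_1) \<Rightarrow> 'k set \<Rightarrow> ((nat \<Rightarrow> 'k) \<times> (nat \<Rightarrow> 'k)) set" where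
  "zero_edges J D v A = {(x, y) \<in> Vec A \<times> Vec A. \<forall>l<a. edge_poly J D v l x y = 0}"

text \<open>Only the parameters of the forms are fixed here. The other values are placeholders,
  later overwritten by \<open>assign\<close> for coefficients and unknowns and by
  \<open>set_roots\<close> for roots.\<close>

definition param_env :: "(nat \<Rightarrow> 'k) \<Rightarrow> ix \<Rightarrow> 'k::comm_ring_1" where
  "param_env lam z = (case z of Lm j \<Rightarrow> lam j | _ \<Rightarrow> 0)"

lemma edge_poly_mem:
  assumes A: "finite_subring A" and v: "\<And>l j k. v (Cf l j k) \<in> A" "\<And>j. j < J \<Longrightarrow> v (Lm j) \<in> A"
    and xy: "x \<in> Vec A" "y \<in> Vec A"
  shows "edge_poly J D v l x y \<in> A"
proof -
  have "lin_form v j x y \<in> A" if "j < J" for j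
    unfolding lin_form_def
  proof (rule finite_subring_sum[OF A])
    fix i assume "i \<in> {..<2 * b}"
    then have "(if i < b then x i else y (i - b)) \<in> A" using xy by (auto simp: Vec_def)
    moreover have "v (Lm j) ^ i \<in> A" by (rule finite_subring_power[OF A v(2)[OF that]])
    ultimately show "(if i < b then x i else y (i - b)) * v (Lm j) ^ i \<in> A"
      using A unfolding finite_subring_def by blast
  qed
  then have "v (Cf l j k) * lin_form v j x y ^ k \<in> A" if "j < J" for j k
    using that A v(1) finite_subring_power[OF A] unfolding finite_subring_def by blast
  then show ?thesis unfolding edge_poly_def by (intro finite_subring_sum[OF A]) auto
qed

text \<open>\<open>Cf l 0 0\<close> multiplies the power 0 of a form, so it is a constant term and
  can be used to adjust the value at one pair freely.\<close>

lemma edge_poly_update_constant: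
  assumes JD: "J > 0" "D > 0"
    and u: "\<And>j. u (Lm j) = u0 (Lm j)" "\<And>j k. (j, k) \<noteq> (0, 0) \<Longrightarrow> u (Cf l j k) = u0 (Cf l j k)"
  shows "edge_poly J D u l x y = edge_poly J D u0 l x y + (u (Cf l 0 0) - u0 (Cf l 0 0))"
proof -
  have lin_form: "lin_form u j x y = lin_form u0 j x y" for j by (simp add: lin_form_def u(1))
  have "edge_poly J D u l x y - edge_poly J D u0 l x y =
      (\<Sum>j<J. \<Sum>k<D. (u (Cf l j k) - u0 (Cf l j k)) * lin_form u0 j x y ^ k)"
    unfolding edge_poly_def lin_form by (simp add: sum_subtractf left_diff_distrib)
  also have "\<dots> = (\<Sum>j<J. \<Sum>k<D. if k = 0 then if j = 0 then u (Cf l 0 0) - u0 (Cf l 0 0) else 0 else 0)"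
    by (intro sum.cong refl) (auto simp: u(2))
  also have "\<dots> = u (Cf l 0 0) - u0 (Cf l 0 0)" using JD by simp
  finally show ?thesis by (simp add: algebra_simps)
qed

text \<open>All coefficients except the \<open>a\<close> constant terms \<open>Cf l 0 0\<close> are
  chosen freely in \<open>A\<close>, and the constant terms are then solved for. So a given pair is
  an edge with probability at least q^-a, where q is \<open>card A\<close>.\<close>

lemma edge_probability:
  fixes A :: "'k::comm_ring_1 set"
  assumes A: "finite_subring A" and lam: "\<And>j. j < J \<Longrightarrow> lam j \<in> A" and JD: "J > 0" "D > 0"
    and xy: "x \<in> Vec A" "y \<in> Vec A"
  shows "card A ^ (a * J * D - a) \<le>
    card {zs. length zs = length (coeff_vars J D) \<and> set zs \<subseteq> A \<and> (x, y) \<in> zero_edges J D (assign (param_env lam) (coeff_vars J D) zs) A}"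
    (is "_ \<le> card ?Z")
proof -
  define S where "S = set (coeff_vars J D) - (\<lambda>l. Cf l 0 0) ` {..<a}"
  define u0 where "u0 = (\<lambda>g z. if z \<in> S then g z else param_env lam z)"
  define u where "u = (\<lambda>g z. if z \<in> (\<lambda>l. Cf l 0 0) ` {..<a} then
    (case z of Cf l _ _ \<Rightarrow> - edge_poly J D (u0 g) l x y | _ \<Rightarrow> 0) else u0 g z)"
  have "card S = card (set (coeff_vars J D)) - card ((\<lambda>l. Cf l 0 0) ` {..<a})"
    unfolding S_def using JD by (intro card_Diff_subset) (auto simp: coeff_vars)
  also have "card ((\<lambda>l. Cf l 0 0) ` {..<a}) = a" by (simp add: card_image inj_on_def)
  finally have cardS: "card S = a * J * D - a" using distinct_card[OF coeff_vars(1)] coeff_vars(2) by simp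
  have finS: "finite S" by (simp add: S_def)
  have inj: "inj_on (\<lambda>g. map (u g) (coeff_vars J D)) (S \<rightarrow>\<^sub>E A)"
  proof (rule inj_onI)
    fix g g' assume g: "g \<in> S \<rightarrow>\<^sub>E A" "g' \<in> S \<rightarrow>\<^sub>E A" "map (u g) (coeff_vars J D) = map (u g') (coeff_vars J D)"
    show "g = g'"
    proof (rule PiE_ext[OF g(1,2)])
      fix z assume z: "z \<in> S"
      then have "u g z = u g' z" using g(3) by (auto simp: S_def)
      then show "g z = g' z" using z by (auto simp: u_def u0_def S_def)
    qed
  qed
  have sub: "(\<lambda>g. map (u g) (coeff_vars J D)) ` (S \<rightarrow>\<^sub>E A) \<subseteq> ?Z"
  proof
    fix zs assume "zs \<in> (\<lambda>g. map (u g) (coeff_vars J D)) ` (S \<rightarrow>\<^sub>E A)"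
    then obtain g where g: "g \<in> S \<rightarrow>\<^sub>E A" "zs = map (u g) (coeff_vars J D)" by blast
    have A0: "0 \<in> A" using A by (simp add: finite_subring_def)
    have u0A: "u0 g (Cf l j k) \<in> A" for l j k
      using g(1) A0 by (auto simp: u0_def param_env_def)
    have u0L: "u0 g (Lm j) = lam j" for j by (auto simp: u0_def param_env_def S_def coeff_vars)
    have evA: "edge_poly J D (u0 g) l x y \<in> A" for l
      by (rule edge_poly_mem[where v = "u0 g", OF A u0A _ xy]) (simp add: u0L lam)
    have uA: "u g (Cf l j k) \<in> A" for l j k
      using evA A u0A by (auto simp: u_def finite_subring_def)
    have as: "assign (param_env lam) (coeff_vars J D) zs z = u g z" for z
    proof -
      have "(\<lambda>l. Cf l 0 0) ` {..<a} \<subseteq> set (coeff_vars J D)" using JD by (auto simp: coeff_vars)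
      then show ?thesis unfolding g(2) assign_map by (auto simp: u_def u0_def S_def)
    qed
    have "edge_poly J D (u g) l x y = 0" if l: "l < a" for l
    proof -
      have "edge_poly J D (u g) l x y = edge_poly J D (u0 g) l x y + (u g (Cf l 0 0) - u0 g (Cf l 0 0))"
        by (rule edge_poly_update_constant[OF JD]) (use l in \<open>auto simp: u_def\<close>)
      moreover have "u0 g (Cf l 0 0) = 0" using l by (simp add: u0_def S_def param_env_def)
      moreover have "u g (Cf l 0 0) = - edge_poly J D (u0 g) l x y" using l by (simp add: u_def)
      ultimately show ?thesis by simp
    qed
    moreover have "assign (param_env lam) (coeff_vars J D) zs = u g" using as by blast
    moreover have "set zs \<subseteq> A" unfolding g(2) using uA by (auto simp: coeff_vars)
    ultimately show "zs \<in> ?Z" using xy g(2) by (simp add: zero_edges_def)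
  qed
  have "finite ?Z"
    by (rule finite_subset[OF _ finite_lists_length_eq[of A "length (coeff_vars J D)"]])
      (use A in \<open>auto simp: finite_subring_def\<close>)
  from card_inj_on_le[OF inj sub this] show ?thesis
    using cardS finS by (simp add: card_funcsetE)
qed

definition set_roots :: "(ix \<Rightarrow> 'k) \<Rightarrow> (nat \<times> nat \<Rightarrow> 'k) \<Rightarrow> ix \<Rightarrow> 'k" where
  "set_roots w \<rho> z = (case z of Rt i j \<Rightarrow> \<rho> (i, j) | _ \<Rightarrow> w z)"

text \<open>Embeddings with the same roots inject into the points of \<open>is_copy\<close> over
  \<open>A\<close>. The copy number merely names a block of unknowns, so \<open>c\<close> may depend
  on the roots.\<close>

lemma few_embeddings:
  fixes w :: "ix \<Rightarrow> 'k::comm_ring_1"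
  assumes A: "finite A"
    and few: "\<And>h \<rho>. \<rho> \<in> ({..b} \<times> {..<b}) \<rightarrow>\<^sub>E A \<Longrightarrow>
      \<exists>c. card (points A (concat (unk_vars c)) (is_copy J D h c) (set_roots w \<rho>)) \<le> N"
  shows "\<not> rooted_power (Suc N) (bip (zero_edges J D w A))"
proof
  assume "rooted_power (Suc N) (bip (zero_edges J D w A))"
  then obtain \<Phi> where \<Phi>: "finite \<Phi>" "card \<Phi> = Suc N" "\<Phi> \<subseteq> extensional {..b}"
    "\<And>\<phi>. \<phi> \<in> \<Phi> \<Longrightarrow> embedding (bip (zero_edges J D w A)) \<phi>"
    "\<And>\<phi> \<psi>. \<phi> \<in> \<Phi> \<Longrightarrow> \<psi> \<in> \<Phi> \<Longrightarrow> same_roots \<phi> \<psi>"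
    unfolding rooted_power_def by blast
  then obtain \<phi>0 where \<phi>0: "\<phi>0 \<in> \<Phi>" by fastforce
  have V: "snd (\<phi> i) \<in> Vec A" if "\<phi> \<in> \<Phi>" "i \<le> b" for \<phi> i
  proof (cases i)
    case 0
    then have "bip (zero_edges J D w A) (\<phi> (Suc 0)) (\<phi> i)" using \<Phi>(4)[OF that(1)] b_pos
      unfolding embedding_def by fastforce
    then show ?thesis by (auto simp: bip_def zero_edges_def)
  next
    case (Suc j)
    then have "bip (zero_edges J D w A) (\<phi> i) (\<phi> (cur j))" using \<Phi>(4)[OF that(1)] that(2)
      unfolding embedding_def by fastforce
    then show ?thesis by (auto simp: bip_def zero_edges_def)
  qed
  \<comment> \<open>Position 0 is a root, so its part is common to all members and fixes one
    orientation for the whole family.\<close>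
  define h where "h = (\<not> fst (\<phi>0 0))"
  define \<rho> where "\<rho> = restrict (\<lambda>(i, j). snd (\<phi>0 i) j) ({..b} \<times> {..<b})"
  have "\<rho> \<in> ({..b} \<times> {..<b}) \<rightarrow>\<^sub>E A"
    using V[OF \<phi>0] by (auto simp: \<rho>_def Vec_def)
  from few[OF this, of h] obtain c where
    c: "card (points A (concat (unk_vars c)) (is_copy J D h c) (set_roots w \<rho>)) \<le> N" by blast
  define g :: "(nat \<Rightarrow> bool \<times> (nat \<Rightarrow> 'k)) \<Rightarrow> ix \<Rightarrow> 'k" where
    "g = (\<lambda>\<phi> z. case z of Uk _ i j \<Rightarrow> snd (\<phi> i) j | _ \<Rightarrow> 0)"
  define L where "L = (\<lambda>\<phi>. map (g \<phi>) (concat (unk_vars c)))"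
  have fst_eq: "fst (\<phi> i) \<longleftrightarrow> side i = h" if "\<phi> \<in> \<Phi>" "i \<le> b" for \<phi> i
  proof -
    have "\<phi> 0 = \<phi>0 0" using \<Phi>(5)[OF that(1) \<phi>0] not_unk_0 by (simp add: same_roots_def)
    then show ?thesis using embedding_bip_side[OF \<Phi>(4)[OF that(1)] that(2)] by (auto simp: h_def)
  qed
  have "L ` \<Phi> \<subseteq> points A (concat (unk_vars c)) (is_copy J D h c) (set_roots w \<rho>)"
  proof
    fix zs assume "zs \<in> L ` \<Phi>"
    then obtain \<phi> where \<phi>: "\<phi> \<in> \<Phi>" "zs = L \<phi>" by blast
    define u where "u = assign (set_roots w \<rho>) (concat (unk_vars c)) zs"
    have u: "u z = (if z \<in> set (concat (unk_vars c)) then g \<phi> z else set_roots w \<rho> z)" for z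
      unfolding u_def \<phi>(2) L_def assign_map ..
    have vertex: "vertex u c i = snd (\<phi> i)" if i: "i \<le> b" for i
    proof
      fix j
      show "vertex u c i j = snd (\<phi> i) j"
      proof (cases "j < b")
        case True
        show ?thesis
        proof (cases "unk i")
          case True
          then have "Uk c i j \<in> set (concat (unk_vars c))" using i \<open>j < b\<close> unfolding set_unk_vars by blast
          then have "u (Uk c i j) = snd (\<phi> i) j" unfolding u by (simp add: g_def)
          then show ?thesis using True \<open>j < b\<close> by (simp add: vertex_def)
        next
          case False
          have "Rt i j \<notin> set (concat (unk_vars c))" unfolding set_unk_vars by blast
          then have "u (Rt i j) = snd (\<phi>0 i) j" unfolding u using i True by (simp add: set_roots_def \<rho>_def)
          moreover have "\<phi> i = \<phi>0 i" using \<Phi>(5)[OF \<phi>(1) \<phi>0] False i by (simp add: same_roots_def)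
          ultimately show ?thesis using True False by (simp add: vertex_def)
        qed
      next
        case False
        then show ?thesis using V[OF \<phi>(1) i] by (simp add: vertex_def Vec_def)
      qed
    qed
    have "u (Cf l j k) = w (Cf l j k)" "u (Lm j) = w (Lm j)" for l j k
    proof -
      have "Cf l j k \<notin> set (concat (unk_vars c))" "Lm j \<notin> set (concat (unk_vars c))" unfolding set_unk_vars by blast+
      then show "u (Cf l j k) = w (Cf l j k)" "u (Lm j) = w (Lm j)" unfolding u by (simp_all add: set_roots_def)
    qed
    then have evu: "edge_poly J D u l x y = edge_poly J D w l x y" for l x y by (simp add: edge_poly_def lin_form_def)
    have "is_copy J D h c u"
      unfolding is_copy_def
    proof (intro conjI ballI impI)
      fix i l assume i: "i \<in> {..<b}" and l: "l \<in> {..<a}"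
      have ci: "cur i \<le> b" using cur_le[of i] i by simp
      have "bip (zero_edges J D w A) (\<phi> (Suc i)) (\<phi> (cur i))" using \<Phi>(4)[OF \<phi>(1)] i by (simp add: embedding_def)
      then have "(edge_left h u c i, edge_right h u c i) \<in> zero_edges J D w A"
        using fst_eq[OF \<phi>(1) ci] vertex[OF ci] vertex[of "Suc i"] i
        by (auto simp: bip_def edge_left_def edge_right_def)
      then show "edge_poly J D u l (edge_left h u c i) (edge_right h u c i) = 0" using l unfolding evu by (simp add: zero_edges_def)
    next
      fix i j assume i: "i \<in> {..b}" and j: "j \<in> {..b}" and ij: "i \<noteq> j \<and> side i = side j"
      have "\<phi> i \<noteq> \<phi> j" using \<Phi>(4)[OF \<phi>(1)] i j ij by (auto simp: embedding_def inj_on_def)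
      moreover have "fst (\<phi> i) = fst (\<phi> j)" using fst_eq[OF \<phi>(1)] i j ij by simp
      ultimately have "snd (\<phi> i) \<noteq> snd (\<phi> j)" by (simp add: prod_eq_iff)
      then obtain t where t: "snd (\<phi> i) t \<noteq> snd (\<phi> j) t" by blast
      have "snd (\<phi> i) \<in> Vec A" "snd (\<phi> j) \<in> Vec A" using V[OF \<phi>(1)] i j by auto
      then have "t < b" using t by (metis (mono_tags, lifting) Vec_def mem_Collect_eq not_le)
      then show "\<not> (\<forall>t\<in>{..<b}. vertex u c i t = vertex u c j t)" using t vertex i j by auto
    qed
    moreover have "set zs \<subseteq> A"
    proof
      fix x assume "x \<in> set zs"
      then obtain z where z: "z \<in> set (concat (unk_vars c))" "x = g \<phi> z" unfolding \<phi>(2) L_def by auto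
      then obtain i j where "z = Uk c i j" "i \<le> b" "j < b" unfolding set_unk_vars by blast
      then show "x \<in> A" using z V[OF \<phi>(1), of i] by (simp add: g_def Vec_def)
    qed
    ultimately show "zs \<in> points A (concat (unk_vars c)) (is_copy J D h c) (set_roots w \<rho>)"
      unfolding u_def by (simp add: \<phi>(2) L_def del: length_concat)
  qed
  moreover have "inj_on L \<Phi>"
  proof (rule inj_onI)
    fix \<phi> \<psi> assume *: "\<phi> \<in> \<Phi>" "\<psi> \<in> \<Phi>" "L \<phi> = L \<psi>"
    show "\<phi> = \<psi>"
    proof (rule extensionalityI[where A = "{..b}"])
      fix i assume i: "i \<in> {..b}"
      show "\<phi> i = \<psi> i"
      proof (cases "unk i")
        case True
        have "snd (\<phi> i) j = snd (\<psi> i) j" for j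
        proof (cases "j < b")
          case True
          have "Uk c i j \<in> set (concat (unk_vars c))" using i True \<open>unk i\<close> unfolding set_unk_vars by blast
          then have "g \<phi> (Uk c i j) = g \<psi> (Uk c i j)" using *(3) unfolding L_def map_eq_conv by blast
          then show ?thesis by (simp add: g_def)
        next
          case False
          then show ?thesis using V[OF *(1), of i] V[OF *(2), of i] i by (simp add: Vec_def)
        qed
        moreover have "fst (\<phi> i) = fst (\<psi> i)" using fst_eq[OF *(1)] fst_eq[OF *(2)] i by simp
        ultimately show ?thesis by (simp add: prod_eq_iff fun_eq_iff)
      next
        case False
        then show ?thesis using \<Phi>(5)[OF *(1,2)] i by (simp add: same_roots_def)
      qed
    qed (use * \<Phi>(3) in auto)
  qed
  ultimately have "card \<Phi> \<le> card (points A (concat (unk_vars c)) (is_copy J D h c) (set_roots w \<rho>))"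
    by (intro card_inj_on_le[of L] finite_points A)
  then show False using c \<Phi>(2) by simp
qed

text \<open>Every \<open>y\<close> occurs in at least \<open>L\<close> outcomes, and discarding at
  most \<open>L / 2\<close> outcomes loses at most half of the incidences. \<open>T\<close> is the
  average number of incidences per outcome, so some remaining outcome reaches half of it.\<close>

lemma averaging:
  fixes q :: nat
  assumes fin: "finite \<Omega>" "finite W" and bad: "Bad \<subseteq> \<Omega>" "2 * card Bad \<le> L"
    and R: "\<And>y. y \<in> W \<Longrightarrow> L \<le> card {x \<in> \<Omega>. R x y}" and pos: "L > 0" "card W > 0"
    and T: "card \<Omega> * T = card W * L"
  shows "\<exists>x \<in> \<Omega> - Bad. T \<le> 2 * card {y \<in> W. R x y}"
proof (rule ccontr)
  assume neg: "\<not> ?thesis"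
  have finB: "finite Bad" using fin bad finite_subset by blast
  have "card W * L \<le> (\<Sum>y\<in>W. card {x \<in> \<Omega>. R x y})"
    using sum_bounded_below[of W L "\<lambda>y. card {x \<in> \<Omega>. R x y}"] R by simp
  also have "\<dots> = (\<Sum>x\<in>\<Omega>. card {y \<in> W. R x y})"
    using sum.swap_restrict[OF fin, of "\<lambda>_ _. 1 :: nat" R] by simp
  also have "\<dots> = (\<Sum>x\<in>\<Omega> - Bad. card {y \<in> W. R x y}) + (\<Sum>x\<in>Bad. card {y \<in> W. R x y})"
    by (rule sum.subset_diff[OF bad(1) fin(1)])
  also have "(\<Sum>x\<in>Bad. card {y \<in> W. R x y}) \<le> card Bad * card W"
    using sum_bounded_above[of Bad "\<lambda>x. card {y \<in> W. R x y}" "card W"] fin(2)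
    by (simp add: card_mono)
  finally have "card W * L \<le> (\<Sum>x\<in>\<Omega> - Bad. card {y \<in> W. R x y}) + card Bad * card W" by simp
  moreover have "2 * card Bad * card W \<le> L * card W" by (rule mult_right_mono[OF bad(2)]) simp
  ultimately have 1: "2 * (card W * L) \<le> 2 * (\<Sum>x\<in>\<Omega> - Bad. card {y \<in> W. R x y}) + L * card W"
    by linarith
  have small: "2 * card {y \<in> W. R x y} + 1 \<le> T" if "x \<in> \<Omega> - Bad" for x
  proof -
    have "\<not> T \<le> 2 * card {y \<in> W. R x y}" using neg that by blast
    then show ?thesis by linarith
  qed
  have "2 * (\<Sum>x\<in>\<Omega> - Bad. card {y \<in> W. R x y}) + card (\<Omega> - Bad) =
      (\<Sum>x\<in>\<Omega> - Bad. 2 * card {y \<in> W. R x y} + 1)"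
    unfolding sum.distrib sum_distrib_left by simp
  also have "\<dots> \<le> card (\<Omega> - Bad) * T"
    using sum_bounded_above[of "\<Omega> - Bad" "\<lambda>x. 2 * card {y \<in> W. R x y} + 1" T] small by simp
  also have "\<dots> \<le> card W * L"
    unfolding T[symmetric] using fin(1) by (intro mult_right_mono card_mono) auto
  finally have 2: "2 * (\<Sum>x\<in>\<Omega> - Bad. card {y \<in> W. R x y}) + card (\<Omega> - Bad) \<le> card W * L" .
  have "card W * L > 0" using pos by simp
  then have "\<Omega> - Bad \<noteq> {}" using 1 by (intro notI) (simp only: sum.empty, simp add: mult.commute)
  then have "card (\<Omega> - Bad) > 0" using fin(1) by (simp add: card_gt_0_iff)
  then show False using 1 2 by (simp add: mult.commute)
qed

lemma exists_dense_bipartite: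
  "\<exists>p q0. \<forall>A :: 'k::alg_closed_field set. finite_subring A \<longrightarrow> q0 \<le> card A \<longrightarrow>
     (\<exists>E. E \<subseteq> Vec A \<times> Vec A \<and> card A ^ (2 * b - a) \<le> 2 * card E \<and> \<not> rooted_power p (bip E))"
proof -
  define s where "s = b * (b + 1) + a + 1"
  define D where "D = s * b"
  define J where "J = (s * b)\<^sup>2 * (2 * b) + 1"
  define M where "M = a * J * D"
  have s1: "s \<ge> 1" by (simp add: s_def)
  have D1: "D \<ge> s" using b_pos by (simp add: D_def)
  have "s \<le> a * J * D"
  proof -
    have "1 * 1 * s \<le> a * J * D" using a_pos D1 by (intro mult_le_mono) (auto simp: J_def)
    then show ?thesis by simp
  qed
  then have sM: "s \<le> M" by (simp add: M_def)
  \<comment> \<open>Positive dimension is demanded for every copy number below \<open>s\<close>,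
    which is the form needed by the tuple argument. Its failure still yields one copy number with a
    finite fibre, and that suffices for \<open>few_embeddings\<close>.\<close>
  define Q where "Q = (\<lambda>h w :: ix \<Rightarrow> 'k. \<forall>c\<in>{..<s}. dim_ge 1 (concat (unk_vars c)) (is_copy J D h c) w)"
  have "constructible (Q h)" for h
    unfolding Q_def by (intro constructible_ball constructible_dim_ge constructible_is_copy) simp
  then have "\<forall>h. \<exists>K. \<forall>v A. finite A \<longrightarrow> A \<noteq> {} \<longrightarrow> \<not> dim_ge (Suc (M - s)) (coeff_vars J D) (Q h) v \<longrightarrow>
      card (points A (coeff_vars J D) (Q h) v) \<le> K * card A ^ (M - s)"
    by (intro allI card_points_le)
  from choice[OF this] obtain K where
    "\<forall>h v A. finite A \<longrightarrow> A \<noteq> {} \<longrightarrow> \<not> dim_ge (Suc (M - s)) (coeff_vars J D) (Q h) v \<longrightarrow>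
      card (points A (coeff_vars J D) (Q h) v) \<le> K h * card A ^ (M - s)" by (elim exE)
  then have K: "card (points A (coeff_vars J D) (Q h) v) \<le> K h * card A ^ (M - s)"
    if "finite A" "A \<noteq> {}" "\<not> dim_ge (Suc (M - s)) (coeff_vars J D) (Q h) v" for h v A
    using that by simp
  have "\<forall>hc. \<exists>K. \<forall>v A. finite A \<longrightarrow> A \<noteq> {} \<longrightarrow> \<not> dim_ge (Suc 0) (concat (unk_vars (snd hc))) (is_copy J D (fst hc) (snd hc)) (v :: ix \<Rightarrow> 'k) \<longrightarrow>
      card (points A (concat (unk_vars (snd hc))) (is_copy J D (fst hc) (snd hc)) v) \<le> K * card A ^ 0"
    by (intro allI card_points_le constructible_is_copy)
  from choice[OF this] obtain N where N0:
    "\<forall>hc v A. finite A \<longrightarrow> A \<noteq> {} \<longrightarrow> \<not> dim_ge (Suc 0) (concat (unk_vars (snd hc))) (is_copy J D (fst hc) (snd hc)) (v :: ix \<Rightarrow> 'k) \<longrightarrow>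
      card (points A (concat (unk_vars (snd hc))) (is_copy J D (fst hc) (snd hc)) v) \<le> N hc * card A ^ 0" by (elim exE)
  have N: "card (points A (concat (unk_vars c)) (is_copy J D h c) v) \<le> N (h, c)"
    if "finite A" "A \<noteq> {}" "\<not> dim_ge (Suc 0) (concat (unk_vars c)) (is_copy J D h c) (v :: ix \<Rightarrow> 'k)" for h c v A
    using N0[THEN spec[of _ "(h, c)"], THEN spec[of _ v], THEN spec[of _ A]] that by simp
  define N1 where "N1 = (\<Sum>c<s. N (True, c) + N (False, c))"
  have N1: "N (h, c) \<le> N1" if "c < s" for h c
  proof -
    have "N (h, c) \<le> N (True, c) + N (False, c)" by (cases h) auto
    also have "\<dots> \<le> N1" unfolding N1_def by (rule member_le_sum) (use that in auto)
    finally show ?thesis .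
  qed
  \<comment> \<open>\<open>J\<close> provides distinct parameters for the forms. In the other term,
    one factor 2 comes from the orientation \<open>h\<close> and one from the demand that bad
    coefficients fill at most half of the edge probability.\<close>
  define q0 where "q0 = J + 4 * (K True + K False) + 2"
  have "\<exists>E. E \<subseteq> Vec A \<times> Vec A \<and> card A ^ (2 * b - a) \<le> 2 * card E \<and> \<not> rooted_power (Suc N1) (bip E)"
    if A: "finite_subring A" and q0: "q0 \<le> card A" for A :: "'k set"
  proof -
    define q where "q = card A"
    have fA: "finite A" and neA: "A \<noteq> {}" using A by (auto simp: finite_subring_def)
    have qpos: "q > 0" using q0 by (simp add: q_def q0_def)
    have "card {..<J} \<le> card A" using q0 by (simp add: q0_def)
    then obtain lam :: "nat \<Rightarrow> 'k" where lam: "lam ` {..<J} \<subseteq> A" "inj_on lam {..<J}"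
      using inj_on_iff_card_le[OF finite_lessThan fA] by blast
    define \<Omega> where "\<Omega> = {zs. length zs = length (coeff_vars J D) \<and> set zs \<subseteq> A}"
    define env where "env = (\<lambda>zs. assign (param_env lam) (coeff_vars J D) zs)"
    have \<Omega>: "finite \<Omega>" "card \<Omega> = q ^ M"
      using finite_lists_length_eq[OF fA, of "length (coeff_vars J D)"] card_lists_length_eq[OF fA, of "length (coeff_vars J D)"]
      by (simp_all add: \<Omega>_def conj_commute coeff_vars(2) M_def q_def)
    define Rho where "Rho = ({..b} \<times> {..<b}) \<rightarrow>\<^sub>E A"
    have Rho: "finite Rho" "card Rho = q ^ (b * (b + 1))"
      using fA by (simp_all add: Rho_def finite_PiE card_funcsetE card_cartesian_product q_def algebra_simps)
    define Bad where "Bad = (\<Union>(h, \<rho>)\<in>UNIV \<times> Rho. points A (coeff_vars J D) (Q h) (set_roots (param_env lam) \<rho>))"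
    have "card (points A (coeff_vars J D) (Q h) (set_roots (param_env lam) \<rho>)) \<le> (K True + K False) * q ^ (M - s)" for h \<rho>
    proof -
      have "inj_on (\<lambda>j. set_roots (param_env lam) \<rho> (Lm j)) {..<J}" using lam(2) by (simp add: set_roots_def param_env_def)
      then have "dim_ge e (coeff_vars J D) (Q h) (set_roots (param_env lam) \<rho>) \<Longrightarrow> e + s \<le> M" for e
        unfolding Q_def M_def by (rule dim_bad_coefficients) (simp_all add: J_def D_def)
      then have "\<not> dim_ge (Suc (M - s)) (coeff_vars J D) (Q h) (set_roots (param_env lam) \<rho>)" using sM by fastforce
      from K[OF fA neA this] have "card (points A (coeff_vars J D) (Q h) (set_roots (param_env lam) \<rho>)) \<le> K h * q ^ (M - s)"
        by (simp add: q_def)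
      also have "\<dots> \<le> (K True + K False) * q ^ (M - s)" by (intro mult_right_mono) (cases h; simp)+
      finally show ?thesis .
    qed
    note pts = this
    have "card Bad \<le> (\<Sum>(h, \<rho>)\<in>UNIV \<times> Rho. card (points A (coeff_vars J D) (Q h) (set_roots (param_env lam) \<rho>)))"
      unfolding Bad_def case_prod_unfold by (rule card_UN_le) (use Rho in auto)
    also have "\<dots> \<le> (\<Sum>(h, \<rho>)\<in>(UNIV :: bool set) \<times> Rho. (K True + K False) * q ^ (M - s))"
      using pts by (intro sum_mono) auto
    also have "\<dots> = 2 * q ^ (b * (b + 1)) * ((K True + K False) * q ^ (M - s))"
      by (simp add: card_cartesian_product Rho case_prod_unfold)
    finally have "card Bad \<le> 2 * q ^ (b * (b + 1)) * ((K True + K False) * q ^ (M - s))" .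
    then have "2 * card Bad \<le> 4 * (K True + K False) * (q ^ (b * (b + 1)) * q ^ (M - s))"
      by (simp only: algebra_simps)
    also have "\<dots> \<le> q * (q ^ (b * (b + 1)) * q ^ (M - s))"
      using q0 by (intro mult_right_mono) (simp_all add: q0_def q_def)
    also have "\<dots> = q ^ (M - a)"
    proof -
      have "M - a = Suc (b * (b + 1) + (M - s))" using sM by (simp add: s_def)
      then show ?thesis by (simp add: power_add)
    qed
    finally have bad: "2 * card Bad \<le> q ^ (M - a)" .
    have BadO: "Bad \<subseteq> \<Omega>" by (auto simp: Bad_def \<Omega>_def)
    have "\<exists>zs\<in>\<Omega> - Bad. q ^ (2 * b - a) \<le> 2 * card {xy \<in> Vec A \<times> Vec A. xy \<in> zero_edges J D (env zs) A}"
    proof (rule averaging[OF \<Omega>(1) _ BadO bad])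
      show "finite (Vec A \<times> Vec A)" using finite_Vec[OF fA] by blast
      show "q ^ (M - a) \<le> card {zs \<in> \<Omega>. xy \<in> zero_edges J D (env zs) A}" if xyV: "xy \<in> Vec A \<times> Vec A" for xy
      proof -
        obtain x y where xy: "xy = (x, y)" "x \<in> Vec A" "y \<in> Vec A" using xyV by auto
        have "lam j \<in> A" if "j < J" for j using lam(1) that by auto
        from edge_probability[where J = J and D = D and lam = lam, OF A this _ _ xy(2,3)] show ?thesis
          using D1 s1 unfolding xy(1) \<Omega>_def env_def M_def q_def by (simp add: J_def conj_assoc)
      qed
      show "q ^ (M - a) > 0" using qpos by simp
      show "card (Vec A \<times> Vec A) > 0" using qpos by (simp add: card_cartesian_product card_Vec[OF fA] q_def)
      have "a \<le> M" using sM by (simp add: s_def)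
      then have "M + (2 * b - a) = b + b + (M - a)" using a_le_b by simp
      then show "card \<Omega> * q ^ (2 * b - a) = card (Vec A \<times> Vec A) * q ^ (M - a)"
        unfolding \<Omega>(2) card_cartesian_product card_Vec[OF fA] q_def[symmetric] by (simp flip: power_add)
    qed
    then obtain zs where zs: "zs \<in> \<Omega> - Bad"
      "q ^ (2 * b - a) \<le> 2 * card {xy \<in> Vec A \<times> Vec A. xy \<in> zero_edges J D (env zs) A}" by blast
    have "{xy \<in> Vec A \<times> Vec A. xy \<in> zero_edges J D (env zs) A} = zero_edges J D (env zs) A" by (auto simp: zero_edges_def)
    moreover have "\<not> rooted_power (Suc N1) (bip (zero_edges J D (env zs) A))"
    proof (rule few_embeddings[OF fA])
      fix h \<rho> assume "\<rho> \<in> ({..b} \<times> {..<b}) \<rightarrow>\<^sub>E A"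
      then have "zs \<notin> points A (coeff_vars J D) (Q h) (set_roots (param_env lam) \<rho>)" using zs(1) by (auto simp: Bad_def Rho_def)
      then have "\<not> Q h (assign (set_roots (param_env lam) \<rho>) (coeff_vars J D) zs)" using zs(1) by (auto simp: \<Omega>_def)
      also have "assign (set_roots (param_env lam) \<rho>) (coeff_vars J D) zs = set_roots (env zs) \<rho>"
      proof
        fix z
        have len: "length zs = length (coeff_vars J D)" using zs(1) by (simp add: \<Omega>_def)
        have off: "assign v is xs z = v z" if "z \<notin> set is" for v :: "ix \<Rightarrow> 'k" and "is" xs
          using that by (induction v "is" xs rule: assign.induct) auto
        have on: "assign v is xs z = assign v' is xs z" if "z \<in> set is" "length xs = length is"
          for v v' :: "ix \<Rightarrow> 'k" and "is" xs
          using that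
        proof (induction v "is" xs arbitrary: v' rule: assign.induct)
          case (1 v i "is" x xs)
          show ?case
          proof (cases "z \<in> set is")
            case True
            then show ?thesis using 1 by (simp del: fun_upd_apply)
          next
            case False
            then show ?thesis using 1 off[OF False] by simp
          qed
        qed auto
        show "assign (set_roots (param_env lam) \<rho>) (coeff_vars J D) zs z = set_roots (env zs) \<rho> z"
        proof (cases "z \<in> set (coeff_vars J D)")
          case True
          then have "set_roots (env zs) \<rho> z = env zs z" by (auto simp: coeff_vars(3) set_roots_def)
          then show ?thesis unfolding env_def using on[OF True len] by simp
        next
          case False
          have "env zs z = param_env lam z" unfolding env_def by (rule off[OF False])
          then have "set_roots (env zs) \<rho> z = set_roots (param_env lam) \<rho> z" by (cases z) (simp_all add: set_roots_def)
          then show ?thesis unfolding off[OF False] by (rule sym)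
        qed
      qed
      finally obtain c where c: "c < s" "\<not> dim_ge (Suc 0) (concat (unk_vars c)) (is_copy J D h c) (set_roots (env zs) \<rho>)"
        unfolding Q_def by auto
      from N[OF fA neA c(2)] N1[OF c(1), of h]
      show "\<exists>c. card (points A (concat (unk_vars c)) (is_copy J D h c) (set_roots (env zs) \<rho>)) \<le> N1"
        by (intro exI[of _ c]) simp
    qed
    moreover have "zero_edges J D (env zs) A \<subseteq> Vec A \<times> Vec A" by (auto simp: zero_edges_def)
    ultimately show ?thesis using zs(2) unfolding q_def by (intro exI[of _ "zero_edges J D (env zs) A"]) simp
  qed
  then show ?thesis by blast
qed
end

section \<open>Supersaturation\<close>

text \<open>While some axis-parallel line meets the set in 1 to \<open>d\<close> points, these
  points are deleted. Each deletion removes at most \<open>d\<close> points and a whole line, so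
  \<open>d\<close> times the number of occupied lines stays below the number of points and the set
  never becomes empty.\<close>

lemma exists_subset_line_dense:
  assumes "finite V" "S \<subseteq> {..<k} \<rightarrow>\<^sub>E V" "k * card V ^ (k - 1) * d < card S"
  shows "\<exists>S'\<subseteq>S. S' \<noteq> {} \<and> (\<forall>s\<in>S'. \<forall>i<k. d < card {x. s(i := x) \<in> S'})"
proof -
  \<comment> \<open>A line in direction \<open>i\<close> is encoded by its remaining coordinates;
    there are at most \<open>k * card V ^ (k - 1)\<close> of them.\<close>
  define lines :: "(nat \<Rightarrow> 'a) set \<Rightarrow> (nat \<times> (nat \<Rightarrow> 'a)) set" where
    "lines = (\<lambda>S. (\<lambda>(i, s). (i, restrict s ({..<k} - {i}))) ` ({..<k} \<times> S))"
  have finPi: "finite ({..<k} \<rightarrow>\<^sub>E V)" using assms(1) by (simp add: finite_PiE)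
  have main: "\<exists>S'\<subseteq>S. S' \<noteq> {} \<and> (\<forall>s\<in>S'. \<forall>i<k. d < card {x. s(i := x) \<in> S'})"
    if "S \<subseteq> {..<k} \<rightarrow>\<^sub>E V" "d * card (lines S) < card S" for S
    using that
  proof (induction "card S" arbitrary: S rule: less_induct)
    case less
    have finS: "finite S" using less.prems(1) finPi finite_subset by blast
    show ?case
    proof (cases "\<forall>s\<in>S. \<forall>i<k. d < card {x. s(i := x) \<in> S}")
      case True
      then show ?thesis using less.prems(2) by (intro exI[of _ S]) auto
    next
      case False
      then obtain s i where si: "s \<in> S" "i < k" "card {x. s(i := x) \<in> S} \<le> d" by (auto simp: not_less)
      define R where "R = (\<lambda>x. s(i := x)) ` {x. s(i := x) \<in> S}"
      have finx: "finite {x. s(i := x) \<in> S}"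
        using finS by (rule finite_surj[where f = "\<lambda>s. s i"]) (auto simp: image_iff, metis fun_upd_same)
      have R: "R \<subseteq> S" "card R \<le> d" "s \<in> R"
        using si card_image_le[OF finx, of "\<lambda>x. s(i := x)"] unfolding R_def
        by (auto intro!: image_eqI[of _ _ "s i"])
      have card: "card (S - R) = card S - card R" "card R \<le> card S"
        using R finS by (auto simp: card_Diff_subset finite_subset card_mono)
      have "lines (S - R) \<subseteq> lines S - {(i, restrict s ({..<k} - {i}))}"
      proof
        fix l assume "l \<in> lines (S - R)"
        then obtain i' s' where l: "l = (i', restrict s' ({..<k} - {i'}))" "i' < k" "s' \<in> S" "s' \<notin> R"
          unfolding lines_def by auto
        have "l \<noteq> (i, restrict s ({..<k} - {i}))"
        proof
          assume "l = (i, restrict s ({..<k} - {i}))"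
          then have eq: "i' = i" "restrict s' ({..<k} - {i}) = restrict s ({..<k} - {i})" using l(1) by auto
          have "s' = s(i := s' i)"
          proof
            fix c
            have "s c = undefined" "s' c = undefined" if "\<not> c < k"
              using that l(3) si(1) less.prems(1) by (auto simp: PiE_iff extensional_def subset_iff)
            then show "s' c = (s(i := s' i)) c" using fun_cong[OF eq(2), of c] by (auto split: if_splits)
          qed
          then have "s' \<in> R" unfolding R_def using l(3) by (metis (mono_tags, lifting) image_eqI mem_Collect_eq)
          then show False using l(4) by simp
        qed
        then show "l \<in> lines S - {(i, restrict s ({..<k} - {i}))}"
          using l by (auto simp: lines_def)
      qed
      moreover have fl: "finite (lines S)" using finS by (simp add: lines_def)
      moreover have "(i, restrict s ({..<k} - {i})) \<in> lines S" using si by (auto simp: lines_def)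
      ultimately have "card (lines (S - R)) < card (lines S)"
        by (intro psubset_card_mono) auto
      then have "d * card (lines (S - R)) + d \<le> d * card (lines S)"
        by (metis Suc_leI mult_Suc_right mult_le_mono2 add.commute)
      then have f3: "d * card (lines (S - R)) < card (S - R)" using less.prems(2) card R(2) by linarith
      have f1: "card (S - R) < card S" using R finS by (intro psubset_card_mono) auto
      have f2: "S - R \<subseteq> {..<k} \<rightarrow>\<^sub>E V" using less.prems(1) by blast
      from less.hyps[OF f1 f2 f3] obtain S' where
        "S' \<subseteq> S - R" "S' \<noteq> {}" "\<forall>s\<in>S'. \<forall>i<k. d < card {x. s(i := x) \<in> S'}" by (elim exE conjE)
      then show ?thesis by (intro exI[of _ S']) auto
    qed
  qed
  have "lines S \<subseteq> Sigma {..<k} (\<lambda>i. ({..<k} - {i}) \<rightarrow>\<^sub>E V)"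
  proof
    fix l assume "l \<in> lines S"
    then obtain i s where l: "l = (i, restrict s ({..<k} - {i}))" "i < k" "s \<in> S" unfolding lines_def by auto
    then have "s c \<in> V" if "c < k" for c using that assms(2) by (auto simp: PiE_iff subset_iff)
    then have "restrict s ({..<k} - {i}) \<in> ({..<k} - {i}) \<rightarrow>\<^sub>E V" by (simp add: restrict_PiE_iff)
    then show "l \<in> Sigma {..<k} (\<lambda>i. ({..<k} - {i}) \<rightarrow>\<^sub>E V)" using l by simp
  qed
  then have "card (lines S) \<le> card (Sigma {..<k} (\<lambda>i. ({..<k} - {i}) \<rightarrow>\<^sub>E V))"
    using assms(1) by (intro card_mono finite_SigmaI) (auto simp: finite_PiE)
  also have "\<dots> = (\<Sum>i<k. card V ^ (k - 1))"
    using assms(1) by (simp add: card_SigmaI finite_PiE card_funcsetE)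
  finally have "card (lines S) \<le> k * card V ^ (k - 1)" by simp
  then have "d * card (lines S) \<le> d * (k * card V ^ (k - 1))" by (rule mult_le_mono2)
  also have "\<dots> < card S" using assms(3) by (simp only: mult.commute)
  finally show ?thesis by (rule main[OF assms(2)])
qed

context caterpillar
begin

lemma exists_dense_bipartite_nat:
  "\<exists>p q0. \<forall>m. q0 \<le> (2::nat) ^ m \<longrightarrow> (\<exists>E. E \<subseteq> {..<(2 ^ m) ^ b} \<times> {..<(2 ^ m) ^ b} \<and>
     (2 ^ m) ^ (2 * b - a) \<le> 2 * card E \<and> \<not> rooted_power p (bip (E :: (nat \<times> nat) set)))"
proof -
  obtain p q0 where pq: "\<And>A :: bit alg_closure set. finite_subring A \<Longrightarrow> q0 \<le> card A \<Longrightarrow>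
     (\<exists>E. E \<subseteq> Vec A \<times> Vec A \<and> card A ^ (2 * b - a) \<le> 2 * card E \<and> \<not> rooted_power p (bip E))"
    using exists_dense_bipartite by blast
  have "\<exists>E. E \<subseteq> {..<(2 ^ m) ^ b} \<times> {..<(2 ^ m) ^ b} \<and>
     (2 ^ m) ^ (2 * b - a) \<le> 2 * card E \<and> \<not> rooted_power p (bip (E :: (nat \<times> nat) set))"
    if q0: "q0 + 2 \<le> (2::nat) ^ m" for m
  proof -
    \<comment> \<open>The summand 2 excludes \<open>m = 0\<close>, for which
      \<open>fixed_field\<close> would be the whole field.\<close>
    have m: "m > 0" using q0 by (cases m) auto
    have ch: "CHAR(bit alg_closure) = 2" by (simp add: CHAR_bit)
    define A :: "bit alg_closure set" where "A = fixed_field m"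
    have A: "finite_subring A" "card A = 2 ^ m"
      unfolding A_def using m ch by (simp_all add: finite_subring_fixed_field card_fixed_field)
    from pq[OF A(1)] obtain E where E: "E \<subseteq> Vec A \<times> Vec A" "card A ^ (2 * b - a) \<le> 2 * card E"
      "\<not> rooted_power p (bip E)" using q0 A(2) by auto
    have fA: "finite A" using A by (simp add: finite_subring_def)
    obtain f where f: "bij_betw f (Vec A) {0..<card (Vec A)}"
      using ex_bij_betw_finite_nat[OF finite_Vec[OF fA]] by blast
    have N: "{0..<card (Vec A)} = {..<(2 ^ m) ^ b}" using card_Vec[OF fA] A(2) by auto
    define g where "g = inv_into (Vec A) f"
    have g: "bij_betw g {..<(2 ^ m) ^ b} (Vec A)"
      unfolding g_def N[symmetric] by (rule bij_betw_inv_into[OF f])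
    have gf: "g (f x) = x" if "x \<in> Vec A" for x
      unfolding g_def using f that by (simp add: bij_betw_inv_into_left)
    have injf: "inj_on f (Vec A)" using f by (simp add: bij_betw_def)
    define E' where "E' = map_prod f f ` E"
    have "inj_on (map_prod f f) E" by (rule inj_on_subset[OF map_prod_inj_on[OF injf injf] E(1)])
    then have cE: "card E' = card E" unfolding E'_def by (rule card_image)
    have E': "E' \<subseteq> {..<(2 ^ m) ^ b} \<times> {..<(2 ^ m) ^ b}"
      using E(1) f unfolding E'_def N[symmetric] bij_betw_def by auto
    have gE: "(g x, g y) \<in> E" if "(x, y) \<in> E'" for x y
      using that E(1) gf unfolding E'_def by auto
    have "\<not> rooted_power p (bip E')"
    proof
      assume "rooted_power p (bip E')"
      then have "rooted_power p (bip E)"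
      proof (rule rooted_power_map[where f = "map_prod id g" and S = "UNIV \<times> {..<(2 ^ m) ^ b}", rotated 2])
        show "inj_on (map_prod id g) (UNIV \<times> {..<(2 ^ m) ^ b})"
          using g by (intro map_prod_inj_on) (auto simp: bij_betw_def)
        fix u w assume "bip E' u w"
        then show "u \<in> UNIV \<times> {..<(2 ^ m) ^ b} \<and> w \<in> UNIV \<times> {..<(2 ^ m) ^ b} \<and>
          bip E (map_prod id g u) (map_prod id g w)"
          using gE E' by (cases u; cases w) (auto simp: bip_def)
      qed
      then show False using E(3) by simp
    qed
    then show ?thesis using E' cE E(2) A(2) by (intro exI[of _ E']) simp
  qed
  then show ?thesis by blast
qed

text \<open>Embedding edge by edge with position 0 at \<open>x0\<close> leaves \<open>z\<close>
  choices each time, so there are at least \<open>z ^ b\<close> embeddings. The other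
  \<open>b - a\<close> roots have at most \<open>card V ^ (b - a)\<close> placements, and one
  placement is used by \<open>p\<close> embeddings.\<close>

lemma exists_rooted_copies:
  fixes L :: "'v \<Rightarrow> 'v \<Rightarrow> bool"
  assumes V: "finite V" "\<And>x y. L x y \<Longrightarrow> x \<in> V \<and> y \<in> V"
    and deg: "\<And>x y. L x y \<Longrightarrow> z + b < card {y'. L x y'}" "\<And>x y. L x y \<Longrightarrow> z + b < card {x'. L x' y}"
    and xy0: "L x0 y0" and z: "p * card V ^ (b - a) \<le> z ^ b"
  shows "\<exists>\<Phi>. finite \<Phi> \<and> card \<Phi> = p \<and> \<Phi> \<subseteq> extensional {..b} \<and>
    (\<forall>\<phi>\<in>\<Phi>. inj_on \<phi> {..b} \<and> (\<forall>i<b. L (\<phi> (Suc i)) (\<phi> (cur i)) \<or> L (\<phi> (cur i)) (\<phi> (Suc i)))) \<and>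
    (\<forall>\<phi>\<in>\<Phi>. \<forall>\<psi>\<in>\<Phi>. same_roots \<phi> \<psi>)"
proof -
  \<comment> \<open>\<open>L\<close> need not be symmetric: vertices with \<open>side\<close> false
    serve as first arguments, the others as second arguments.\<close>
  define ed where "ed = (\<lambda>\<phi> i. if side (cur i) then L (\<phi> (Suc i)) (\<phi> (cur i)) else L (\<phi> (cur i)) (\<phi> (Suc i)))"
  define Nm where "Nm = (\<lambda>m. {\<phi> \<in> {..m} \<rightarrow>\<^sub>E V. inj_on \<phi> {..m} \<and> \<phi> 0 = x0 \<and> (\<forall>i<m. ed \<phi> i)})"
  have finN: "finite (Nm m)" for m unfolding Nm_def using V(1) by (simp add: finite_PiE)
  have count: "z ^ m \<le> card (Nm m)" if "m \<le> b" for m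
    using that
  proof (induction m)
    case 0
    have "restrict (\<lambda>_. x0) {..0} \<in> Nm 0" using V(2)[OF xy0] by (auto simp: Nm_def)
    then have "card (Nm 0) > 0" using finN[of 0] by (auto simp: card_gt_0_iff)
    then show ?case by simp
  next
    case (Suc m)
    define Ext where "Ext = (\<lambda>\<phi>. {x. \<phi>(Suc m := x) \<in> Nm (Suc m)})"
    have ExtV: "Ext \<phi> \<subseteq> V" for \<phi>
    proof
      fix x assume "x \<in> Ext \<phi>"
      then have "(\<phi>(Suc m := x)) (Suc m) \<in> V" unfolding Ext_def Nm_def by blast
      then show "x \<in> V" by simp
    qed
    have Ext: "z \<le> card (Ext \<phi>)" if \<phi>: "\<phi> \<in> Nm m" for \<phi>
    proof -
      define Dg where "Dg = (if side (cur m) then {x'. L x' (\<phi> (cur m))} else {y'. L (\<phi> (cur m)) y'})"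
      have "\<exists>y. if side (cur m) then L y (\<phi> (cur m)) else L (\<phi> (cur m)) y"
      proof (cases "cur m")
        case 0
        then show ?thesis using \<phi> xy0 side_0 by (auto simp: Nm_def)
      next
        case (Suc i)
        then have "i < m" using cur_le[of m] by simp
        then have "ed \<phi> i" using \<phi> by (simp add: Nm_def)
        then show ?thesis using Suc side_Suc[of i] by (auto simp: ed_def split: if_splits)
      qed
      then have "z + b < card Dg" using deg unfolding Dg_def by (cases "side (cur m)") auto
      \<comment> \<open>The excess \<open>b\<close> in the degree condition pays for the vertices
        that are already occupied.\<close>
      moreover have "card (\<phi> ` {..m}) \<le> b" using card_image_le[of "{..m}" \<phi>] Suc.prems by simp
      ultimately have "z \<le> card (Dg - \<phi> ` {..m})"
        using diff_card_le_card_Diff[of "\<phi> ` {..m}" Dg] by simp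
      also have "Dg - \<phi> ` {..m} \<subseteq> Ext \<phi>"
      proof
        fix x assume x: "x \<in> Dg - \<phi> ` {..m}"
        have ci: "cur i \<noteq> Suc m" if "i \<le> m" for i using cur_le[of i] that by simp
        have xV: "x \<in> V" using x V(2) unfolding Dg_def by (auto split: if_splits)
        have "\<phi>(Suc m := x) \<in> {..Suc m} \<rightarrow>\<^sub>E V"
          using \<phi> xV unfolding Nm_def atMost_Suc by (intro PiE_fun_upd) auto
        moreover have "inj_on (\<phi>(Suc m := x)) {..Suc m}"
        proof -
          have "inj_on \<phi> {..m}" using \<phi> by (simp add: Nm_def)
          then have "inj_on (\<phi>(Suc m := x)) {..m}" by (rule inj_on_cong[THEN iffD1, rotated]) simp
          then show ?thesis using x unfolding atMost_Suc by (auto simp: image_iff)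
        qed
        moreover have "ed (\<phi>(Suc m := x)) i" if "i < Suc m" for i
        proof (cases "i = m")
          case True
          then show ?thesis using x ci[of m] by (auto simp: ed_def Dg_def)
        next
          case False
          then have "i < m" using that by simp
          then have "ed \<phi> i" using \<phi> by (simp add: Nm_def)
          then show ?thesis using ci[of i] \<open>i < m\<close> by (simp add: ed_def)
        qed
        moreover have "\<phi> 0 = x0" using \<phi> by (simp add: Nm_def)
        ultimately show "x \<in> Ext \<phi>" by (simp add: Ext_def Nm_def)
      qed
      then have "card (Dg - \<phi> ` {..m}) \<le> card (Ext \<phi>)"
        using finite_subset[OF ExtV V(1)] by (intro card_mono)
      finally show ?thesis .
    qed
    have inj: "inj_on (\<lambda>(\<phi>, x). \<phi>(Suc m := x)) (Sigma (Nm m) Ext)"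
    proof (rule inj_onI, clarify)
      fix \<phi> x \<psi> y assume *: "\<phi> \<in> Nm m" "\<psi> \<in> Nm m" "\<phi>(Suc m := x) = \<psi>(Suc m := y)"
      have "x = y" using fun_cong[OF *(3), of "Suc m"] by simp
      moreover have "\<phi> = \<psi>"
      proof (rule extensionalityI[where A = "{..m}"])
        show "\<phi> \<in> extensional {..m}" "\<psi> \<in> extensional {..m}" using *(1,2) by (auto simp: Nm_def PiE_def)
        show "\<phi> i = \<psi> i" if "i \<in> {..m}" for i using fun_cong[OF *(3), of i] that by simp
      qed
      ultimately show "\<phi> = \<psi> \<and> x = y" by simp
    qed
    have "z ^ Suc m \<le> z * card (Nm m)" using Suc by simp
    also have "\<dots> \<le> (\<Sum>\<phi>\<in>Nm m. card (Ext \<phi>))"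
      using sum_bounded_below[of "Nm m" z "\<lambda>\<phi>. card (Ext \<phi>)"] Ext by (simp add: mult.commute)
    also have "\<dots> = card (Sigma (Nm m) Ext)"
      using finN finite_subset[OF ExtV V(1)] by (simp add: card_SigmaI)
    also have "\<dots> \<le> card (Nm (Suc m))"
      by (rule card_inj_on_le[OF inj _ finN]) (auto simp: Ext_def)
    finally show ?case .
  qed
  \<comment> \<open>Position 0 is left out because \<open>x0\<close> already fixes it; this is why
    the exponent is \<open>b - a\<close>, not \<open>b - a + 1\<close>.\<close>
  define Rt' where "Rt' = {i. i \<le> b \<and> 0 < i \<and> \<not> unk i}"
  have "{i. i \<le> b \<and> 0 < i} = Rt' \<union> {i. i \<le> b \<and> unk i}" using not_unk_0 by (auto simp: Rt'_def intro!: gr0I)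
  moreover have "Rt' \<inter> {i. i \<le> b \<and> unk i} = {}" by (auto simp: Rt'_def)
  moreover have fRt: "finite Rt'" by (simp add: Rt'_def)
  moreover have "{i. i \<le> b \<and> 0 < i} = {1..b}" by auto
  ultimately have "card {1..b} = card Rt' + a" using card_unk[of b] rank_b
    by (metis card_Un_disjoint finite_Collect_le_nat finite_Collect_conjI)
  then have cRt: "card Rt' = b - a" by simp
  have "\<exists>y\<in>Rt' \<rightarrow>\<^sub>E V. card (Nm b) \<le> card ((\<lambda>\<phi>. restrict \<phi> Rt') -` {y} \<inter> Nm b) * card (Rt' \<rightarrow>\<^sub>E V)"
  proof (rule pigeonhole_card)
    show "(\<lambda>\<phi>. restrict \<phi> Rt') \<in> Nm b \<rightarrow> Rt' \<rightarrow>\<^sub>E V"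
    proof (rule funcsetI)
      fix \<phi> assume "\<phi> \<in> Nm b"
      then have "\<phi> i \<in> V" if "i \<le> b" for i using that by (auto simp: Nm_def PiE_iff)
      then show "restrict \<phi> Rt' \<in> Rt' \<rightarrow>\<^sub>E V" by (simp add: restrict_PiE_iff Rt'_def)
    qed
    show "finite (Rt' \<rightarrow>\<^sub>E V)" using V(1) fRt by (simp add: finite_PiE)
    show "Rt' \<rightarrow>\<^sub>E V \<noteq> {}" using V(2)[OF xy0] by (auto simp: PiE_eq_empty_iff)
  qed (rule finN)
  then obtain y where y: "card (Nm b) \<le> card ((\<lambda>\<phi>. restrict \<phi> Rt') -` {y} \<inter> Nm b) * card V ^ (b - a)"
    using fRt by (auto simp: card_funcsetE cRt)
  define F where "F = (\<lambda>\<phi>. restrict \<phi> Rt') -` {y} \<inter> Nm b"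
  have "p * card V ^ (b - a) \<le> card F * card V ^ (b - a)"
    using order.trans[OF order.trans[OF z count[OF order.refl]] y] unfolding F_def .
  moreover have "card V > 0" using V xy0 by (auto simp: card_gt_0_iff)
  ultimately have "p \<le> card F" by simp
  then obtain \<Phi> where \<Phi>: "\<Phi> \<subseteq> F" "card \<Phi> = p" "finite \<Phi>" by (rule obtain_subset_with_card_n)
  have "same_roots \<phi> \<psi>" if "\<phi> \<in> \<Phi>" "\<psi> \<in> \<Phi>" for \<phi> \<psi>
    unfolding same_roots_def
  proof (intro allI impI)
    fix i assume i: "i \<le> b" "\<not> unk i"
    have eq: "restrict \<phi> Rt' = restrict \<psi> Rt'" "\<phi> 0 = x0" "\<psi> 0 = x0" using that \<Phi>(1) by (auto simp: F_def Nm_def)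
    show "\<phi> i = \<psi> i"
    proof (cases "i = 0")
      case False
      then have "i \<in> Rt'" using i by (simp add: Rt'_def)
      then show ?thesis using fun_cong[OF eq(1), of i] by simp
    qed (use eq in simp)
  qed
  moreover have "\<Phi> \<subseteq> extensional {..b}" using \<Phi>(1) by (auto simp: F_def Nm_def PiE_def)
  moreover have "inj_on \<phi> {..b} \<and> (\<forall>i<b. L (\<phi> (Suc i)) (\<phi> (cur i)) \<or> L (\<phi> (cur i)) (\<phi> (Suc i)))"
    if "\<phi> \<in> \<Phi>" for \<phi>
  proof -
    have "inj_on \<phi> {..b}" "\<forall>i<b. ed \<phi> i" using that \<Phi>(1) by (auto simp: F_def Nm_def)
    then show ?thesis by (auto simp: ed_def split: if_splits)
  qed
  ultimately show ?thesis using \<Phi> by (intro exI[of _ \<Phi>]) blast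
qed
end

section \<open>Good graphs and cliques\<close>

definition cliques :: "nat \<Rightarrow> 'v sgraph \<Rightarrow> 'v set set" where
  "cliques t G = {S. S \<subseteq> verts G \<and> finite S \<and> card S = t \<and> (\<forall>u\<in>S. \<forall>v\<in>S. u \<noteq> v \<longrightarrow> {u, v} \<in> edges G)}"

definition induced :: "'v sgraph \<Rightarrow> 'v set \<Rightarrow> 'v sgraph" where
  "induced G W = \<lparr>verts = W, edges = {e \<in> edges G. e \<subseteq> W}\<rparr>"

lemma finite_cliques: "simple_graph G \<Longrightarrow> finite (cliques t G)"
  by (rule finite_subset[of _ "Pow (verts G)"]) (auto simp: cliques_def simple_graph_def)

text \<open>A complete subgraph is determined by its vertex set, so copies become sets and no
  automorphisms have to be tracked.\<close>

lemma card_copies_complete_graph: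
  fixes G :: "'v sgraph"
  assumes G: "simple_graph G"
  shows "card (copies (complete_graph t) G) = card (cliques t G)"
proof -
  let ?K = "\<lambda>S. \<lparr>verts = S, edges = {e. e \<subseteq> S \<and> card e = 2}\<rparr> :: 'v sgraph"
  have image2: "(\<lambda>e. f ` e) ` {e. e \<subseteq> A \<and> card e = 2} = {e. e \<subseteq> f ` A \<and> card e = 2}"
    if "inj_on f A" for f :: "nat \<Rightarrow> 'v" and A
  proof
    show "(\<lambda>e. f ` e) ` {e. e \<subseteq> A \<and> card e = 2} \<subseteq> {e. e \<subseteq> f ` A \<and> card e = 2}"
      using that by (auto simp: card_image inj_on_subset)
    show "{e. e \<subseteq> f ` A \<and> card e = 2} \<subseteq> (\<lambda>e. f ` e) ` {e. e \<subseteq> A \<and> card e = 2}"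
    proof
      fix e assume "e \<in> {e. e \<subseteq> f ` A \<and> card e = 2}"
      then obtain e' where "e' \<subseteq> A" "e = f ` e'" "card e = 2" by (auto simp: subset_image_iff)
      moreover have "card e' = card e" using that \<open>e' \<subseteq> A\<close> \<open>e = f ` e'\<close> by (simp add: card_image inj_on_subset)
      ultimately show "e \<in> (\<lambda>e. f ` e) ` {e. e \<subseteq> A \<and> card e = 2}" by auto
    qed
  qed
  have "bij_betw ?K (cliques t G) (copies (complete_graph t) G)"
    unfolding bij_betw_def
  proof
    show "inj_on ?K (cliques t G)" by (rule inj_onI) simp
    show "?K ` cliques t G = copies (complete_graph t) G"
    proof (rule subset_antisym)
      show "?K ` cliques t G \<subseteq> copies (complete_graph t) G"
      proof (rule image_subsetI)
        fix S assume S: "S \<in> cliques t G"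
        then obtain f where f: "bij_betw f {..<t} S"
          using ex_bij_betw_nat_finite[of S] by (auto simp: cliques_def atLeast0LessThan)
        have "isomorphic (complete_graph t) (?K S)"
          unfolding isomorphic_def complete_graph_def using f image2[of f "{..<t}"]
          by (intro exI[of _ f]) (simp add: bij_betw_def)
        moreover have "{e. e \<subseteq> S \<and> card e = 2} \<subseteq> edges G"
          using S by (auto simp: cliques_def card_2_iff)
        ultimately show "?K S \<in> copies (complete_graph t) G"
          using S by (auto simp: copies_def is_subgraph_def simple_graph_def cliques_def)
      qed
      show "copies (complete_graph t) G \<subseteq> ?K ` cliques t G"
      proof
        fix H assume "H \<in> copies (complete_graph t) G"
        then obtain f where sub: "is_subgraph H G" and f: "bij_betw f {..<t} (verts H)"
          "edges H = (\<lambda>e. f ` e) ` {e. e \<subseteq> {..<t} \<and> card e = 2}"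
          by (auto simp: copies_def isomorphic_def complete_graph_def)
        have e: "edges H = {e. e \<subseteq> verts H \<and> card e = 2}"
          using image2[of f "{..<t}"] f by (simp add: bij_betw_def)
        have "verts H \<in> cliques t G"
          unfolding cliques_def
        proof (intro CollectI conjI ballI impI)
          show "verts H \<subseteq> verts G" "finite (verts H)" using sub by (auto simp: is_subgraph_def simple_graph_def)
          show "card (verts H) = t" using bij_betw_same_card[OF f(1)] by simp
          fix u v assume "u \<in> verts H" "v \<in> verts H" "u \<noteq> v"
          then have "{u, v} \<in> edges H" unfolding e by simp
          then show "{u, v} \<in> edges G" using sub by (auto simp: is_subgraph_def)
        qed
        moreover have "H = ?K (verts H)" using e by simp
        ultimately show "H \<in> ?K ` cliques t G" by blast
      qed
    qed
  qed
  then show ?thesis using bij_betw_same_card by fastforce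
qed

section \<open>Good colourings and the forbidden family\<close>

context caterpillar
begin

lemma rooted_power_mono:
  assumes "\<And>u w. R u w \<Longrightarrow> R' u w" "rooted_power p R"
  shows "rooted_power p R'"
  using assms(2) by (rule rooted_power_map[where f = id and S = UNIV, rotated 2]) (use assms(1) in auto)

text \<open>The shape of the extremal graph: colours 0 and 1 carry the sparse bipartite graph,
  colours 2 to \<open>k - 1\<close> are unrestricted independent sets, and colours from
  \<open>k\<close> on occur at most once each.\<close>

definition good_colouring :: "nat \<Rightarrow> nat \<Rightarrow> nat \<Rightarrow> 'v sgraph \<Rightarrow> ('v \<Rightarrow> nat) \<Rightarrow> bool" where
  "good_colouring t k p H \<kappa> \<longleftrightarrow> (\<forall>v\<in>verts H. \<kappa> v < t) \<and>
     (\<forall>u\<in>verts H. \<forall>v\<in>verts H. {u, v} \<in> edges H \<longrightarrow> \<kappa> u \<noteq> \<kappa> v) \<and>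
     (\<forall>u\<in>verts H. \<forall>v\<in>verts H. \<kappa> u = \<kappa> v \<and> k \<le> \<kappa> u \<longrightarrow> u = v) \<and>
     \<not> rooted_power p (\<lambda>u v. {u, v} \<in> edges H \<and> \<kappa> u < 2 \<and> \<kappa> v < 2)"

definition good :: "nat \<Rightarrow> nat \<Rightarrow> nat \<Rightarrow> 'v sgraph \<Rightarrow> bool" where
  "good t k p H \<longleftrightarrow> (\<exists>\<kappa>. good_colouring t k p H \<kappa>)"

lemma good_subgraph:
  assumes "is_subgraph H G" "good t k p G"
  shows "good t k p H"
proof -
  obtain \<kappa> where \<kappa>: "good_colouring t k p G \<kappa>" using assms(2) by (auto simp: good_def)
  have sub: "verts H \<subseteq> verts G" "edges H \<subseteq> edges G" using assms(1) by (auto simp: is_subgraph_def)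
  have "\<not> rooted_power p (\<lambda>u v. {u, v} \<in> edges H \<and> \<kappa> u < 2 \<and> \<kappa> v < 2)"
  proof
    assume "rooted_power p (\<lambda>u v. {u, v} \<in> edges H \<and> \<kappa> u < 2 \<and> \<kappa> v < 2)"
    then have "rooted_power p (\<lambda>u v. {u, v} \<in> edges G \<and> \<kappa> u < 2 \<and> \<kappa> v < 2)"
      by (rule rooted_power_mono[rotated]) (use sub in auto)
    then show False using \<kappa> by (simp add: good_colouring_def)
  qed
  then have "good_colouring t k p H \<kappa>" using \<kappa> sub unfolding good_colouring_def by blast
  then show ?thesis by (auto simp: good_def)
qed

lemma good_isomorphic:
  fixes F :: "'v sgraph" and H :: "'w sgraph"
  assumes "isomorphic F H" "simple_graph F" "good t k p H"
  shows "good t k p F"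
proof -
  obtain f where f: "bij_betw f (verts F) (verts H)" "edges H = (\<lambda>e. f ` e) ` edges F"
    using assms(1) by (auto simp: isomorphic_def)
  obtain \<kappa> where \<kappa>: "good_colouring t k p H \<kappa>" using assms(3) by (auto simp: good_def)
  have fV: "f v \<in> verts H" if "v \<in> verts F" for v using f(1) that by (auto simp: bij_betw_def)
  have fE: "{f u, f v} \<in> edges H" if "{u, v} \<in> edges F" for u v using imageI[OF that, of "\<lambda>e. f ` e"] unfolding f(2) by simp
  have injf: "inj_on f (verts F)" using f(1) by (simp add: bij_betw_def)
  have "\<not> rooted_power p (\<lambda>u v. {u, v} \<in> edges F \<and> (\<kappa> \<circ> f) u < 2 \<and> (\<kappa> \<circ> f) v < 2)"
  proof
    assume "rooted_power p (\<lambda>u v. {u, v} \<in> edges F \<and> (\<kappa> \<circ> f) u < 2 \<and> (\<kappa> \<circ> f) v < 2)"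
    then have "rooted_power p (\<lambda>u v. {u, v} \<in> edges H \<and> \<kappa> u < 2 \<and> \<kappa> v < 2)"
    proof (rule rooted_power_map[rotated 2, OF _ _ injf])
      fix u v assume uv: "{u, v} \<in> edges F \<and> (\<kappa> \<circ> f) u < 2 \<and> (\<kappa> \<circ> f) v < 2"
      then have "{u, v} \<subseteq> verts F" using assms(2) unfolding simple_graph_def by blast
      then show "u \<in> verts F \<and> v \<in> verts F \<and> {f u, f v} \<in> edges H \<and> \<kappa> (f u) < 2 \<and> \<kappa> (f v) < 2"
        using uv fE by auto
    qed
    then show False using \<kappa> by (simp add: good_colouring_def)
  qed
  moreover have "\<forall>u\<in>verts F. \<forall>v\<in>verts F. (\<kappa> \<circ> f) u = (\<kappa> \<circ> f) v \<and> k \<le> (\<kappa> \<circ> f) u \<longrightarrow> u = v"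
    using \<kappa> fV inj_onD[OF injf] unfolding good_colouring_def by (simp add: comp_def)
  ultimately have "good_colouring t k p F (\<kappa> \<circ> f)"
    using \<kappa> fV fE unfolding good_colouring_def by simp
  then show ?thesis by (auto simp: good_def)
qed

text \<open>Cutting off at \<open>M\<close> vertices makes the family finite; \<open>M\<close> will
  be the largest size of a vertex set tested in the upper bound.\<close>

definition forbidden :: "nat \<Rightarrow> nat \<Rightarrow> nat \<Rightarrow> nat \<Rightarrow> nat sgraph set" where
  "forbidden t k p M = {F. simple_graph F \<and> verts F \<subseteq> {..<M} \<and> \<not> good t k p F}"

lemma finite_forbidden: "finite (forbidden t k p M)"
proof (rule finite_imageD)
  show "inj_on (\<lambda>F. (verts F, edges F)) (forbidden t k p M)" by (rule inj_onI) simp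
  have "(\<lambda>F. (verts F, edges F)) ` forbidden t k p M \<subseteq> Pow {..<M} \<times> Pow (Pow {..<M})"
    by (force simp: forbidden_def simple_graph_def)
  then show "finite ((\<lambda>F. (verts F, edges F)) ` forbidden t k p M)" by (rule finite_subset) simp
qed

lemma free_of_forbidden:
  fixes G :: "'v sgraph"
  assumes "good t k p G"
  shows "free_of (forbidden t k p M) G"
  unfolding free_of_def
proof (intro ballI equals0I)
  fix F H assume F: "F \<in> forbidden t k p M" and H: "H \<in> copies F G"
  then have "good t k p H" using good_subgraph[OF _ assms] by (simp add: copies_def)
  then show False using F H good_isomorphic[of F H t k p] by (simp add: forbidden_def copies_def)
qed

text \<open>If it failed, relabelling \<open>W\<close> by an initial segment would give a member of
  the family with a copy in \<open>G\<close>.\<close>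

lemma good_induced:
  fixes G :: "'v sgraph"
  assumes G: "simple_graph G" "free_of (forbidden t k p M) G" and W: "W \<subseteq> verts G" "card W \<le> M"
  shows "good t k p (induced G W)"
proof (rule ccontr)
  assume neg: "\<not> good t k p (induced G W)"
  have finW: "finite W" using G(1) W(1) finite_subset by (auto simp: simple_graph_def)
  have simple: "simple_graph (induced G W)" using G(1) finW by (auto simp: simple_graph_def induced_def)
  obtain f where f: "bij_betw f W {0..<card W}" using ex_bij_betw_finite_nat[OF finW] by blast
  then have injf: "inj_on f W" by (simp add: bij_betw_def)
  define F where "F = \<lparr>verts = f ` W, edges = (\<lambda>e. f ` e) ` edges (induced G W)\<rparr>"
  have eW: "e \<subseteq> W" if "e \<in> edges (induced G W)" for e using that by (simp add: induced_def)
  have F: "simple_graph F" "verts F \<subseteq> {..<M}"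
  proof -
    have "card (f ` e) = 2" if "e \<in> edges (induced G W)" for e
      using that simple eW[OF that] injf by (simp add: card_image inj_on_subset simple_graph_def)
    then show "simple_graph F" using finW eW by (auto simp: F_def simple_graph_def)
    show "verts F \<subseteq> {..<M}" using f W(2) by (auto simp: F_def bij_betw_def)
  qed
  have iso1: "isomorphic (induced G W) F"
    unfolding isomorphic_def by (rule exI[of _ f]) (use injf in \<open>simp add: F_def bij_betw_def induced_def\<close>)
  have iso2: "isomorphic F (induced G W)"
    unfolding isomorphic_def
  proof (intro exI conjI)
    show "bij_betw (inv_into W f) (verts F) (verts (induced G W))"
      using bij_betw_inv_into[of f W "f ` W"] injf by (simp add: F_def bij_betw_def induced_def)
    have "inv_into W f ` f ` e = e" if "e \<in> edges (induced G W)" for e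
      using inv_into_image_cancel[OF injf eW[OF that]] .
    then show "edges (induced G W) = (\<lambda>e. inv_into W f ` e) ` edges F"
      by (simp add: F_def image_image cong: image_cong_simp)
  qed
  have "\<not> good t k p F" using neg good_isomorphic[OF iso1 simple] by blast
  then have "F \<in> forbidden t k p M" using F by (simp add: forbidden_def)
  moreover have "induced G W \<in> copies F G"
    using iso2 simple W(1) by (auto simp: copies_def is_subgraph_def induced_def)
  ultimately show False using G(2) by (auto simp: free_of_def)
qed

lemma clique_colouring:
  assumes \<kappa>: "good_colouring t k p H \<kappa>" and A: "A \<in> cliques t H"
  shows "inj_on \<kappa> A" "\<kappa> ` A = {..<t}"
proof -
  show inj: "inj_on \<kappa> A"
    using \<kappa> A unfolding inj_on_def good_colouring_def cliques_def by blast
  have "\<kappa> ` A \<subseteq> {..<t}" using \<kappa> A unfolding good_colouring_def cliques_def by auto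
  moreover have "card (\<kappa> ` A) = card {..<t}" using card_image[OF inj] A by (simp add: cliques_def)
  ultimately show "\<kappa> ` A = {..<t}" by (simp add: card_subset_eq)
qed

text \<open>A \<open>t\<close>-clique uses all \<open>t\<close> colours, so it contains the only
  vertex of each colour from \<open>k\<close> on.\<close>

lemma cliques_meet:
  assumes "good t k p H" and A: "A \<in> cliques t H" and B: "B \<in> cliques t H"
  shows "t - k \<le> card (A \<inter> B)"
proof -
  obtain \<kappa> where \<kappa>: "good_colouring t k p H \<kappa>" using assms(1) by (auto simp: good_def)
  have "{k..<t} \<subseteq> \<kappa> ` (A \<inter> B)"
  proof
    fix c assume c: "c \<in> {k..<t}"
    then obtain u v where "u \<in> A" "v \<in> B" "\<kappa> u = c" "\<kappa> v = c"
      using clique_colouring(2)[OF \<kappa> A] clique_colouring(2)[OF \<kappa> B] by (metis atLeastLessThan_iff imageE lessThan_iff)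
    moreover from this have "u \<in> verts H" "v \<in> verts H" using A B by (auto simp: cliques_def)
    moreover have "\<forall>u\<in>verts H. \<forall>v\<in>verts H. \<kappa> u = \<kappa> v \<and> k \<le> \<kappa> u \<longrightarrow> u = v"
      using \<kappa> unfolding good_colouring_def by (elim conjE)
    ultimately have "u = v" "u \<in> A" "v \<in> B" "\<kappa> u = c" using c by auto
    then show "c \<in> \<kappa> ` (A \<inter> B)" by auto
  qed
  then have "card {k..<t} \<le> card (A \<inter> B)" using A by (intro surj_card_le) (auto simp: cliques_def)
  then show ?thesis by simp
qed

lemma clique_induced: "A \<in> cliques t G \<Longrightarrow> A \<subseteq> W \<Longrightarrow> A \<in> cliques t (induced G W)"
  unfolding cliques_def induced_def by auto
end

section \<open>The upper bound\<close>

context caterpillar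
begin

text \<open>Pigeonhole over the at most \<open>2 ^ card A\<close> subsets of one fixed member
  \<open>A\<close>.\<close>

lemma exists_common_subset:
  assumes fin: "finite C" and A: "A \<in> C" "finite A"
    and meet: "\<And>B. B \<in> C \<Longrightarrow> m \<le> card (A \<inter> B)"
  shows "\<exists>Q\<subseteq>A. card Q = m \<and> card C \<le> 2 ^ card A * card {B \<in> C. Q \<subseteq> B}"
proof -
  have "\<forall>B\<in>C. \<exists>Q. Q \<subseteq> A \<inter> B \<and> card Q = m"
    using obtain_subset_with_card_n[OF meet] by metis
  then obtain g where g: "\<And>B. B \<in> C \<Longrightarrow> g B \<subseteq> A \<inter> B \<and> card (g B) = m" by metis
  have "\<exists>Q\<in>g ` C. card C \<le> card (g -` {Q} \<inter> C) * card (g ` C)"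
    by (rule pigeonhole_card) (use fin A(1) in auto)
  then obtain B where B: "B \<in> C" "card C \<le> card (g -` {g B} \<inter> C) * card (g ` C)" by auto
  have "card (g ` C) \<le> card (Pow A)" using g A(2) by (intro card_mono) auto
  moreover have "card (g -` {g B} \<inter> C) \<le> card {B' \<in> C. g B \<subseteq> B'}"
  proof (intro card_mono subsetI)
    fix B' assume "B' \<in> g -` {g B} \<inter> C"
    then have "B' \<in> C" "g B = g B'" by auto
    then show "B' \<in> {B' \<in> C. g B \<subseteq> B'}" using g[of B'] by simp
  qed (use fin in simp)
  ultimately have "card (g -` {g B} \<inter> C) * card (g ` C) \<le> card {B' \<in> C. g B \<subseteq> B'} * 2 ^ card A"
    using A(2) by (intro mult_le_mono) (simp_all add: card_Pow)
  then have "card C \<le> 2 ^ card A * card {B' \<in> C. g B \<subseteq> B'}" using B(2) by (simp add: mult.commute)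
  then show ?thesis using g[OF B(1)] by (intro exI[of _ "g B"]) auto
qed

text \<open>The size bound for \<open>W\<close> covers two cliques (\<open>2 * t\<close>) and also a
  clique with \<open>k\<close> spare vertices and, for each ordered pair of coordinates,
  \<open>p\<close> trees on \<open>b + 1\<close> vertices.\<close>

lemma card_cliques_le:
  fixes G :: "'v sgraph"
  assumes G: "simple_graph G" and kt: "2 \<le> k" "k \<le> t"
    and good: "\<And>W. W \<subseteq> verts G \<Longrightarrow> card W \<le> 2 * t + k + k * k * (p * (b + 1)) \<Longrightarrow> good t k p (induced G W)"
    and z: "p * card (verts G) ^ (b - a) \<le> z ^ b"
  shows "card (cliques t G) \<le> 2 ^ t * (k * card (verts G) ^ (k - 1) * (z + b))"
proof (rule ccontr)
  assume neg: "\<not> ?thesis"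
  let ?V = "verts G" and ?C = "cliques t G"
  have finV: "finite ?V" using G by (simp add: simple_graph_def)
  obtain A where A: "A \<in> ?C" using neg by (cases "?C = {}") auto
  have cA: "card A = t" "finite A" "A \<subseteq> ?V" using A by (auto simp: cliques_def)
  have "t - k \<le> card (A \<inter> B)" if B: "B \<in> ?C" for B
  proof -
    have cB: "card B = t" "finite B" "B \<subseteq> ?V" using B by (auto simp: cliques_def)
    have "good t k p (induced G (A \<union> B))"
      by (rule good) (use cA cB card_Un_le[of A B] in auto)
    then show ?thesis
      using cliques_meet clique_induced[OF A, of "A \<union> B"] clique_induced[OF B, of "A \<union> B"] by blast
  qed
  from exists_common_subset[OF finite_cliques[OF G] A cA(2) this]
  obtain Q where Q: "Q \<subseteq> A" "card Q = t - k" "card ?C \<le> 2 ^ t * card {B \<in> ?C. Q \<subseteq> B}"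
    unfolding cA(1) by blast
  have finQ: "finite Q" using Q(1) cA(2) finite_subset by blast
  have "2 ^ t * (k * card ?V ^ (k - 1) * (z + b)) < 2 ^ t * card {B \<in> ?C. Q \<subseteq> B}" using neg Q(3) by linarith
  then have many: "k * card ?V ^ (k - 1) * (z + b) < card {B \<in> ?C. Q \<subseteq> B}" by simp
  \<comment> \<open>Ordered tuples, so that one coordinate at a time can be varied. Each clique
    through \<open>Q\<close> has at least one ordering, hence \<open>S\<close> is no smaller than
    the set of these cliques.\<close>
  define S where "S = {s \<in> {..<k} \<rightarrow>\<^sub>E ?V. inj_on s {..<k} \<and> s ` {..<k} \<inter> Q = {} \<and> s ` {..<k} \<union> Q \<in> ?C}"
  have SV: "S \<subseteq> {..<k} \<rightarrow>\<^sub>E ?V" by (auto simp: S_def)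
  have finS: "finite S" by (rule finite_subset[OF SV]) (use finV in \<open>simp add: finite_PiE\<close>)
  have "{B \<in> ?C. Q \<subseteq> B} \<subseteq> (\<lambda>s. s ` {..<k} \<union> Q) ` S"
  proof
    fix B assume B: "B \<in> {B \<in> ?C. Q \<subseteq> B}"
    then have cB: "card B = t" "finite B" "B \<subseteq> ?V" "Q \<subseteq> B" by (auto simp: cliques_def)
    have "card (B - Q) = k" using cB Q(2) finQ kt by (simp add: card_Diff_subset)
    then obtain f where "bij_betw f {0..<k} (B - Q)" using ex_bij_betw_nat_finite[of "B - Q"] cB(2) by auto
    then have f: "inj_on f {..<k}" "f ` {..<k} = B - Q" by (auto simp: bij_betw_def atLeast0LessThan)
    define s where "s = restrict f {..<k}"
    have im: "s ` {..<k} = B - Q" using f(2) by (simp add: s_def)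
    have fB: "f i \<in> ?V" if "i < k" for i
    proof -
      have "f i \<in> f ` {..<k}" using that by simp
      then show ?thesis using f(2) cB(3) by auto
    qed
    then have "s \<in> S" unfolding S_def using f B im cB by (auto simp: s_def restrict_PiE_iff inj_on_def Un_absorb2 Un_Diff_cancel2)
    moreover have "s ` {..<k} \<union> Q = B" using im cB(4) by auto
    ultimately show "B \<in> (\<lambda>s. s ` {..<k} \<union> Q) ` S" by blast
  qed
  then have "card {B \<in> ?C. Q \<subseteq> B} \<le> card S" by (rule surj_card_le[OF finS])
  then have "k * card ?V ^ (k - 1) * (z + b) < card S" using many by simp
  from exists_subset_line_dense[OF finV SV this] obtain S' where
    S': "S' \<subseteq> S" "S' \<noteq> {}" "\<And>s i. s \<in> S' \<Longrightarrow> i < k \<Longrightarrow> z + b < card {x. s(i := x) \<in> S'}"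
    by blast
  then obtain s0 where s0: "s0 \<in> S'" by blast
  define K where "K = s0 ` {..<k} \<union> Q"
  have clq: "s ` {..<k} \<union> Q \<in> ?C" "inj_on s {..<k}" "s ` {..<k} \<inter> Q = {}" "\<And>i. i < k \<Longrightarrow> s i \<in> ?V" if "s \<in> S'" for s
    using that S'(1) by (auto simp: S_def)
  have K: "K \<in> ?C" unfolding K_def by (rule clq[OF s0])
  have adj: "{s c, u} \<in> edges G" if "s \<in> S'" "c < k" "u \<in> Q \<or> (\<exists>c'<k. c' \<noteq> c \<and> u = s c')" for s c u
  proof -
    have "s c \<in> s ` {..<k} \<union> Q" "u \<in> s ` {..<k} \<union> Q" using that by auto
    moreover have "s c \<noteq> u" using that clq(2,3)[OF that(1)] by (auto simp: inj_on_def)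
    ultimately show ?thesis using clq(1)[OF that(1)] unfolding cliques_def by blast
  qed
  \<comment> \<open>The link of the clique with coordinates \<open>i\<close> and \<open>j\<close>
    released. Its degrees in both directions are large by the choice of \<open>S'\<close>.\<close>
  define L where "L = (\<lambda>i j x y. s0(i := x, j := y) \<in> S')"
  define Pr where "Pr = (\<lambda>i j \<Phi>. finite \<Phi> \<and> card \<Phi> = p \<and> \<Phi> \<subseteq> extensional {..b} \<and>
    (\<forall>\<phi>\<in>\<Phi>. inj_on \<phi> {..b} \<and> (\<forall>m<b. L i j (\<phi> (Suc m)) (\<phi> (cur m)) \<or> L i j (\<phi> (cur m)) (\<phi> (Suc m)))) \<and>
    (\<forall>\<phi>\<in>\<Phi>. \<forall>\<psi>\<in>\<Phi>. same_roots \<phi> \<psi>))"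
  have "\<exists>\<Phi>. Pr i j \<Phi>" if ij: "i < k" "j < k" "i \<noteq> j" for i j
    unfolding Pr_def
  proof (rule exists_rooted_copies[OF finV _ _ _ _ z])
    fix x y assume xy: "L i j x y"
    have "(s0(i := x, j := y)) i \<in> ?V" "(s0(i := x, j := y)) j \<in> ?V"
      using clq(4)[OF xy[unfolded L_def]] ij by blast+
    then show "x \<in> ?V \<and> y \<in> ?V" using ij by simp
    have "(s0(i := x, j := y))(j := y') = s0(i := x, j := y')" for y' by simp
    then show "z + b < card {y'. L i j x y'}"
      using S'(3)[OF xy[unfolded L_def] ij(2)] by (simp add: L_def)
    have "(s0(i := x, j := y))(i := x') = s0(i := x', j := y)" for x' using ij(3) by (simp add: fun_upd_twist)
    then show "z + b < card {x'. L i j x' y}"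
      using S'(3)[OF xy[unfolded L_def] ij(1)] by (simp add: L_def)
  next
    show "L i j (s0 i) (s0 j)" using s0 by (simp add: L_def)
  qed
  \<comment> \<open>Which coordinates receive the colours 0 and 1 is known only after
    \<open>W\<close> is fixed and coloured, so trees are prepared for every pair.\<close>
  then have "\<forall>ij. \<exists>\<Phi>. fst ij < k \<and> snd ij < k \<and> fst ij \<noteq> snd ij \<longrightarrow> Pr (fst ij) (snd ij) \<Phi>" by blast
  from choice[OF this] obtain \<Phi> where
    \<Phi>0: "\<forall>ij. fst ij < k \<and> snd ij < k \<and> fst ij \<noteq> snd ij \<longrightarrow> Pr (fst ij) (snd ij) (\<Phi> ij)" by (elim exE)
  have \<Phi>: "finite (\<Phi> (i, j))" "card (\<Phi> (i, j)) = p" "\<Phi> (i, j) \<subseteq> extensional {..b}"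
    "\<And>\<phi>. \<phi> \<in> \<Phi> (i, j) \<Longrightarrow> inj_on \<phi> {..b}"
    "\<And>\<phi> m. \<phi> \<in> \<Phi> (i, j) \<Longrightarrow> m < b \<Longrightarrow> L i j (\<phi> (Suc m)) (\<phi> (cur m)) \<or> L i j (\<phi> (cur m)) (\<phi> (Suc m))"
    "\<And>\<phi> \<psi>. \<phi> \<in> \<Phi> (i, j) \<Longrightarrow> \<psi> \<in> \<Phi> (i, j) \<Longrightarrow> same_roots \<phi> \<psi>" if "i < k" "j < k" "i \<noteq> j" for i j
    using \<Phi>0[THEN spec[of _ "(i, j)"]] that by (simp_all add: Pr_def)
  have vertex: "\<exists>x y. L i j x y \<and> (\<phi> m = x \<or> \<phi> m = y)" if "i < k" "j < k" "i \<noteq> j" "\<phi> \<in> \<Phi> (i, j)" "m \<le> b" for i j \<phi> m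
  proof (cases m)
    case 0
    then show ?thesis using \<Phi>(5)[OF that(1-4) b_pos] by auto
  next
    case (Suc m')
    then show ?thesis using \<Phi>(5)[OF that(1-4), of m'] that(5) by auto
  qed
  \<comment> \<open>A second vertex for coordinate \<open>i\<close>, adjacent to the rest of the
    clique; it will show that the colour of \<open>s0 i\<close> is not reserved for a single
    vertex.\<close>
  have "\<exists>x. x \<noteq> s0 i \<and> s0(i := x) \<in> S'" if "i < k" for i
  proof (rule ccontr)
    assume "\<not> ?thesis"
    then have "{x. s0(i := x) \<in> S'} \<subseteq> {s0 i}" by auto
    then have "card {x. s0(i := x) \<in> S'} \<le> 1" using card_mono[of "{s0 i}"] by fastforce
    then show False using S'(3)[OF s0 that] b_pos by simp
  qed
  then have "\<forall>i. \<exists>x. i < k \<longrightarrow> x \<noteq> s0 i \<and> s0(i := x) \<in> S'" by blast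
  from choice[OF this] obtain y where y: "\<And>i. i < k \<Longrightarrow> y i \<noteq> s0 i \<and> s0(i := y i) \<in> S'" by blast
  define Ps where "Ps = {ij \<in> {..<k} \<times> {..<k}. fst ij \<noteq> snd ij}"
  define Z where "Z = (\<Union>ij\<in>Ps. \<Union>\<phi>\<in>\<Phi> ij. \<phi> ` {..b})"
  define W where "W = K \<union> y ` {..<k} \<union> Z"
  have cardZ: "card Z \<le> k * k * (p * (b + 1))"
  proof -
    have finPs: "finite Ps" by (simp add: Ps_def)
    have "card (\<Union>\<phi>\<in>\<Phi> ij. \<phi> ` {..b}) \<le> p * (b + 1)" if "ij \<in> Ps" for ij
    proof -
      have ij: "finite (\<Phi> ij)" "card (\<Phi> ij) = p" using \<Phi>(1,2)[of "fst ij" "snd ij"] that by (auto simp: Ps_def)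
      have "card (\<Union>\<phi>\<in>\<Phi> ij. \<phi> ` {..b}) \<le> (\<Sum>\<phi>\<in>\<Phi> ij. card (\<phi> ` {..b}))" by (rule card_UN_le[OF ij(1)])
      also have "\<dots> \<le> (\<Sum>\<phi>\<in>\<Phi> ij. b + 1)" by (intro sum_mono order.trans[OF card_image_le]) auto
      finally show ?thesis using ij(2) by simp
    qed
    note step = this
    have "card Z \<le> (\<Sum>ij\<in>Ps. card (\<Union>\<phi>\<in>\<Phi> ij. \<phi> ` {..b}))" unfolding Z_def by (rule card_UN_le[OF finPs])
    also have "\<dots> \<le> (\<Sum>ij\<in>Ps. p * (b + 1))" by (intro sum_mono step)
    also have "\<dots> = card Ps * (p * (b + 1))" by simp
    also have "card Ps \<le> card ({..<k} \<times> {..<k})" unfolding Ps_def by (rule card_mono) auto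
    finally show ?thesis by (simp add: card_cartesian_product)
  qed
  have cK: "card K = t" "finite K" "K \<subseteq> ?V" using K by (auto simp: cliques_def)
  have "card W \<le> card K + card (y ` {..<k}) + card Z"
    unfolding W_def by (intro order.trans[OF card_Un_le] add_mono card_Un_le order.refl)
  also have "\<dots> \<le> 2 * t + k + k * k * (p * (b + 1))"
    using cardZ cK(1) card_image_le[of "{..<k}" y] by simp
  finally have cW: "card W \<le> 2 * t + k + k * k * (p * (b + 1))" .
  have yV: "y i \<in> ?V" if "i < k" for i using clq(4)[OF y[OF that, THEN conjunct2] that] by simp
  have LV: "x \<in> ?V \<and> y \<in> ?V" if "L i j x y" "i < k" "j < k" "i \<noteq> j" for i j x y
    using clq(4)[OF that(1)[unfolded L_def] that(2)] clq(4)[OF that(1)[unfolded L_def] that(3)] that(4) by simp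
  have WV: "W \<subseteq> ?V"
  proof
    fix v assume "v \<in> W"
    then consider "v \<in> K" | i where "i < k" "v = y i" | "v \<in> Z" unfolding W_def by auto
    then show "v \<in> ?V"
    proof cases
      case 3
      then obtain i j \<phi> m where *: "i < k" "j < k" "i \<noteq> j" "\<phi> \<in> \<Phi> (i, j)" "m \<le> b" "v = \<phi> m"
        unfolding Z_def Ps_def by auto
      then show ?thesis using vertex[OF *(1-5)] LV[OF _ *(1-3)] by auto
    qed (use cK yV in auto)
  qed
  obtain \<kappa> where \<kappa>: "good_colouring t k p (induced G W) \<kappa>" using good[OF WV cW] by (auto simp: good_def)
  have proper: "\<kappa> u \<noteq> \<kappa> v" if "u \<in> W" "v \<in> W" "{u, v} \<in> edges G" for u v
    using \<kappa> that unfolding good_colouring_def induced_def by simp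
  have less_t: "\<kappa> u < t" if "u \<in> W" for u using \<kappa> that unfolding good_colouring_def induced_def by simp
  have single: "u = v" if "u \<in> W" "v \<in> W" "\<kappa> u = \<kappa> v" "k \<le> \<kappa> u" for u v
    using \<kappa> that unfolding good_colouring_def induced_def by simp
  have "K \<in> cliques t (induced G W)" by (rule clique_induced[OF K]) (auto simp: W_def)
  note \<kappa>K = clique_colouring[OF \<kappa> this]
  have KW: "K \<subseteq> W" by (auto simp: W_def)
  have s0K: "s0 i \<in> K" if "i < k" for i using that by (simp add: K_def)
  \<comment> \<open>The colour of \<open>y i\<close> occurs in the clique, and by adjacency only at
    \<open>s0 i\<close>. So two different vertices share this colour, which is impossible from
    \<open>k\<close> on.\<close>
  have below: "\<kappa> (s0 i) < k" if i: "i < k" for i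
  proof (rule ccontr)
    assume big: "\<not> \<kappa> (s0 i) < k"
    have yW: "y i \<in> W" using i by (simp add: W_def)
    have "\<kappa> (y i) \<in> \<kappa> ` K" unfolding \<kappa>K(2) using less_t[OF yW] by simp
    then obtain u where u: "u \<in> K" "\<kappa> (y i) = \<kappa> u" by auto
    have "u = s0 i"
    proof (rule ccontr)
      assume "u \<noteq> s0 i"
      then have "u \<in> Q \<or> (\<exists>c'<k. c' \<noteq> i \<and> u = (s0(i := y i)) c')" using u(1) unfolding K_def by auto
      from adj[OF y[OF i, THEN conjunct2] i this] have "{y i, u} \<in> edges G" by simp
      then show False using proper[OF yW] u KW by auto
    qed
    then have "y i = s0 i" using single[OF yW _ u(2)] u KW big by auto
    then show False using y[OF i] by simp
  qed
  have "inj_on (\<lambda>i. \<kappa> (s0 i)) {..<k}"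
    using comp_inj_on[OF clq(2)[OF s0], of \<kappa>] inj_on_subset[OF \<kappa>K(1), of "s0 ` {..<k}"]
    by (simp add: K_def comp_def)
  moreover have "(\<lambda>i. \<kappa> (s0 i)) ` {..<k} \<subseteq> {..<k}" using below by auto
  ultimately have surj: "(\<lambda>i. \<kappa> (s0 i)) ` {..<k} = {..<k}" by (simp add: endo_inj_surj)
  have "0 \<in> (\<lambda>i. \<kappa> (s0 i)) ` {..<k}" "1 \<in> (\<lambda>i. \<kappa> (s0 i)) ` {..<k}" unfolding surj using kt by auto
  then obtain i j where ij: "i < k" "j < k" "\<kappa> (s0 i) = 0" "\<kappa> (s0 j) = 1" by fastforce
  then have ne: "i \<noteq> j" by auto
  have ZW: "\<phi> m \<in> W" if "\<phi> \<in> \<Phi> (i, j)" "m \<le> b" for \<phi> m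
  proof -
    have "(i, j) \<in> Ps" using ij ne by (simp add: Ps_def)
    then have "\<phi> m \<in> Z" using that unfolding Z_def by blast
    then show ?thesis by (simp add: W_def)
  qed
  \<comment> \<open>A vertex of a tree is adjacent to every vertex of the clique except possibly
    \<open>s0 i\<close> and \<open>s0 j\<close>, so only their colours 0 and 1 are left for
    it.\<close>
  have low: "\<kappa> (\<phi> m) < 2" if \<phi>: "\<phi> \<in> \<Phi> (i, j)" "m \<le> b" for \<phi> m
  proof (rule ccontr)
    assume big: "\<not> \<kappa> (\<phi> m) < 2"
    have "\<kappa> (\<phi> m) \<in> \<kappa> ` K" unfolding \<kappa>K(2) using less_t[OF ZW[OF \<phi>]] by simp
    then obtain u where u: "u \<in> K" "\<kappa> (\<phi> m) = \<kappa> u" by auto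
    then have "u \<noteq> s0 i" "u \<noteq> s0 j" using big ij by auto
    then have uQ: "u \<in> Q \<or> (\<exists>c'<k. c' \<noteq> i \<and> c' \<noteq> j \<and> u = s0 c')" using u(1) unfolding K_def by auto
    obtain x y where xy: "L i j x y" "\<phi> m = x \<or> \<phi> m = y" using vertex[OF ij(1,2) ne \<phi>] by blast
    let ?s = "s0(i := x, j := y)"
    have "u \<in> Q \<or> (\<exists>c'<k. c' \<noteq> i \<and> u = ?s c')" "u \<in> Q \<or> (\<exists>c'<k. c' \<noteq> j \<and> u = ?s c')"
      using uQ by auto
    then have "{?s i, u} \<in> edges G" "{?s j, u} \<in> edges G"
      using adj[OF xy(1)[unfolded L_def]] ij by blast+
    then have "{\<phi> m, u} \<in> edges G" using xy(2) ne by auto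
    then show False using proper[OF ZW[OF \<phi>]] u KW by auto
  qed
  have LE: "{x, y} \<in> edges G" if "L i j x y" for x y
  proof -
    have "\<exists>c'<k. c' \<noteq> i \<and> y = (s0(i := x, j := y)) c'" using ij(2) ne by (intro exI[of _ j]) auto
    then have "{(s0(i := x, j := y)) i, y} \<in> edges G"
      by (intro adj[OF that[unfolded L_def] ij(1)] disjI2)
    then show ?thesis using ne by simp
  qed
  have "rooted_power p (\<lambda>u v. {u, v} \<in> edges (induced G W) \<and> \<kappa> u < 2 \<and> \<kappa> v < 2)"
    unfolding rooted_power_def
  proof (intro exI[of _ "\<Phi> (i, j)"] conjI ballI)
    show "finite (\<Phi> (i, j))" "card (\<Phi> (i, j)) = p" "\<Phi> (i, j) \<subseteq> extensional {..b}"
      using \<Phi>(1-3)[OF ij(1,2) ne] .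
    show "same_roots \<phi> \<psi>" if "\<phi> \<in> \<Phi> (i, j)" "\<psi> \<in> \<Phi> (i, j)" for \<phi> \<psi>
      using \<Phi>(6)[OF ij(1,2) ne that] .
    fix \<phi> assume \<phi>: "\<phi> \<in> \<Phi> (i, j)"
    show "embedding (\<lambda>u v. {u, v} \<in> edges (induced G W) \<and> \<kappa> u < 2 \<and> \<kappa> v < 2) \<phi>"
      unfolding embedding_def
    proof (intro conjI allI impI)
      show "inj_on \<phi> {..b}" using \<Phi>(4)[OF ij(1,2) ne \<phi>] .
      fix m assume m: "m < b"
      then have cm: "cur m \<le> b" using cur_le[of m] by simp
      show "\<kappa> (\<phi> (Suc m)) < 2" "\<kappa> (\<phi> (cur m)) < 2" using low[OF \<phi>] m cm by auto
      have "{\<phi> (Suc m), \<phi> (cur m)} \<in> edges G"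
        using \<Phi>(5)[OF ij(1,2) ne \<phi> m] LE by (metis insert_commute)
      then show "{\<phi> (Suc m), \<phi> (cur m)} \<in> edges (induced G W)"
        using ZW[OF \<phi>] m cm by (simp add: induced_def)
    qed
  qed
  then show False using \<kappa> by (simp add: good_colouring_def)
qed
end

section \<open>The lower bound\<close>

context caterpillar
begin

text \<open>First \<open>k\<close> blocks of length \<open>N\<close>, then \<open>t - k\<close>
  single vertices. The remaining vertices get the default 0 and will be isolated.\<close>

definition lower_colour :: "nat \<Rightarrow> nat \<Rightarrow> nat \<Rightarrow> nat \<Rightarrow> nat" where
  "lower_colour N k t v = (if v < k * N then v div N else if v < k * N + (t - k) then k + (v - k * N) else 0)"

text \<open>All pairs of different colours are joined, except that an edge whose larger colour is 1,
  hence one between blocks 0 and 1, must come from \<open>E\<close>.\<close>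

definition lower_graph :: "nat \<Rightarrow> nat \<Rightarrow> nat \<Rightarrow> (nat \<times> nat) set \<Rightarrow> nat \<Rightarrow> nat sgraph" where
  "lower_graph N k t E n = \<lparr>verts = {..<n}, edges = {{u, v} |u v.
     u < k * N + (t - k) \<and> v < k * N + (t - k) \<and> lower_colour N k t u < lower_colour N k t v \<and>
     (lower_colour N k t v = 1 \<longrightarrow> (u, v - N) \<in> E)}\<rparr>"

lemma lower_colour_less: "2 \<le> k \<Longrightarrow> k \<le> t \<Longrightarrow> lower_colour N k t v < t"
  using less_mult_imp_div_less[of v k N] by (cases "v < k * N") (auto simp: lower_colour_def)

lemma lower_graph_simple: "k * N + (t - k) \<le> n \<Longrightarrow> simple_graph (lower_graph N k t E n)"
  unfolding simple_graph_def lower_graph_def by (auto simp: card_2_iff)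

lemma lower_colour_low:
  assumes "2 \<le> k" "v < k * N + (t - k)" "lower_colour N k t v < 2"
  shows "v < 2 * N" "lower_colour N k t v = v div N"
proof -
  show *: "lower_colour N k t v = v div N" using assms by (auto simp: lower_colour_def split: if_splits)
  then have "v div N < 2" "v < k * N" using assms by (auto simp: lower_colour_def split: if_splits)
  then show "v < 2 * N" by (cases "N = 0") (auto simp: div_less_iff_less_mult)
qed

lemma good_lower_graph:
  assumes kt: "2 \<le> k" "k \<le> t" and E: "E \<subseteq> {..<N} \<times> {..<N}" and pow: "\<not> rooted_power p (bip E)"
  shows "good t k p (lower_graph N k t E n)"
proof -
  let ?G = "lower_graph N k t E n" and ?T = "k * N + (t - k)" and ?c = "lower_colour N k t"
  have edge: "\<exists>u' v'. {u, v} = {u', v'} \<and> u' < ?T \<and> v' < ?T \<and> ?c u' < ?c v' \<and> (?c v' = 1 \<longrightarrow> (u', v' - N) \<in> E)"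
    if "{u, v} \<in> edges ?G" for u v
    using that by (simp add: lower_graph_def)
  have "\<not> rooted_power p (\<lambda>u v. {u, v} \<in> edges ?G \<and> ?c u < 2 \<and> ?c v < 2)"
  proof
    assume "rooted_power p (\<lambda>u v. {u, v} \<in> edges ?G \<and> ?c u < 2 \<and> ?c v < 2)"
    then have "rooted_power p (bip E)"
    \<comment> \<open>Blocks 0 and 1 are identified with the two tagged parts of
      \<open>bip E\<close>.\<close>
    proof (rule rooted_power_map[where f = "\<lambda>v. (v < N, v mod N)" and S = "{..<2 * N}", rotated 2])
      show "inj_on (\<lambda>v. (v < N, v mod N)) {..<2 * N}"
      proof (rule inj_onI)
        fix u v assume *: "u \<in> {..<2 * N}" "v \<in> {..<2 * N}" "(u < N, u mod N) = (v < N, v mod N)"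
        then have "u div N = v div N"
          by (cases "u < N") (auto simp: div_if less_diff_conv2 not_less)
        then show "u = v" using * by (metis div_mult_mod_eq prod.inject)
      qed
      fix u v assume uv: "{u, v} \<in> edges ?G \<and> ?c u < 2 \<and> ?c v < 2"
      then obtain u' v' where *: "{u, v} = {u', v'}" "u' < ?T" "v' < ?T" "?c u' < ?c v'"
        "?c v' = 1 \<longrightarrow> (u', v' - N) \<in> E" using edge by blast
      have low: "?c u' < 2" "?c v' < 2" using *(1) uv by (auto simp: doubleton_eq_iff)
      then have c: "?c u' = 0" "?c v' = 1" using *(4) by auto
      note l = lower_colour_low[OF kt(1) *(2) low(1)] lower_colour_low[OF kt(1) *(3) low(2)]
      have N: "N > 0" using l(1) by (cases N) auto
      have "u' div N = 0" "v' div N = 1" using l c by simp_all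
      then have d: "u' < N" "N \<le> v'" using N div_less[of v' N] by (auto simp: div_eq_0_iff not_less[symmetric])
      have m: "u' mod N = u'" "v' mod N = v' - N" using d l(3) by (auto simp: mod_if)
      have "bip E (u' < N, u' mod N) (v' < N, v' mod N)" "bip E (v' < N, v' mod N) (u' < N, u' mod N)"
        using *(5) c d unfolding m by (auto simp: bip_def)
      moreover have "(u = u' \<and> v = v') \<or> (u = v' \<and> v = u')" using *(1) by (auto simp: doubleton_eq_iff)
      ultimately show "u \<in> {..<2 * N} \<and> v \<in> {..<2 * N} \<and> bip E (u < N, u mod N) (v < N, v mod N)"
        using l by auto
    qed
    then show False using pow by simp
  qed
  moreover have "?c u \<noteq> ?c v" if "{u, v} \<in> edges ?G" for u v
    using edge[OF that] by (auto simp: doubleton_eq_iff)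
  moreover have "u = v" if "?c u = ?c v" "k \<le> ?c u" for u v
  proof -
    have "w = k * N + (?c w - k)" if "k \<le> ?c w" for w
    proof -
      have "\<not> w < k * N"
      proof
        assume "w < k * N"
        then have "?c w < k" by (simp add: lower_colour_def less_mult_imp_div_less)
        then show False using that by simp
      qed
      then show ?thesis using that kt by (auto simp: lower_colour_def split: if_splits)
    qed
    then show ?thesis using that by metis
  qed
  ultimately have "good_colouring t k p ?G ?c"
    using lower_colour_less[OF kt] unfolding good_colouring_def by blast
  then show ?thesis by (auto simp: good_def)
qed

lemma card_cliques_lower_graph:
  assumes kt: "2 \<le> k" "k \<le> t" and E: "E \<subseteq> {..<N} \<times> {..<N}" and n: "k * N + (t - k) \<le> n" and N: "N > 0"
  shows "card E * N ^ (k - 2) \<le> card (cliques t (lower_graph N k t E n))"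
proof -
  let ?G = "lower_graph N k t E n" and ?T = "k * N + (t - k)" and ?c = "lower_colour N k t"
  \<comment> \<open>The vertex of colour \<open>c\<close> in the clique given by an edge of
    \<open>E\<close> and free choices in blocks 2 to \<open>k - 1\<close>. Colours recover
    \<open>c\<close> from the vertex, so the clique determines these data.\<close>
  define \<sigma> where "\<sigma> = (\<lambda>(e, s) c. if c = 0 then fst e else if c = 1 then N + snd e
    else if c < k then c * N + s c else k * N + (c - k) :: nat)"
  let ?D = "E \<times> ({2..<k} \<rightarrow>\<^sub>E {..<N})"
  have block: "?c (c * N + x) = c" "c * N + x < k * N" if "c < k" "x < N" for c x
  proof -
    have "c * N + x < Suc c * N" using that by simp
    also have "\<dots> \<le> k * N" using that by (intro mult_le_mono1) simp
    finally show "c * N + x < k * N" .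
    then show "?c (c * N + x) = c" using that by (simp add: lower_colour_def)
  qed
  have \<sigma>: "?c (\<sigma> d c) = c" "\<sigma> d c < ?T" if d: "d \<in> ?D" and c: "c < t" for d c
  proof -
    obtain x y s where d': "d = ((x, y), s)" by (metis surj_pair)
    have xy: "x < N" "y < N" and s: "\<And>c. 2 \<le> c \<Longrightarrow> c < k \<Longrightarrow> s c < N" using d E unfolding d' by (auto simp: PiE_iff)
    consider "c = 0" | "c = 1" | "2 \<le> c" "c < k" | "k \<le> c" by linarith
    then have "?c (\<sigma> d c) = c \<and> \<sigma> d c < ?T"
    proof cases
      case 1
      then show ?thesis using block[of 0 x] xy kt by (simp add: \<sigma>_def d' trans_less_add1)
    next
      case 2
      then show ?thesis using block[of 1 y] xy kt by (simp add: \<sigma>_def d' trans_less_add1)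
    next
      case 3
      then show ?thesis using block[of c "s c"] s by (simp add: \<sigma>_def d' trans_less_add1)
    next
      case 4
      then obtain j t' where j: "c = k + j" "t = k + t'" using kt(2) by (metis le_Suc_ex)
      then show ?thesis using c kt by (simp add: \<sigma>_def d' lower_colour_def)
    qed
    then show "?c (\<sigma> d c) = c" "\<sigma> d c < ?T" by auto
  qed
  have inj\<sigma>: "inj_on (\<sigma> d) {..<t}" if "d \<in> ?D" for d
    by (rule inj_on_inverseI[where g = ?c]) (use \<sigma>(1)[OF that] in auto)
  have "(\<lambda>d. \<sigma> d ` {..<t}) ` ?D \<subseteq> cliques t ?G"
  proof (rule image_subsetI)
    fix d assume d: "d \<in> ?D"
    have edge: "{\<sigma> d c, \<sigma> d c'} \<in> edges ?G" if "c < c'" "c' < t" for c c'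
    proof -
      have "(\<sigma> d c, \<sigma> d c' - N) \<in> E" if "c' = 1"
        using d \<open>c < c'\<close> that by (auto simp: \<sigma>_def)
      then have "\<sigma> d c < ?T \<and> \<sigma> d c' < ?T \<and> ?c (\<sigma> d c) < ?c (\<sigma> d c') \<and>
          (?c (\<sigma> d c') = 1 \<longrightarrow> (\<sigma> d c, \<sigma> d c' - N) \<in> E)"
        using \<sigma>[OF d, of c] \<sigma>[OF d, of c'] that by simp
      then show ?thesis unfolding lower_graph_def sgraph.select_convs mem_Collect_eq by blast
    qed
    show "\<sigma> d ` {..<t} \<in> cliques t ?G"
      unfolding cliques_def
    proof (intro CollectI conjI ballI impI)
      show "\<sigma> d ` {..<t} \<subseteq> verts ?G" using \<sigma>(2)[OF d] n by (fastforce simp: lower_graph_def)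
      show "finite (\<sigma> d ` {..<t})" by simp
      show "card (\<sigma> d ` {..<t}) = t" using card_image[OF inj\<sigma>[OF d]] by simp
      fix u v assume "u \<in> \<sigma> d ` {..<t}" "v \<in> \<sigma> d ` {..<t}" "u \<noteq> v"
      then obtain c c' where c: "c < t" "c' < t" "u = \<sigma> d c" "v = \<sigma> d c'" "c \<noteq> c'" by auto
      then show "{u, v} \<in> edges ?G" using edge[of c c'] edge[of c' c]
        by (cases "c < c'") (auto simp: insert_commute)
    qed
  qed
  moreover have "inj_on (\<lambda>d. \<sigma> d ` {..<t}) ?D"
  proof (rule inj_onI)
    fix d d' assume d: "d \<in> ?D" "d' \<in> ?D" "\<sigma> d ` {..<t} = \<sigma> d' ` {..<t}"
    have eq: "\<sigma> d c = \<sigma> d' c" if c: "c < t" for c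
    proof -
      have "\<sigma> d c \<in> \<sigma> d' ` {..<t}" using d(3) c by blast
      then obtain c' where "c' < t" "\<sigma> d c = \<sigma> d' c'" by auto
      then have "c = c'" using \<sigma>(1)[OF d(1) c] \<sigma>(1)[OF d(2)] by metis
      then show ?thesis using \<open>\<sigma> d c = \<sigma> d' c'\<close> by simp
    qed
    obtain x y s where d1: "d = ((x, y), s)" by (metis surj_pair)
    obtain x' y' s' where d2: "d' = ((x', y'), s')" by (metis surj_pair)
    have "x = x'" "y = y'" using eq[of 0] eq[of 1] kt by (simp_all add: \<sigma>_def d1 d2)
    moreover have "s = s'"
    proof (rule PiE_ext[of s "{2..<k}" "\<lambda>_. {..<N}" s'])
      show "s \<in> {2..<k} \<rightarrow>\<^sub>E {..<N}" "s' \<in> {2..<k} \<rightarrow>\<^sub>E {..<N}" using d by (auto simp: d1 d2)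
      show "s c = s' c" if "c \<in> {2..<k}" for c using eq[of c] that kt by (simp add: \<sigma>_def d1 d2)
    qed
    ultimately show "d = d'" by (simp add: d1 d2)
  qed
  ultimately have "card ?D \<le> card (cliques t ?G)"
    using finite_cliques[OF lower_graph_simple[OF n]] by (intro card_inj_on_le)
  then show ?thesis by (simp add: card_cartesian_product card_funcsetE)
qed
end

section \<open>Realizability\<close>

lemma gen_ex_le:
  assumes "\<And>G :: nat sgraph. simple_graph G \<Longrightarrow> card (verts G) = n \<Longrightarrow> free_of \<F> G \<Longrightarrow> card (copies H G) \<le> B"
  shows "gen_ex n H \<F> \<le> B"
proof (cases "copy_counts n H \<F> = {}")
  case True
  then show ?thesis by (simp add: gen_ex_def Sup_nat_def)
next
  case False
  from gen_ex_attained(2)[OF this] show ?thesis using assms unfolding copy_counts_def by auto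
qed

lemma gen_ex_ge:
  fixes G :: "nat sgraph"
  assumes "simple_graph G" "card (verts G) = n" "free_of \<F> G"
  shows "card (copies H G) \<le> gen_ex n H \<F>"
proof -
  have mem: "card (copies H G) \<in> copy_counts n H \<F>" using assms unfolding copy_counts_def by blast
  then have "gen_ex n H \<F> = Max (copy_counts n H \<F>)" by (intro gen_ex_attained(1)) blast
  then show ?thesis using Max_ge[OF finite_copy_counts mem] by simp
qed

lemma bigtheta_powrI:
  fixes f :: "nat \<Rightarrow> nat"
  assumes "c > 0" "\<And>n. n \<ge> N \<Longrightarrow> c * real n powr r \<le> real (f n)" "\<And>n. n \<ge> N \<Longrightarrow> real (f n) \<le> C * real n powr r"
  shows "(\<lambda>n. real (f n)) \<in> \<Theta>(\<lambda>n. real n powr r)"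
proof (rule bigthetaI)
  show "(\<lambda>n. real (f n)) \<in> O(\<lambda>n. real n powr r)"
    by (rule bigoI[of _ C]) (use assms(3) in \<open>auto simp: eventually_at_top_linorder\<close>)
  show "(\<lambda>n. real (f n)) \<in> \<Omega>(\<lambda>n. real n powr r)"
    by (rule landau_omega.bigI[OF assms(1)]) (use assms(2) in \<open>auto simp: eventually_at_top_linorder\<close>)
qed

lemma realizable_complete: "t \<ge> 1 \<Longrightarrow> realizable (real t) (complete_graph t)"
  unfolding realizable_def
proof (intro exI[of _ "{}"] conjI)
  assume t: "t \<ge> 1"
  show "(\<lambda>n. real (gen_ex n (complete_graph t) {})) \<in> \<Theta>(\<lambda>n. real n powr real t)"
  proof (rule bigtheta_powrI[where N = t and c = "1 / real t ^ t" and C = 1])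
    fix n :: nat assume n: "n \<ge> t"
    define G :: "nat sgraph" where "G = \<lparr>verts = {..<n}, edges = {e. e \<subseteq> {..<n} \<and> card e = 2}\<rparr>"
    have G: "simple_graph G" by (auto simp: G_def simple_graph_def)
    have "cliques t G = {S. S \<subseteq> {..<n} \<and> card S = t}"
      by (auto simp: cliques_def G_def intro: finite_subset)
    then have "card (copies (complete_graph t) G) = n choose t"
      using card_copies_complete_graph[OF G] n_subsets[of "{..<n}" t] by simp
    moreover have "card (copies (complete_graph t) G) \<le> gen_ex n (complete_graph t) {}"
      by (rule gen_ex_ge[OF G]) (auto simp: G_def free_of_def)
    moreover have "(real n / real t) ^ t \<le> real (n choose t)" using binomial_ge_n_over_k_pow_k[OF n, where 'a = real] by simp
    ultimately have "(real n / real t) ^ t \<le> real (gen_ex n (complete_graph t) {})" by linarith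
    then show "1 / real t ^ t * real n powr real t \<le> real (gen_ex n (complete_graph t) {})"
      using n t by (simp add: powr_realpow power_divide)
    have "gen_ex n (complete_graph t) {} \<le> n ^ t"
    proof (rule gen_ex_le)
      fix G :: "nat sgraph" assume G: "simple_graph G" "card (verts G) = n"
      have fin: "finite (verts G)" using G(1) by (simp add: simple_graph_def)
      have "card (copies (complete_graph t) G) \<le> card {S. S \<subseteq> verts G \<and> card S = t}"
        unfolding card_copies_complete_graph[OF G(1)] using fin
        by (intro card_mono) (auto simp: cliques_def)
      also have "\<dots> = n choose t" using n_subsets[OF fin] G(2) by simp
      also have "\<dots> \<le> n ^ t" using n by (rule binomial_le_pow)
      finally show "card (copies (complete_graph t) G) \<le> n ^ t" .
    qed
    then have "real (gen_ex n (complete_graph t) {}) \<le> real n ^ t" by (metis of_nat_le_iff of_nat_power)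
    then show "real (gen_ex n (complete_graph t) {}) \<le> 1 * real n powr real t"
      using n t by (simp add: powr_realpow)
  qed (use t in simp)
qed auto

context caterpillar
begin

lemma powr_ratio: "(x::real) > 0 \<Longrightarrow> (x ^ b) powr (real k - real a / real b) = x powr (real b * real k - real a)"
  using b_pos by (simp add: powr_realpow[symmetric] powr_powr right_diff_distrib)

lemma gen_ex_upper:
  assumes kt: "2 \<le> k" "k \<le> t" and n: "n \<ge> 1"
  shows "real (gen_ex n (complete_graph t) (forbidden t k p (2 * t + k + k * k * (p * (b + 1))))) \<le>
    (2 ^ t * real k * (real p + 1 + real b)) * real n powr (real k - real a / real b)"
proof -
  \<comment> \<open>\<open>x ^ b\<close> equals \<open>n ^ (b - a)\<close>, the bound for the
    placements of the roots other than position 0. Rounding up \<open>p * x\<close> gives a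
    sufficient \<open>z\<close>, because \<open>p <= p ^ b\<close>.\<close>
  define x where "x = real n powr (1 - real a / real b)"
  define z where "z = nat \<lceil>real p * x\<rceil>"
  have ab: "real a / real b \<le> 1" using a_le_b b_pos by simp
  have x1: "x \<ge> 1" unfolding x_def using n ab by (intro ge_one_powr_ge_zero) auto
  have xb: "x ^ b = real n ^ (b - a)"
  proof -
    have "x ^ b = x powr real b" using x1 by (simp add: powr_realpow)
    also have "\<dots> = real n powr (real b - real a)"
      unfolding x_def powr_powr using b_pos by (simp add: left_diff_distrib)
    also have "real b - real a = real (b - a)" using a_le_b by simp
    finally show ?thesis using n by (simp add: powr_realpow)
  qed
  have zx: "real p * x \<le> real z" "real z \<le> real p * x + 1"
    unfolding z_def using x1 by (simp_all add: of_nat_nat)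
  have "p * n ^ (b - a) \<le> z ^ b"
  proof -
    have "p \<le> p ^ b" using b_pos by (cases "p = 0") (simp_all add: self_le_power)
    then have "real p \<le> real p ^ b" by (metis of_nat_le_iff of_nat_power)
    then have "real p * real n ^ (b - a) \<le> real p ^ b * x ^ b" unfolding xb by (intro mult_right_mono) auto
    also have "\<dots> \<le> real z ^ b"
      using zx(1) x1 unfolding power_mult_distrib[symmetric] by (intro power_mono) auto
    finally have "real (p * n ^ (b - a)) \<le> real (z ^ b)" by simp
    then show ?thesis by (simp only: of_nat_le_iff)
  qed
  note zpow = this
  have "gen_ex n (complete_graph t) (forbidden t k p (2 * t + k + k * k * (p * (b + 1)))) \<le>
      2 ^ t * (k * n ^ (k - 1) * (z + b))"
  proof (rule gen_ex_le)
    fix G :: "nat sgraph"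
    assume G: "simple_graph G" "card (verts G) = n" "free_of (forbidden t k p (2 * t + k + k * k * (p * (b + 1)))) G"
    show "card (copies (complete_graph t) G) \<le> 2 ^ t * (k * n ^ (k - 1) * (z + b))"
      unfolding card_copies_complete_graph[OF G(1)] G(2)[symmetric]
      by (rule card_cliques_le[OF G(1) kt good_induced[OF G(1,3)]]) (use zpow G(2) in auto)
  qed
  then have "real (gen_ex n (complete_graph t) (forbidden t k p (2 * t + k + k * k * (p * (b + 1))))) \<le>
      real (2 ^ t * (k * n ^ (k - 1) * (z + b)))" by (simp only: of_nat_le_iff)
  also have "\<dots> = 2 ^ t * real k * (real n ^ (k - 1) * (real z + real b))" by simp
  also have "\<dots> \<le> 2 ^ t * real k * (real n ^ (k - 1) * ((real p + 1 + real b) * x))"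
  proof (intro mult_left_mono)
    have "real z + real b \<le> real p * x + 1 * x + real b * x"
      using zx(2) x1 mult_left_mono[OF x1, of "real b"] by simp
    then show "real z + real b \<le> (real p + 1 + real b) * x" by (simp add: algebra_simps)
  qed auto
  also have "\<dots> = (2 ^ t * real k * (real p + 1 + real b)) * (real n ^ (k - 1) * x)" by simp
  also have "real n ^ (k - 1) * x = real n powr (real k - real a / real b)"
  proof -
    have "real n ^ (k - 1) = real n powr (real k - 1)" using n kt by (simp add: powr_realpow[symmetric] of_nat_diff)
    then show ?thesis unfolding x_def by (simp add: powr_add[symmetric])
  qed
  finally show ?thesis .
qed

text \<open>The largest scale that still fits is one below the first that does not; consecutive
  values of \<open>2 ^ (m * b)\<close> differ by the factor \<open>2 ^ b\<close>, so only a constant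
  factor of \<open>n\<close> is lost.\<close>

lemma exists_scale:
  fixes n :: nat
  assumes kt: "2 \<le> k" "k \<le> t" and n: "k * 2 ^ (m0 * b) + t \<le> n"
  shows "\<exists>m\<ge>m0. k * 2 ^ (m * b) + t \<le> n \<and> n < (k * 2 ^ b + t) * 2 ^ (m * b)"
proof -
  let ?P = "\<lambda>m. n < k * 2 ^ (m * b) + t"
  have "?P n"
  proof -
    have "n < 2 ^ n" by (rule less_exp)
    also have "(2::nat) ^ n \<le> 2 ^ (n * b)" using b_pos by (intro power_increasing) auto
    also have "\<dots> \<le> k * 2 ^ (n * b)" using kt by simp
    finally show ?thesis by simp
  qed
  define m' where "m' = (LEAST m. ?P m)"
  have m': "?P m'" unfolding m'_def by (rule LeastI[of ?P n]) fact
  have "m0 < m'"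
  proof (rule ccontr)
    assume "\<not> m0 < m'"
    then have "(2::nat) ^ (m' * b) \<le> 2 ^ (m0 * b)" by (intro power_increasing mult_right_mono) auto
    then have "k * 2 ^ (m' * b) \<le> k * 2 ^ (m0 * b)" by simp
    then show False using m' n by linarith
  qed
  then obtain m where m: "m' = Suc m" "m0 \<le> m" by (cases m') auto
  have "\<not> ?P m" using not_less_Least[of m ?P] m(1) unfolding m'_def by simp
  moreover have "n < (k * 2 ^ b + t) * 2 ^ (m * b)"
  proof -
    have "n < k * 2 ^ (Suc m * b) + t" using m' m(1) by simp
    also have "\<dots> \<le> k * 2 ^ b * 2 ^ (m * b) + t * 2 ^ (m * b)" by (simp add: power_add)
    finally show ?thesis by (simp add: algebra_simps)
  qed
  ultimately show ?thesis using m(2) by (intro exI[of _ m]) simp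
qed

lemma scale_powr_pos:
  assumes "2 \<le> k"
  shows "2 * real (k * 2 ^ b + t) powr x > 0"
proof -
  have "real (k * 2 ^ b + t) \<noteq> 0" using assms by (simp only: of_nat_eq_0_iff) simp
  then have "real (k * 2 ^ b + t) powr x > 0" by (simp only: powr_gt_zero not_False_eq_True)
  then show ?thesis by (rule mult_pos_pos[rotated]) simp
qed

text \<open>With \<open>N = (2 ^ m) ^ b\<close>, half of \<open>(2 ^ m) ^ (2 * b - a)\<close> edges
  times \<open>N ^ (k - 2)\<close> choices in the other blocks is half of
  \<open>N powr (k - a / b)\<close>, and \<open>n\<close> is at most a constant times
  \<open>N\<close>.\<close>

lemma gen_ex_lower:
  assumes kt: "2 \<le> k" "k \<le> t"
    and dense: "\<And>m. q0 \<le> (2::nat) ^ m \<Longrightarrow> \<exists>E. E \<subseteq> {..<(2 ^ m) ^ b} \<times> {..<(2 ^ m) ^ b} \<and>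
     (2 ^ m) ^ (2 * b - a) \<le> 2 * card E \<and> \<not> rooted_power p (bip (E :: (nat \<times> nat) set))"
    and n: "k * 2 ^ (q0 * b) + t \<le> n"
  shows "1 / (2 * real (k * 2 ^ b + t) powr (real k - real a / real b)) * real n powr (real k - real a / real b)
    \<le> real (gen_ex n (complete_graph t) (forbidden t k p M))"
proof -
  let ?r = "real k - real a / real b"
  obtain m where m: "m \<ge> q0" "k * 2 ^ (m * b) + t \<le> n" "n < (k * 2 ^ b + t) * 2 ^ (m * b)"
    using exists_scale[OF kt n] by blast
  define N :: nat where "N = (2 ^ m) ^ b"
  have N: "N = 2 ^ (m * b)" "N > 0" by (simp_all add: N_def power_mult)
  have "q0 \<le> m" by (rule m(1))
  also have "m \<le> 2 ^ m" using less_exp[of m] by simp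
  finally obtain E where E: "E \<subseteq> {..<N} \<times> {..<N}" "(2 ^ m) ^ (2 * b - a) \<le> 2 * card E"
    "\<not> rooted_power p (bip (E :: (nat \<times> nat) set))" using dense[of m] unfolding N_def by blast
  let ?G = "lower_graph N k t E n"
  have nT: "k * N + (t - k) \<le> n" using m(2) N by simp
  have G: "simple_graph ?G" by (rule lower_graph_simple[OF nT])
  have "card E * N ^ (k - 2) \<le> card (copies (complete_graph t) ?G)"
    unfolding card_copies_complete_graph[OF G] by (rule card_cliques_lower_graph[OF kt E(1) nT N(2)])
  also have "\<dots> \<le> gen_ex n (complete_graph t) (forbidden t k p M)"
    by (rule gen_ex_ge[OF G _ free_of_forbidden[OF good_lower_graph[OF kt E(1,3)]]]) (simp add: lower_graph_def)
  finally have low: "card E * N ^ (k - 2) \<le> gen_ex n (complete_graph t) (forbidden t k p M)" .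
  have "(2 ^ m) ^ (b * k - a) = (2 ^ m) ^ (2 * b - a) * N ^ (k - 2)"
  proof -
    have "a \<le> 2 * b" using a_le_b by simp
    moreover have "b * k = 2 * b + b * (k - 2)" using kt by (simp add: algebra_simps flip: add_mult_distrib2)
    ultimately have "b * k - a = (2 * b - a) + b * (k - 2)" by simp
    then show ?thesis unfolding N_def by (simp only: power_add power_mult[symmetric] mult.assoc)
  qed
  also have "\<dots> \<le> 2 * card E * N ^ (k - 2)" by (rule mult_right_mono[OF E(2)]) simp
  also have "\<dots> \<le> 2 * gen_ex n (complete_graph t) (forbidden t k p M)" using low by simp
  finally have "real ((2 ^ m) ^ (b * k - a)) \<le> real (2 * gen_ex n (complete_graph t) (forbidden t k p M))"
    by (simp only: of_nat_le_iff)
  then have 1: "real (2 ^ m) ^ (b * k - a) \<le> 2 * real (gen_ex n (complete_graph t) (forbidden t k p M))" by simp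
  have "a \<le> b * k" using a_le_b kt by (metis le_trans mult.right_neutral mult_le_mono2 one_le_numeral)
  then have 2: "real (2 ^ m) ^ (b * k - a) = real N powr ?r"
    using powr_ratio[of "real (2 ^ m)" k] by (simp add: powr_realpow[symmetric] of_nat_diff N_def)
  have "real a / real b \<le> 1" "real k \<ge> 2" using a_le_b b_pos kt by simp_all
  then have "?r \<ge> 0" by linarith
  moreover have "real n \<le> real (k * 2 ^ b + t) * real N" using m(3) N by (metis less_imp_le of_nat_le_iff of_nat_mult)
  ultimately have "real n powr ?r \<le> (real (k * 2 ^ b + t) * real N) powr ?r" by (intro powr_mono2) auto
  also have "\<dots> = real (k * 2 ^ b + t) powr ?r * real N powr ?r" by (rule powr_mult)
  also have "\<dots> \<le> real (k * 2 ^ b + t) powr ?r * (2 * real (gen_ex n (complete_graph t) (forbidden t k p M)))"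
    using 1 unfolding 2 by (intro mult_left_mono) auto
  finally have "real n powr ?r \<le> (2 * real (k * 2 ^ b + t) powr ?r) * real (gen_ex n (complete_graph t) (forbidden t k p M))"
    by (simp add: mult_ac)
  moreover have "2 * real (k * 2 ^ b + t) powr ?r > 0" by (rule scale_powr_pos[OF kt(1)])
  ultimately show ?thesis by (simp add: pos_divide_le_eq mult.commute)
qed

lemma realizable_ratio:
  assumes kt: "2 \<le> k" "k \<le> t"
  shows "realizable (real k - real a / real b) (complete_graph t)"
proof -
  obtain p q0 where dense: "\<And>m. q0 \<le> (2::nat) ^ m \<Longrightarrow> \<exists>E. E \<subseteq> {..<(2 ^ m) ^ b} \<times> {..<(2 ^ m) ^ b} \<and>
     (2 ^ m) ^ (2 * b - a) \<le> 2 * card E \<and> \<not> rooted_power p (bip (E :: (nat \<times> nat) set))"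
    using exists_dense_bipartite_nat by blast
  let ?F = "forbidden t k p (2 * t + k + k * k * (p * (b + 1)))"
  show ?thesis
    unfolding realizable_def
  proof (intro exI[of _ ?F] conjI)
    show "finite ?F" by (rule finite_forbidden)
    show "\<forall>F\<in>?F. simple_graph F" by (simp add: forbidden_def)
    show "(\<lambda>n. real (gen_ex n (complete_graph t) ?F)) \<in> \<Theta>(\<lambda>n. real n powr (real k - real a / real b))"
    proof (rule bigtheta_powrI[OF _ gen_ex_lower[OF kt dense] gen_ex_upper[OF kt]])
      show "1 / (2 * real (k * 2 ^ b + t) powr (real k - real a / real b)) > 0"
        by (rule divide_pos_pos[OF zero_less_one scale_powr_pos[OF kt(1)]])
      show "n \<ge> 1" if "k * 2 ^ (q0 * b) + t \<le> n" for n using that kt by simp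
    qed
  qed
qed
end

theorem theorem1p2:
  fixes t :: nat and r :: real
  assumes "t \<ge> 2" and "r \<in> \<rat>" and "1 \<le> r" and "r \<le> real t"
  shows "realizable r (complete_graph t)"
proof (cases "r = real t")
  case True
  then show ?thesis using realizable_complete[of t] assms(1) by simp
next
  case False
  \<comment> \<open>The floor plus one, not the ceiling, so that \<open>k - r\<close> is positive;
    an integer \<open>r\<close> below \<open>t\<close> gets \<open>a / b = 1\<close>.\<close>
  define k where "k = nat \<lfloor>r\<rfloor> + 1"
  have "real k = real_of_int \<lfloor>r\<rfloor> + 1" using assms(3) by (simp add: k_def)
  then have k: "real k - 1 \<le> r" "r < real k" by linarith+
  have "real 1 < real k" "real k < real (t + 1)" using k assms(3,4) False by simp_all
  then have kt: "2 \<le> k" "k \<le> t" unfolding of_nat_less_iff by simp_all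
  have "real k - r \<in> \<rat>" using assms(2) by simp
  then obtain a b :: nat where ab: "b \<noteq> 0" "\<bar>real k - r\<bar> = real a / real b"
    by (rule Rats_abs_nat_div_natE)
  then have r: "r = real k - real a / real b" using k by simp
  have "real a / real b > 0" "real a / real b \<le> 1" using k r by simp_all
  then have "1 \<le> a" "a \<le> b" using ab(1) by (simp_all add: zero_less_divide_iff)
  then interpret caterpillar a b by unfold_locales
  show ?thesis unfolding r by (rule realizable_ratio[OF kt])
qed

end
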